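(* Let $\mathbf{S}_0$ be the $2$-adic Banach space of $2^{-1/2}$-overconvergent cuspidal $2$-adic modular forms of weight $0$ and tame level $1$ over $\mathbf{Q}_2$, with its compact operator $U=U_2$. Let $|\lambda_1|\ge|\lambda_2|\ge|\lambda_3|\ge\cdots$ be the non-zero eigenvalues (with multiplicities) of $U$ on $\mathbf{S}_0$. Then for every $n\ge1$ the slope of $\lambda_n$ is given by $$v_2(\lambda_n)=1+2\,v_2\!\left(\frac{(3n)!}{n!}\right).$$
   Context: Let $\Delta(\tau)=q\prod_{n\ge1}(1-q^n)^{24}$, $q=e^{2\pi i\tau}$, $f(\tau)=\Delta(2\tau)/\Delta(\tau)=q+24q^2+\cdots$ and $g=2^6f$. The space $\mathbf{M}_0$ of $2^{-1/2}$-overconvergent $2$-adic modular forms of weight $0$ and tame level $1$ is the Banach space (with supremum norm) of rigid analytic functions over $\mathbf{Q}_2$ on the affinoid $X_0(1)_{\ge 2^{-1/2}}$ of the level one modular curve obtained by removing the open disc of radius $2^{-1/2}$ (in the sense of a suitable local parameter after adding auxiliary level structure) over the supersingular point. Concretely this affinoid is the region $\{|j|\ge 2^{-6}\}$ of the $j$-line, and it is identified (preserving $q$-expansions) with the region $\{|g|\le 1\}$ of $X_0(2)$; thus $\mathbf{M}_0$ is the space of series $\sum_{n\ge0}a_ng^n$ with $a_n\in\mathbf{Q}_2$, $a_n\to0$, with norm $\max_n|a_n|$. The subspace $\mathbf{S}_0=\mathbf{S}_0(\mathrm{SL}_2(\mathbf{Z});\mathbf{Q}_2;2^{-1/2})$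 consists of the elements whose $q$-expansion has zero constant term, i.e. the series $\sum_{n\ge1}a_ng^n$ with $a_n\to 0$. The operator $U$ acts on $q$-expansions by $U(\sum a_nq^n)=\sum a_{2n}q^n$; it is a compact operator on $\mathbf{M}_0$ preserving $\mathbf{S}_0$. Its non-zero eigenvalues with multiplicities (in $\mathbf{C}_2$, the completion of an algebraic closure of $\mathbf{Q}_2$) are the inverses of the zeros, with multiplicity, of its characteristic (Fredholm) power series $\det(1-XU)$. Here $v_2$ is the $2$-adic valuation with $v_2(2)=1$, extended to $\mathbf{C}_2$, and the slope of a non-zero eigenvalue is its $2$-adic valuation. *)

theory Defs
  imports "HOL-Analysis.Analysis"
begin

section \<open>Fields with a non-archimedean absolute value\<close>

class nonarch_field = field + metric_space +
  fixes vabs :: "'a \<Rightarrow> real"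
  assumes dist_vabs: "dist x y = vabs (x - y)"
    and vabs_mult: "vabs (x * y) = vabs x * vabs y"
    and vabs_add: "vabs (x + y) \<le> max (vabs x) (vabs y)"

section \<open>The field of 2-adic numbers\<close>

subsection \<open>The 2-adic absolute value on the rationals\<close>

definition abs2 :: "rat \<Rightarrow> real" where
  "abs2 x = (if x = 0 then 0 else
     2 powi (int (multiplicity 2 (snd (quotient_of x))) - int (multiplicity 2 (fst (quotient_of x)))))"

lemma abs2_divide:
  assumes "a \<noteq> 0" "b \<noteq> 0"
  shows "abs2 (of_int a / of_int b) = 2 powi (int (multiplicity 2 b) - int (multiplicity 2 a))"
proof -
  define x :: rat where "x = of_int a / of_int b"
  obtain c d where cd: "quotient_of x = (c, d)"
    by (cases "quotient_of x")
  have d: "d > 0" and x: "x = of_int c / of_int d"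
    using quotient_of_denom_pos[OF cd] quotient_of_div[OF cd] by auto
  have "x \<noteq> 0" using assms by (simp add: x_def)
  hence c: "c \<noteq> 0" using x by auto
  have "(of_int (a * d) :: rat) = of_int (c * b)"
    using x assms d by (simp add: x_def field_simps)
  hence eq: "a * d = c * b" by (simp only: of_int_eq_iff)
  have p: "prime_elem (2::int)" by simp
  have "multiplicity 2 a + multiplicity 2 d = multiplicity 2 c + multiplicity 2 b"
    using arg_cong[OF eq, of "multiplicity 2"] assms c d
    by (simp add: prime_elem_multiplicity_mult_distrib[OF p])
  hence "int (multiplicity 2 d) - int (multiplicity 2 c) = int (multiplicity 2 b) - int (multiplicity 2 a)"
    by linarith
  thus ?thesis using \<open>x \<noteq> 0\<close>
    unfolding abs2_def x_def[symmetric] by (simp add: cd)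
qed

lemma abs2_0 [simp]: "abs2 0 = 0"
  by (simp add: abs2_def)

lemma abs2_1 [simp]: "abs2 1 = 1"
  using abs2_divide[of 1 1] by simp

lemma abs2_nonneg [simp]: "abs2 x \<ge> 0"
  by (simp add: abs2_def)

lemma abs2_eq_0_iff [simp]: "abs2 x = 0 \<longleftrightarrow> x = 0"
  by (simp add: abs2_def)

lemma rat_cases_int:
  fixes x :: rat
  obtains a b :: int where "b \<noteq> 0" "x = of_int a / of_int b"
proof (cases "quotient_of x")
  case (Pair a b)
  thus ?thesis
    using that[of b a] quotient_of_denom_pos[OF Pair] quotient_of_div[OF Pair] by simp
qed

lemma abs2_mult: "abs2 (x * y) = abs2 x * abs2 y"
proof (cases "x = 0 \<or> y = 0")
  case False
  obtain a b where b: "b \<noteq> 0" and x: "x = of_int a / of_int b" by (rule rat_cases_int)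
  obtain c d where d: "d \<noteq> 0" and y: "y = of_int c / of_int d" by (rule rat_cases_int)
  have ac: "a \<noteq> 0" "c \<noteq> 0" using False x y by auto
  have xy: "x * y = of_int (a * c) / of_int (b * d)" by (simp add: x y)
  have p: "prime_elem (2::int)" by simp
  have "abs2 (x * y) = 2 powi (int (multiplicity 2 (b * d)) - int (multiplicity 2 (a * c)))"
    unfolding xy by (rule abs2_divide) (use ac b d in auto)
  also have "int (multiplicity 2 (b * d)) - int (multiplicity 2 (a * c)) =
      (int (multiplicity 2 b) - int (multiplicity 2 a)) + (int (multiplicity 2 d) - int (multiplicity 2 c))"
    using ac b d by (simp add: prime_elem_multiplicity_mult_distrib[OF p])
  also have "2 powi \<dots> = abs2 x * abs2 y"
    unfolding x y using ac b d by (simp add: abs2_divide power_int_add)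
  finally show ?thesis .
qed auto

lemma abs2_add: "abs2 (x + y) \<le> max (abs2 x) (abs2 y)"
proof (cases "x = 0 \<or> y = 0 \<or> x + y = 0")
  case True
  thus ?thesis by (auto simp: le_max_iff_disj)
next
  case False
  obtain a' b' where b': "b' \<noteq> 0" and x': "x = of_int a' / of_int b'" by (rule rat_cases_int)
  obtain c' d' where d': "d' \<noteq> 0" and y': "y = of_int c' / of_int d'" by (rule rat_cases_int)
  define a b c where "a = a' * d'" and "b = b' * d'" and "c = c' * b'"
  have b: "b \<noteq> 0" and x: "x = of_int a / of_int b" and y: "y = of_int c / of_int b"
    using b' d' by (auto simp: a_def b_def c_def x' y')
  have xy: "x + y = of_int (a + c) / of_int b" by (simp add: x y add_divide_distrib)
  have nz: "a \<noteq> 0" "c \<noteq> 0" "a + c \<noteq> 0"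
    using False unfolding xy by (auto simp: x y simp del: of_int_add)
  define k where "k = min (multiplicity 2 a) (multiplicity 2 c)"
  have "2 ^ k dvd a" "2 ^ k dvd c"
    by (auto simp: k_def intro!: multiplicity_dvd')
  hence "2 ^ k dvd a + c" by simp
  hence "k \<le> multiplicity 2 (a + c)"
    using nz by (intro multiplicity_geI) auto
  hence "2 powi (int (multiplicity 2 b) - int (multiplicity 2 (a + c)))
      \<le> (2 :: real) powi (int (multiplicity 2 b) - int k)"
    by (intro power_int_increasing) auto
  also have "\<dots> \<le> max (abs2 x) (abs2 y)"
    unfolding x y using nz b by (simp add: abs2_divide k_def min_def)
  finally show ?thesis
    unfolding xy abs2_divide[OF nz(3) b] .
qed

lemma abs2_minus [simp]: "abs2 (- x) = abs2 x"
proof -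
  have "abs2 (- 1) * abs2 (- 1) = 1"
    by (simp flip: abs2_mult)
  hence "abs2 (- 1) = 1"
    using abs2_nonneg[of "-1"] by (simp add: square_eq_1_iff)
  thus ?thesis using abs2_mult[of "-1" x] by simp
qed

lemma abs2_minus_commute: "abs2 (x - y) = abs2 (y - x)"
  using abs2_minus[of "x - y"] by simp

lemma abs2_triangle: "abs2 (x + y) \<le> abs2 x + abs2 y"
  using abs2_add[of x y] abs2_nonneg[of x] abs2_nonneg[of y] by linarith

lemma abs2_abs_diff: "\<bar>abs2 x - abs2 y\<bar> \<le> abs2 (x - y)"
  using abs2_triangle[of "x - y" y] abs2_triangle[of "y - x" x] abs2_minus_commute[of x y] by simp

lemma abs2_inverse: "abs2 (inverse x) = inverse (abs2 x)"
proof (cases "x = 0")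
  case False
  hence "abs2 x * abs2 (inverse x) = 1"
    by (simp flip: abs2_mult)
  thus ?thesis by (metis inverse_unique)
qed auto


subsection \<open>Completion\<close>

definition cauchy2 :: "(nat \<Rightarrow> rat) \<Rightarrow> bool" where
  "cauchy2 X \<longleftrightarrow> (\<forall>e>0. \<exists>k. \<forall>m\<ge>k. \<forall>n\<ge>k. abs2 (X m - X n) < e)"

definition null2 :: "(nat \<Rightarrow> rat) \<Rightarrow> bool" where
  "null2 X \<longleftrightarrow> (\<lambda>n. abs2 (X n)) \<longlonglongrightarrow> 0"

lemma null2_bound:
  assumes "(f \<longlongrightarrow> 0) sequentially" "\<And>n. abs2 (X n) \<le> f n"
  shows "null2 X"
  unfolding null2_def
  by (rule tendsto_sandwich[OF _ _ tendsto_const assms(1)]) (auto simp: assms(2))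

lemma null2_0 [simp]: "null2 (\<lambda>n. 0)"
  by (simp add: null2_def)

lemma null2_const [simp]: "null2 (\<lambda>n. c) \<longleftrightarrow> c = 0"
  by (simp add: null2_def tendsto_const_iff)

lemma null2_add: "null2 X \<Longrightarrow> null2 Y \<Longrightarrow> null2 (\<lambda>n. X n + Y n)"
  by (rule null2_bound[where f = "\<lambda>n. abs2 (X n) + abs2 (Y n)"])
     (auto simp: null2_def abs2_triangle intro: tendsto_add_zero)

lemma null2_minus [simp]: "null2 (\<lambda>n. - X n) \<longleftrightarrow> null2 X"
  by (simp add: null2_def)

lemma null2_diff: "null2 X \<Longrightarrow> null2 Y \<Longrightarrow> null2 (\<lambda>n. X n - Y n)"
  using null2_add[of X "\<lambda>n. - Y n"] by simp

lemma null2_mult_bounded: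
  assumes "\<And>n. abs2 (X n) \<le> B" "null2 Y"
  shows "null2 (\<lambda>n. X n * Y n)"
proof (rule null2_bound)
  show "(\<lambda>n. B * abs2 (Y n)) \<longlonglongrightarrow> 0"
    using assms(2) by (auto simp: null2_def intro: tendsto_mult_right_zero)
qed (auto simp: abs2_mult intro: mult_right_mono assms)

lemma cauchy2_const [simp]: "cauchy2 (\<lambda>n. c)"
  by (simp add: cauchy2_def)

lemma cauchy2_add:
  assumes "cauchy2 X" "cauchy2 Y"
  shows "cauchy2 (\<lambda>n. X n + Y n)"
  unfolding cauchy2_def
proof (intro allI impI)
  fix e :: real assume e: "e > 0"
  obtain k where k: "\<forall>m\<ge>k. \<forall>n\<ge>k. abs2 (X m - X n) < e"
    using assms(1) e by (auto simp: cauchy2_def)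
  obtain l where l: "\<forall>m\<ge>l. \<forall>n\<ge>l. abs2 (Y m - Y n) < e"
    using assms(2) e by (auto simp: cauchy2_def)
  have "abs2 (X m + Y m - (X n + Y n)) < e" if "m \<ge> max k l" "n \<ge> max k l" for m n
    using abs2_add[of "X m - X n" "Y m - Y n"] that k l
    by (simp add: algebra_simps) (meson le_less_trans max_less_iff_conj)
  thus "\<exists>k. \<forall>m\<ge>k. \<forall>n\<ge>k. abs2 (X m + Y m - (X n + Y n)) < e" by blast
qed

lemma cauchy2_minus: "cauchy2 X \<Longrightarrow> cauchy2 (\<lambda>n. - X n)"
  unfolding cauchy2_def by (metis abs2_minus minus_diff_minus)

lemma cauchy2_abs2_Cauchy:
  assumes "cauchy2 X"
  shows "Cauchy (\<lambda>n. abs2 (X n))"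
proof (rule metric_CauchyI)
  fix e :: real assume "e > 0"
  then obtain k where "\<forall>m\<ge>k. \<forall>n\<ge>k. abs2 (X m - X n) < e"
    using assms by (auto simp: cauchy2_def)
  thus "\<exists>M. \<forall>m\<ge>M. \<forall>n\<ge>M. dist (abs2 (X m)) (abs2 (X n)) < e"
    unfolding dist_real_def by (meson abs2_abs_diff le_less_trans)
qed

lemma cauchy2_LIMSEQ: "cauchy2 X \<Longrightarrow> (\<lambda>n. abs2 (X n)) \<longlonglongrightarrow> lim (\<lambda>n. abs2 (X n))"
  using cauchy2_abs2_Cauchy Cauchy_convergent convergent_LIMSEQ_iff by blast

lemma cauchy2_bounded:
  assumes "cauchy2 X"
  obtains B where "B > 0" "\<And>n. abs2 (X n) \<le> B"
proof -
  have "Bseq (\<lambda>n. abs2 (X n))"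
    using cauchy2_abs2_Cauchy[OF assms] by (rule Cauchy_Bseq)
  then obtain B where "B > 0" "\<And>n. norm (abs2 (X n)) \<le> B"
    by (auto simp: Bseq_def)
  thus ?thesis using that[of B] by simp
qed

lemma cauchy2_mult:
  assumes X: "cauchy2 X" and Y: "cauchy2 Y"
  shows "cauchy2 (\<lambda>n. X n * Y n)"
  unfolding cauchy2_def
proof (intro allI impI)
  fix e :: real assume e: "e > 0"
  obtain A where A: "A > 0" "\<And>n. abs2 (X n) \<le> A" using cauchy2_bounded[OF X] by blast
  obtain B where B: "B > 0" "\<And>n. abs2 (Y n) \<le> B" using cauchy2_bounded[OF Y] by blast
  obtain k where k: "\<forall>m\<ge>k. \<forall>n\<ge>k. abs2 (X m - X n) < e / B"
    using X e B(1) unfolding cauchy2_def by (meson divide_pos_pos)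
  obtain l where l: "\<forall>m\<ge>l. \<forall>n\<ge>l. abs2 (Y m - Y n) < e / A"
    using Y e A(1) unfolding cauchy2_def by (meson divide_pos_pos)
  have "abs2 (X m * Y m - X n * Y n) < e" if mn: "m \<ge> max k l" "n \<ge> max k l" for m n
  proof -
    have "abs2 (X m) * abs2 (Y m - Y n) \<le> A * abs2 (Y m - Y n)"
      by (intro mult_right_mono A) auto
    also have "\<dots> < e" using l mn A(1) by (simp add: field_simps)
    finally have 1: "abs2 (X m * (Y m - Y n)) < e" by (simp add: abs2_mult)
    have "abs2 (X m - X n) * abs2 (Y n) \<le> abs2 (X m - X n) * B"
      by (intro mult_left_mono B) auto
    also have "\<dots> < e" using k mn B(1) by (simp add: field_simps)
    finally have 2: "abs2 ((X m - X n) * Y n) < e" by (simp add: abs2_mult)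
    have "X m * Y m - X n * Y n = X m * (Y m - Y n) + (X m - X n) * Y n"
      by (simp add: algebra_simps)
    also have "abs2 \<dots> < e"
      using abs2_add[of "X m * (Y m - Y n)" "(X m - X n) * Y n"] 1 2 by linarith
    finally show ?thesis .
  qed
  thus "\<exists>k. \<forall>m\<ge>k. \<forall>n\<ge>k. abs2 (X m * Y m - X n * Y n) < e" by blast
qed

lemma cauchy2_not_null2:
  assumes "cauchy2 X" "\<not> null2 X"
  obtains b k where "b > 0" "\<And>n. n \<ge> k \<Longrightarrow> b < abs2 (X n)"
proof -
  define L where "L = lim (\<lambda>n. abs2 (X n))"
  have L: "(\<lambda>n. abs2 (X n)) \<longlonglongrightarrow> L"
    unfolding L_def by (rule cauchy2_LIMSEQ) fact
  have "L \<ge> 0" by (rule LIMSEQ_le_const[OF L]) auto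
  moreover have "L \<noteq> 0" using L assms(2) by (auto simp: null2_def)
  ultimately have "L > 0" by simp
  hence "eventually (\<lambda>n. L / 2 < abs2 (X n)) sequentially"
    by (intro order_tendstoD[OF L]) auto
  thus ?thesis
    using that[of "L / 2"] \<open>L > 0\<close> by (auto simp: eventually_sequentially)
qed

lemma cauchy2_inverse:
  assumes X: "cauchy2 X" "\<not> null2 X"
  shows "cauchy2 (\<lambda>n. inverse (X n))"
  unfolding cauchy2_def
proof (intro allI impI)
  fix e :: real assume e: "e > 0"
  obtain b k where b: "b > 0" "\<And>n. n \<ge> k \<Longrightarrow> b < abs2 (X n)"
    using cauchy2_not_null2[OF X] by blast
  obtain l where l: "\<forall>m\<ge>l. \<forall>n\<ge>l. abs2 (X m - X n) < e * (b * b)"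
    using X(1) e b(1) unfolding cauchy2_def by (metis mult_pos_pos)
  have "abs2 (inverse (X m) - inverse (X n)) < e" if mn: "m \<ge> max k l" "n \<ge> max k l" for m n
  proof -
    have bm: "b < abs2 (X m)" and bn: "b < abs2 (X n)" using b(2) mn by auto
    hence nz: "X m \<noteq> 0" "X n \<noteq> 0" using b(1) by force+
    have "inverse (X m) - inverse (X n) = (X n - X m) * inverse (X m * X n)"
      using nz by (simp add: field_simps)
    hence "abs2 (inverse (X m) - inverse (X n)) = abs2 (X n - X m) / (abs2 (X m) * abs2 (X n))"
      by (simp only: abs2_mult abs2_inverse divide_inverse)
    also have "\<dots> < e"
    proof -
      have "abs2 (X n - X m) < e * (b * b)" using l mn by simp
      also have "\<dots> \<le> e * (abs2 (X m) * abs2 (X n))"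
        using e b(1) bm bn by (intro mult_left_mono mult_mono) auto
      finally have "abs2 (X n - X m) < e * (abs2 (X m) * abs2 (X n))" .
      moreover have "abs2 (X m) * abs2 (X n) > 0"
        using bm bn b(1) by (intro mult_pos_pos) auto
      ultimately show ?thesis by (simp only: pos_divide_less_eq)
    qed
    finally show ?thesis .
  qed
  thus "\<exists>k. \<forall>m\<ge>k. \<forall>n\<ge>k. abs2 (inverse (X m) - inverse (X n)) < e" by blast
qed

definition rel2 :: "(nat \<Rightarrow> rat) \<Rightarrow> (nat \<Rightarrow> rat) \<Rightarrow> bool" where
  "rel2 X Y \<longleftrightarrow> cauchy2 X \<and> cauchy2 Y \<and> null2 (\<lambda>n. X n - Y n)"

lemma rel2_refl: "cauchy2 X \<Longrightarrow> rel2 X X"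
  by (simp add: rel2_def)

lemma part_equivp_rel2: "part_equivp rel2"
proof (rule part_equivpI)
  show "\<exists>x. rel2 x x" by (auto intro: rel2_refl cauchy2_const)
  show "symp rel2"
    by (auto simp: symp_def rel2_def null2_def abs2_minus_commute)
  show "transp rel2"
    unfolding transp_def rel2_def by (force dest: null2_add)
qed

quotient_type Q2 = "nat \<Rightarrow> rat" / partial: rel2
  morphisms rep_Q2 Q2_of_seq
  by (rule part_equivp_rel2)

lemma Domainp_pcr_Q2 [transfer_domain_rule]: "Domainp pcr_Q2 = cauchy2"
  by (simp add: Q2.domain_eq rel2_def)

instantiation Q2 :: field
begin

lift_definition zero_Q2 :: Q2 is "\<lambda>n. 0"
  by (simp add: rel2_refl)

lift_definition one_Q2 :: Q2 is "\<lambda>n. 1"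
  by (simp add: rel2_refl)

lift_definition plus_Q2 :: "Q2 \<Rightarrow> Q2 \<Rightarrow> Q2" is "\<lambda>X Y n. X n + Y n"
proof -
  fix X X' Y Y' assume *: "rel2 X X'" "rel2 Y Y'"
  hence "null2 (\<lambda>n. (X n - X' n) + (Y n - Y' n))"
    by (intro null2_add) (auto simp: rel2_def)
  also have "(\<lambda>n. (X n - X' n) + (Y n - Y' n)) = (\<lambda>n. (X n + Y n) - (X' n + Y' n))"
    by (auto simp: algebra_simps)
  finally show "rel2 (\<lambda>n. X n + Y n) (\<lambda>n. X' n + Y' n)"
    using * by (simp add: rel2_def cauchy2_add)
qed

lift_definition uminus_Q2 :: "Q2 \<Rightarrow> Q2" is "\<lambda>X n. - X n"
proof -
  fix X X' assume *: "rel2 X X'"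
  hence "null2 (\<lambda>n. - (X n - X' n))"
    unfolding null2_minus by (simp add: rel2_def)
  also have "(\<lambda>n. - (X n - X' n)) = (\<lambda>n. - X n - - X' n)"
    by auto
  finally show "rel2 (\<lambda>n. - X n) (\<lambda>n. - X' n)"
    using * by (simp add: rel2_def cauchy2_minus)
qed

lift_definition times_Q2 :: "Q2 \<Rightarrow> Q2 \<Rightarrow> Q2" is "\<lambda>X Y n. X n * Y n"
proof -
  fix X X' Y Y' assume *: "rel2 X X'" "rel2 Y Y'"
  obtain A where A: "\<And>n. abs2 (X n) \<le> A" using * cauchy2_bounded[of X] by (auto simp: rel2_def)
  obtain B where B: "\<And>n. abs2 (Y' n) \<le> B" using * cauchy2_bounded[of Y'] by (auto simp: rel2_def)
  have "null2 (\<lambda>n. X n * (Y n - Y' n) + Y' n * (X n - X' n))"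
    using * by (intro null2_add null2_mult_bounded[OF A] null2_mult_bounded[OF B]) (auto simp: rel2_def)
  also have "(\<lambda>n. X n * (Y n - Y' n) + Y' n * (X n - X' n)) = (\<lambda>n. X n * Y n - X' n * Y' n)"
    by (auto simp: algebra_simps)
  finally show "rel2 (\<lambda>n. X n * Y n) (\<lambda>n. X' n * Y' n)"
    using * by (auto simp: rel2_def cauchy2_mult)
qed

lift_definition inverse_Q2 :: "Q2 \<Rightarrow> Q2"
  is "\<lambda>X. if null2 X then (\<lambda>n. 0) else (\<lambda>n. inverse (X n))"
proof -
  fix X Y assume *: "rel2 X Y"
  hence X: "cauchy2 X" and Y: "cauchy2 Y" and XY: "null2 (\<lambda>n. X n - Y n)"
    by (auto simp: rel2_def)
  have iff: "null2 X \<longleftrightarrow> null2 Y"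
    using null2_diff[OF _ XY, of X] null2_add[OF _ XY, of Y] by auto
  have "rel2 (\<lambda>n. inverse (X n)) (\<lambda>n. inverse (Y n))" if nX: "\<not> null2 X"
  proof -
    have nY: "\<not> null2 Y" using iff nX by simp
    note iX = cauchy2_inverse[OF X nX] and iY = cauchy2_inverse[OF Y nY]
    obtain A where A: "\<And>n. abs2 (inverse (X n) * inverse (Y n)) \<le> A"
      using cauchy2_bounded[OF cauchy2_mult[OF iX iY]] by blast
    obtain b k where bk: "b > 0" "\<And>n. n \<ge> k \<Longrightarrow> b < abs2 (X n)"
      using cauchy2_not_null2[OF X nX] by blast
    obtain c l where cl: "c > 0" "\<And>n. n \<ge> l \<Longrightarrow> c < abs2 (Y n)"
      using cauchy2_not_null2[OF Y nY] by blast
    have 1: "null2 (\<lambda>n. inverse (X n) * inverse (Y n) * (Y n - X n))"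
      using XY by (intro null2_mult_bounded[OF A]) (auto simp: null2_def abs2_minus_commute)
    have "eventually (\<lambda>n. inverse (X n) * inverse (Y n) * (Y n - X n) = inverse (X n) - inverse (Y n))
        sequentially"
      using eventually_ge_at_top[of "max k l"]
    proof eventually_elim
      case (elim n)
      hence "X n \<noteq> 0" "Y n \<noteq> 0" using bk(2)[of n] cl(2)[of n] bk(1) cl(1) by auto
      thus ?case by (simp add: field_simps)
    qed
    hence "eventually (\<lambda>n. abs2 (inverse (X n) * inverse (Y n) * (Y n - X n)) =
             abs2 (inverse (X n) - inverse (Y n))) sequentially"
      by eventually_elim simp
    hence "null2 (\<lambda>n. inverse (X n) - inverse (Y n))"
      using 1 unfolding null2_def by (simp cong: tendsto_cong)
    thus ?thesis using iX iY by (simp add: rel2_def)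
  qed
  thus "?thesis X Y" using iff by (auto simp: rel2_refl)
qed

definition "x - y = x + - y" for x y :: Q2

definition "x div y = x * inverse y" for x y :: Q2

instance
proof
  fix a b c :: Q2
  show "a + b = b + a"
    by transfer (auto simp: rel2_def add.commute cauchy2_add)
  show "(a + b) + c = a + (b + c)"
    by transfer (auto simp: rel2_def add.assoc cauchy2_add)
  show "0 + a = a"
    by transfer (auto simp: rel2_def)
  show "- a + a = 0"
    by transfer (auto simp: rel2_def)
  show "a - b = a + - b"
    by (rule minus_Q2_def)
  show "(a * b) * c = a * (b * c)"
    by transfer (auto simp: rel2_def mult.assoc cauchy2_mult)
  show "a * b = b * a"
    by transfer (auto simp: rel2_def mult.commute cauchy2_mult)
  show "1 * a = a"
    by transfer (auto simp: rel2_def)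
  show "(a + b) * c = a * c + b * c"
    by transfer (auto simp: rel2_def algebra_simps cauchy2_mult cauchy2_add)
  show "(0::Q2) \<noteq> 1"
    by transfer (auto simp: rel2_def)
  show "a \<noteq> 0 \<Longrightarrow> inverse a * a = 1"
  proof transfer
    fix X assume X: "cauchy2 X" "\<not> rel2 X (\<lambda>n. 0)"
    hence nX: "\<not> null2 X" by (simp add: rel2_def)
    obtain b k where bk: "b > 0" "\<And>n. n \<ge> k \<Longrightarrow> b < abs2 (X n)"
      using cauchy2_not_null2[OF X(1) nX] by blast
    have "eventually (\<lambda>n. 0 = abs2 (inverse (X n) * X n - 1)) sequentially"
      using eventually_ge_at_top[of k]
    proof eventually_elim
      case (elim n)
      hence "X n \<noteq> 0" using bk(2)[of n] bk(1) by auto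
      thus ?case by simp
    qed
    hence "null2 (\<lambda>n. inverse (X n) * X n - 1)"
      unfolding null2_def by (rule Lim_transform_eventually[OF tendsto_const])
    thus "rel2 (\<lambda>n. (if null2 X then \<lambda>n. 0 else (\<lambda>n. inverse (X n))) n * X n) (\<lambda>n. 1)"
      using X(1) nX by (simp add: rel2_def cauchy2_mult cauchy2_inverse)
  qed
  show "a div b = a * inverse b"
    by (rule divide_Q2_def)
  show "inverse (0::Q2) = 0"
    by transfer (simp add: rel2_def)
qed

end

instantiation Q2 :: nonarch_field
begin

lift_definition vabs_Q2 :: "Q2 \<Rightarrow> real" is "\<lambda>X. lim (\<lambda>n. abs2 (X n))"
proof -
  fix X Y assume "rel2 X Y"
  hence X: "cauchy2 X" and Y: "cauchy2 Y" and XY: "(\<lambda>n. abs2 (X n - Y n)) \<longlonglongrightarrow> 0"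
    by (auto simp: rel2_def null2_def)
  have "(\<lambda>n. abs2 (X n) - abs2 (Y n)) \<longlonglongrightarrow> 0"
    by (rule tendsto_rabs_zero_cancel, rule tendsto_sandwich[OF _ _ tendsto_const XY])
       (auto simp: abs2_abs_diff)
  with tendsto_diff[OF cauchy2_LIMSEQ[OF X] cauchy2_LIMSEQ[OF Y]]
  show "lim (\<lambda>n. abs2 (X n)) = lim (\<lambda>n. abs2 (Y n))"
    using LIMSEQ_unique by fastforce
qed

definition "dist x y = vabs (x - y)" for x y :: Q2

definition "uniformity = (INF e\<in>{0 <..}. principal {(x :: Q2, y). dist x y < e})"

definition "open U \<longleftrightarrow> (\<forall>x\<in>U. \<forall>\<^sub>F (x', y) in uniformity. x' = x \<longrightarrow> y \<in> U)" for U :: "Q2 set"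

instance
proof
  have vabs_0: "vabs x = 0 \<longleftrightarrow> x = 0" for x :: Q2
  proof (transfer)
    fix X assume X: "cauchy2 X"
    have "lim (\<lambda>n. abs2 (X n)) = 0 \<longleftrightarrow> null2 X"
      unfolding null2_def using cauchy2_LIMSEQ[OF X] by (metis limI)
    thus "(lim (\<lambda>n. abs2 (X n)) = 0) = rel2 X (\<lambda>n. 0)"
      using X by (simp add: rel2_def)
  qed
  have vabs_minus: "vabs (- x) = vabs x" for x :: Q2
    by transfer simp
  have vabs_nonneg: "vabs x \<ge> 0" for x :: Q2
  proof transfer
    fix X assume X: "cauchy2 X"
    show "0 \<le> lim (\<lambda>n. abs2 (X n))"
      by (rule LIMSEQ_le_const[OF cauchy2_LIMSEQ[OF X]]) auto
  qed
  fix x y z :: Q2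
  show "dist x y = vabs (x - y)"
    by (rule dist_Q2_def)
  show "uniformity = (INF e\<in>{0 <..}. principal {(x :: Q2, y). dist x y < e})"
    by (rule uniformity_Q2_def)
  show "open U \<longleftrightarrow> (\<forall>x\<in>U. \<forall>\<^sub>F (x', y) in uniformity. x' = x \<longrightarrow> y \<in> U)" for U :: "Q2 set"
    by (rule open_Q2_def)
  show "vabs (x * y) = vabs x * vabs y"
  proof transfer
    fix X Y assume X: "cauchy2 X" and Y: "cauchy2 Y"
    show "lim (\<lambda>n. abs2 (X n * Y n)) = lim (\<lambda>n. abs2 (X n)) * lim (\<lambda>n. abs2 (Y n))"
      unfolding abs2_mult by (intro limI tendsto_mult cauchy2_LIMSEQ X Y)
  qed
  show ultra: "vabs (x + y) \<le> max (vabs x) (vabs y)" for x y :: Q2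
  proof transfer
    fix X Y assume X: "cauchy2 X" and Y: "cauchy2 Y"
    show "lim (\<lambda>n. abs2 (X n + Y n)) \<le> max (lim (\<lambda>n. abs2 (X n))) (lim (\<lambda>n. abs2 (Y n)))"
      by (rule LIMSEQ_le[OF cauchy2_LIMSEQ[OF cauchy2_add[OF X Y]]
                            tendsto_max[OF cauchy2_LIMSEQ[OF X] cauchy2_LIMSEQ[OF Y]]])
         (auto intro: abs2_add)
  qed
  show "dist x y = 0 \<longleftrightarrow> x = y"
    by (simp add: dist_Q2_def vabs_0)
  show "dist x y \<le> dist x z + dist y z"
  proof -
    have "vabs ((x - z) + (z - y)) \<le> max (vabs (x - z)) (vabs (z - y))"
      by (rule ultra)
    also have "vabs (z - y) = vabs (y - z)"
      using vabs_minus[of "y - z"] by simp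
    also have "max (vabs (x - z)) (vabs (y - z)) \<le> vabs (x - z) + vabs (y - z)"
      using vabs_nonneg[of "x - z"] vabs_nonneg[of "y - z"] by simp
    finally show ?thesis by (simp add: dist_Q2_def)
  qed
qed

end

lift_definition Q2_of_rat :: "rat \<Rightarrow> Q2" is "\<lambda>x n. x"
  by (simp add: rel2_refl)

lemma Q2_of_rat_hom:
  "Q2_of_rat (x + y) = Q2_of_rat x + Q2_of_rat y"
  "Q2_of_rat (x * y) = Q2_of_rat x * Q2_of_rat y"
  "Q2_of_rat 1 = 1"
  "Q2_of_rat (- x) = - Q2_of_rat x"
  "Q2_of_rat 0 = 0"
  by (transfer; simp add: rel2_refl)+

lemma Q2_of_rat_diff: "Q2_of_rat (x - y) = Q2_of_rat x - Q2_of_rat y"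
  by (simp only: diff_conv_add_uminus Q2_of_rat_hom)

lemma vabs_Q2_of_rat: "vabs (Q2_of_rat x) = abs2 x"
  by transfer (simp add: limI)

lemma Q2_rat_dense:
  assumes "e > 0"
  obtains r where "dist x (Q2_of_rat r) < e"
proof -
  have "\<exists>r. vabs (x - Q2_of_rat r) < e"
    unfolding diff_conv_add_uminus using assms
  proof (transfer fixing: e)
    fix X assume X: "cauchy2 X" and e: "0 < e"
    obtain k where k: "\<forall>m\<ge>k. \<forall>n\<ge>k. abs2 (X m - X n) < e / 2"
      using X e unfolding cauchy2_def by (meson half_gt_zero)
    have c: "cauchy2 (\<lambda>n. X n + - X k)"
      by (rule cauchy2_add) (use X in auto)
    have "lim (\<lambda>n. abs2 (X n + - X k)) \<le> e / 2"
      by (rule LIMSEQ_le_const2[OF cauchy2_LIMSEQ[OF c]]) (use k in \<open>auto intro!: exI[of _ k] less_imp_le\<close>)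
    hence "lim (\<lambda>n. abs2 (X n + - X k)) < e" using e by linarith
    thus "\<exists>r. lim (\<lambda>n. abs2 (X n + - r)) < e" by blast
  qed
  thus ?thesis using that by (auto simp: dist_vabs)
qed

lemma Q2_of_rat_LIMSEQ:
  assumes "cauchy2 X"
  shows "(\<lambda>n. Q2_of_rat (X n)) \<longlonglongrightarrow> Q2_of_seq X"
proof (rule metric_LIMSEQ_I)
  fix e :: real assume e: "e > 0"
  have pcr: "pcr_Q2 X (Q2_of_seq X)"
    using assms by (simp add: Q2.pcr_cr_eq cr_Q2_def rel2_refl)
  obtain k where k: "\<forall>m\<ge>k. \<forall>n\<ge>k. abs2 (X m - X n) < e / 2"
    using assms e unfolding cauchy2_def by (meson half_gt_zero)
  have "dist (Q2_of_rat (X n)) (Q2_of_seq X) < e" if n: "n \<ge> k" for n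
  proof -
    have c: "cauchy2 (\<lambda>i. X n + - X i)"
      by (intro cauchy2_add cauchy2_minus assms) auto
    have "vabs (Q2_of_rat (X n) + - Q2_of_seq X) = lim (\<lambda>i. abs2 (X n + - X i))"
    proof -
      have "Q2_of_rat (X n) = Q2_of_seq (\<lambda>_. X n)"
        by (simp add: Q2_of_rat.abs_eq)
      also have "\<dots> + - Q2_of_seq X = Q2_of_seq (\<lambda>i. X n + - X i)"
        using assms by (simp add: uminus_Q2.abs_eq plus_Q2.abs_eq rel2_refl cauchy2_minus)
      also have "vabs \<dots> = lim (\<lambda>i. abs2 (X n + - X i))"
        by (rule vabs_Q2.abs_eq) (rule rel2_refl[OF c])
      finally show ?thesis .
    qed
    also have "\<dots> \<le> e / 2"
      by (rule LIMSEQ_le_const2[OF cauchy2_LIMSEQ[OF c]])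
         (use k n in \<open>auto intro!: exI[of _ k] less_imp_le\<close>)
    also have "\<dots> < e" using e by simp
    finally show ?thesis by (simp add: dist_vabs)
  qed
  thus "\<exists>N. \<forall>n\<ge>N. dist (Q2_of_rat (X n)) (Q2_of_seq X) < e" by blast
qed

instance Q2 :: complete_space
proof
  fix S :: "nat \<Rightarrow> Q2" assume S: "Cauchy S"
  have "\<exists>r. dist (S n) (Q2_of_rat r) < inverse (real (Suc n))" for n
    using Q2_rat_dense[of "inverse (real (Suc n))" "S n"] by auto
  then obtain X where X: "\<And>n. dist (S n) (Q2_of_rat (X n)) < inverse (real (Suc n))"
    by metis
  have SX: "(\<lambda>n. dist (S n) (Q2_of_rat (X n))) \<longlonglongrightarrow> 0"
    by (rule tendsto_sandwich[OF _ _ tendsto_const LIMSEQ_inverse_real_of_nat])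
       (auto intro!: always_eventually less_imp_le X simp del: of_nat_Suc)
  have "cauchy2 X"
    unfolding cauchy2_def
  proof (intro allI impI)
    fix e :: real assume e: "e > 0"
    obtain k where k: "\<forall>m\<ge>k. \<forall>n\<ge>k. dist (S m) (S n) < e / 3"
      using S e unfolding Cauchy_def by (meson divide_pos_pos zero_less_numeral)
    obtain l where l: "\<forall>n\<ge>l. dist (S n) (Q2_of_rat (X n)) < e / 3"
      using order_tendstoD(2)[OF SX, of "e / 3"] e by (auto simp: eventually_sequentially)
    have "abs2 (X m - X n) < e" if "m \<ge> max k l" "n \<ge> max k l" for m n
    proof -
      have "abs2 (X m - X n) = dist (Q2_of_rat (X m)) (Q2_of_rat (X n))"
        by (simp add: dist_vabs vabs_Q2_of_rat flip: Q2_of_rat_diff)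
      also have "\<dots> \<le> dist (S m) (Q2_of_rat (X m)) + (dist (S m) (S n) + dist (S n) (Q2_of_rat (X n)))"
        by (metis add_left_mono dist_commute dist_triangle order_trans)
      also have "\<dots> < e / 3 + (e / 3 + e / 3)"
        using k l that by (intro add_strict_mono) auto
      finally show ?thesis by simp
    qed
    thus "\<exists>k. \<forall>m\<ge>k. \<forall>n\<ge>k. abs2 (X m - X n) < e" by blast
  qed
  from Q2_of_rat_LIMSEQ[OF this]
  have "(\<lambda>n. dist (Q2_of_rat (X n)) (Q2_of_seq X)) \<longlonglongrightarrow> 0"
    by (simp flip: tendsto_dist_iff)
  from tendsto_add_zero[OF SX this]
  have "(\<lambda>n. dist (S n) (Q2_of_seq X)) \<longlonglongrightarrow> 0"
    by (intro tendsto_sandwich[OF always_eventually[OF allI[OF zero_le_dist]]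
          always_eventually[OF allI[OF dist_triangle]] tendsto_const])
  hence "S \<longlonglongrightarrow> Q2_of_seq X"
    by (simp flip: tendsto_dist_iff)
  thus "convergent S" by (auto simp: convergent_def)
qed

lemma Q2_of_rat_of_nat: "Q2_of_rat (of_nat n) = of_nat n"
  by (induction n) (simp_all add: Q2_of_rat_hom)

lemma vabs_Q2_of_nat: "vabs (of_nat n :: Q2) = abs2 (of_nat n)"
  by (metis Q2_of_rat_of_nat vabs_Q2_of_rat)

instance Q2 :: field_char_0
proof
  show "inj (of_nat :: nat \<Rightarrow> Q2)"
  proof (rule injI)
    fix m n :: nat assume "(of_nat m :: Q2) = of_nat n"
    hence "Q2_of_rat (of_nat m - of_nat n) = Q2_of_rat 0"
      by (simp add: Q2_of_rat_diff Q2_of_rat_of_nat Q2_of_rat_hom)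
    hence "abs2 (of_nat m - of_nat n) = 0"
      by (metis vabs_Q2_of_rat abs2_0)
    thus "m = n" by simp
  qed
qed


section \<open>Completions of an algebraic closure of the 2-adic numbers\<close>

definition algebraic_over_Q2 :: "(Q2 \<Rightarrow> 'c::nonarch_field) \<Rightarrow> 'c \<Rightarrow> bool" where
  "algebraic_over_Q2 \<iota> x \<longleftrightarrow> (\<exists>p::Q2 poly. p \<noteq> 0 \<and> poly (map_poly \<iota> p) x = 0)"

text \<open>
  The predicate below says that \<open>\<iota>\<close> exhibits \<open>'c\<close> as the field $\mathbf{C}_2$: \<open>\<iota>\<close> is an isometric
  embedding of $\mathbf{Q}_2$ into the complete field \<open>'c\<close>, the elements algebraic over
  $\mathbf{Q}_2$ form an algebraically closed field (hence an algebraic closure of $\mathbf{Q}_2$),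
  and they are dense in \<open>'c\<close>. This determines \<open>'c\<close> up to isometric isomorphism over
  $\mathbf{Q}_2$, since the absolute value of $\mathbf{Q}_2$ extends uniquely to an algebraic
  closure.
\<close>

definition is_C2 :: "(Q2 \<Rightarrow> 'c::{nonarch_field, complete_space}) \<Rightarrow> bool" where
  "is_C2 \<iota> \<longleftrightarrow>
     \<iota> 1 = 1 \<and> (\<forall>x y. \<iota> (x + y) = \<iota> x + \<iota> y) \<and> (\<forall>x y. \<iota> (x * y) = \<iota> x * \<iota> y) \<and>
     (\<forall>x. vabs (\<iota> x) = vabs x) \<and>
     (\<forall>p :: 'c poly. (\<forall>i. algebraic_over_Q2 \<iota> (coeff p i)) \<and> degree p > 0 \<longrightarrow>
        (\<exists>x. algebraic_over_Q2 \<iota> x \<and> poly p x = 0)) \<and>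
     closure {x. algebraic_over_Q2 \<iota> x} = UNIV"

text \<open>The valuation normalised by $v_2(2) = 1$; only meaningful for non-zero arguments.\<close>

definition v2 :: "'c::nonarch_field \<Rightarrow> real" where
  "v2 x = - log 2 (vabs x)"


section \<open>Overconvergent 2-adic modular forms of weight 0\<close>

text \<open>
  All modular forms are given by their $q$-expansions, formal power series over $\mathbf{Q}_2$ with
  \<open>fps_X\<close> in the role of $q$. The infinite product refers to the $q$-adic topology on power series.
\<close>

definition Delta_q :: "Q2 fps" where
  "Delta_q = fps_X * (\<Prod>n. (1 - fps_X ^ Suc n) ^ 24)"

lemma Delta_has_prod:
  obtains P :: "Q2 fps" where
    "(\<lambda>n. (1 - fps_X ^ Suc n) ^ 24) has_prod P" "Delta_q = fps_X * P" "fps_nth P 0 = 1"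
proof -
  define F where "F = (\<lambda>n. (1 - fps_X ^ Suc n) ^ 24 :: Q2 fps)"
  have ex: "\<exists>H. (1 - z) ^ m = 1 + z * H" for z :: "Q2 fps" and m
  proof (induction m)
    case (Suc m)
    then obtain H where "(1 - z) ^ m = 1 + z * H" by blast
    hence "(1 - z) ^ Suc m = 1 + z * (H - 1 - z * H)"
      by (simp add: algebra_simps)
    thus ?case by blast
  qed (auto intro: exI[of _ 0])
  define Q where "Q = (\<lambda>N. \<Prod>i\<le>N. F i)"
  have Q_Suc: "fps_nth (Q (Suc N)) n = fps_nth (Q N) n" if "n \<le> N" for n N
  proof -
    obtain H where H: "F (Suc N) = 1 + fps_X ^ Suc (Suc N) * H"
      unfolding F_def using ex by blast
    have "Q (Suc N) = Q N + fps_X ^ Suc (Suc N) * (H * Q N)"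
      by (simp add: Q_def H algebra_simps)
    moreover have "fps_nth (fps_X ^ Suc (Suc N) * (H * Q N)) n = 0"
      using that by (subst fps_X_power_mult_nth) auto
    ultimately show ?thesis by simp
  qed
  have Q_stable: "fps_nth (Q N) n = fps_nth (Q n) n" if "n \<le> N" for n N
    using that by (induction N rule: dec_induct) (auto simp: Q_Suc)
  define P where "P = Abs_fps (\<lambda>n. fps_nth (Q n) n)"
  have P0: "fps_nth P 0 = 1"
    by (simp add: P_def Q_def F_def fps_nth_power_0)
  have lim: "Q \<longlonglongrightarrow> P"
  proof (rule tendsto_fpsI)
    fix n
    show "eventually (\<lambda>N. fps_nth (Q N) n = fps_nth P n) sequentially"
      using eventually_ge_at_top[of n]
      by eventually_elim (unfold P_def fps_nth_Abs_fps, rule Q_stable)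
  qed
  have "P \<noteq> 0" using P0 by auto
  with lim have "F has_prod P"
    by (simp add: has_prod_def raw_has_prod_def Q_def)
  moreover from this have "P = prodinf F" by (rule has_prod_unique)
  ultimately show ?thesis
    using that[of P] P0 by (simp add: F_def Delta_q_def)
qed

lemma subdegree_Delta_q: "subdegree Delta_q = 1" "fps_nth Delta_q 1 = 1"
proof -
  obtain P where P: "Delta_q = fps_X * P" "fps_nth P 0 = 1" by (rule Delta_has_prod)
  show "fps_nth Delta_q 1 = 1" unfolding P(1) using P(2) by simp
  moreover have "fps_nth Delta_q 0 = 0" unfolding P(1) by simp
  ultimately show "subdegree Delta_q = 1" by (intro subdegreeI) auto
qed

text \<open>$f(\tau) = \Delta(2\tau) / \Delta(\tau)$; replacing $\tau$ by $2\tau$ replaces $q$ by $q^2$.\<close>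

definition f_q :: "Q2 fps" where
  "f_q = (Delta_q oo fps_X ^ 2) / Delta_q"

definition g_q :: "Q2 fps" where
  "g_q = fps_const (2 ^ 6) * f_q"

lemma g_q_nth: "fps_nth g_q 0 = 0" "fps_nth g_q 1 = 2 ^ 6"
proof -
  define D2 where "D2 = Delta_q oo (fps_X ^ 2 :: Q2 fps)"
  have X2: "fps_nth (fps_X ^ 2 :: Q2 fps) 0 = 0" by simp
  have sub: "subdegree D2 = 2"
    unfolding D2_def using subdegree_Delta_q(1) by (subst subdegree_fps_compose[OF X2]) simp
  have D2_2: "fps_nth D2 2 = 1"
  proof -
    have "fps_nth D2 2 = (\<Sum>i=0..2. fps_nth Delta_q i * fps_nth (fps_X ^ (2 * i)) 2)"
      by (simp add: D2_def fps_compose_nth flip: power_mult)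
    also have "\<dots> = fps_nth Delta_q 1"
      by (simp add: numeral_2_eq_2 fps_X_power_iff)
    finally show ?thesis by (simp only: subdegree_Delta_q(2))
  qed
  have "fps_nth f_q (2 - 1) = fps_nth D2 2 * inverse (fps_nth Delta_q 1)"
    unfolding f_q_def D2_def[symmetric]
    using fps_divide_nth_base[of Delta_q D2] sub subdegree_Delta_q(1) by simp
  hence f1: "fps_nth f_q 1 = 1" by (simp add: D2_2 subdegree_Delta_q(2)[unfolded One_nat_def])
  have f0: "fps_nth f_q 0 = 0"
    unfolding f_q_def D2_def[symmetric]
    using sub subdegree_Delta_q(1) by (intro fps_divide_nth_below) simp
  show "fps_nth g_q 0 = 0" "fps_nth g_q 1 = 2 ^ 6"
    using f0 f1 by (simp_all add: g_q_def)
qed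

text \<open>
  The rigid functions on the region $|g| \le 1$ are the series $\sum_n a_n g^n$ with $a_n \to 0$.
  As $g$ has no constant term, the $q$-expansion of such a series is a composition of formal
  power series.
\<close>

definition overconvergent_forms :: "Q2 fps set" (\<open>\<^bold>M\<^sub>0\<close>) where
  "\<^bold>M\<^sub>0 = {Abs_fps a oo g_q | a. a \<longlonglongrightarrow> 0}"

definition overconvergent_cusp_forms :: "Q2 fps set" (\<open>\<^bold>S\<^sub>0\<close>) where
  "\<^bold>S\<^sub>0 = {F \<in> \<^bold>M\<^sub>0. fps_nth F 0 = 0}"

lemma overconvergent_cusp_forms_iff:
  "F \<in> \<^bold>S\<^sub>0 \<longleftrightarrow> (\<exists>a. a \<longlonglongrightarrow> 0 \<and> a 0 = 0 \<and> F = Abs_fps a oo g_q)"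
  by (auto simp: overconvergent_cusp_forms_def overconvergent_forms_def)

text \<open>
  The coefficients $a_n$ are unique because $g$ has order 1 in $q$. The norm of $\mathbf{M}_0$ is
  their maximum, so $(g^n)_{n \ge 0}$ is an orthonormal basis of $\mathbf{M}_0$ and
  $(g^n)_{n \ge 1}$ is one of $\mathbf{S}_0$.
\<close>

definition g_coeffs :: "Q2 fps \<Rightarrow> nat \<Rightarrow> Q2" where
  "g_coeffs F = (THE a. a \<longlonglongrightarrow> 0 \<and> F = Abs_fps a oo g_q)"

lemma g_coeffs_compose:
  assumes "a \<longlonglongrightarrow> 0"
  shows "g_coeffs (Abs_fps a oo g_q) = a"
proof -
  have g1: "fps_nth g_q 1 \<noteq> 0" unfolding g_q_nth(2) by simp
  have "b = a" if "Abs_fps a oo g_q = Abs_fps b oo g_q" for b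
    using that unfolding fps_compose_inj_right[OF g_q_nth(1) g1]
    by (metis fps_nth_Abs_fps ext)
  thus ?thesis
    unfolding g_coeffs_def by (intro the_equality) (use assms in auto)
qed

definition overconvergent_norm :: "Q2 fps \<Rightarrow> real" where
  "overconvergent_norm F = (SUP n. vabs (g_coeffs F n))"

definition U_op :: "Q2 fps \<Rightarrow> Q2 fps" where
  "U_op F = Abs_fps (\<lambda>n. fps_nth F (2 * n))"


section \<open>Characteristic power series and eigenvalues\<close>

text \<open>
  Serre's Fredholm determinant $\det(1 - X A)$ of a compact operator with matrix \<open>A\<close> with respect to
  an orthonormal basis indexed by \<open>I\<close>: the coefficient of $X^m$ is $(-1)^m$ times the convergent sum
  of the principal $m \times m$ minors of \<open>A\<close>. It does not depend on the orthonormal basis.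
\<close>

definition minor :: "('i \<Rightarrow> 'i \<Rightarrow> 'a::comm_ring_1) \<Rightarrow> 'i set \<Rightarrow> 'a" where
  "minor A S = (\<Sum>p | p permutes S. of_int (sign p) * (\<Prod>i\<in>S. A i (p i)))"

definition fredholm_det :: "'i set \<Rightarrow> ('i \<Rightarrow> 'i \<Rightarrow> 'a::nonarch_field) \<Rightarrow> 'a fps" where
  "fredholm_det I A =
     Abs_fps (\<lambda>m. (-1) ^ m * (\<Sum>\<^sub>\<infinity>S | S \<subseteq> I \<and> finite S \<and> card S = m. minor A S))"

text \<open>
  The series $\det(1 - XU)$ for $U$ on $\mathbf{S}_0$, computed in the orthonormal basis $(g^j)_{j \ge 1}$:
  the matrix is given by $U(g^j) = \sum_{i \ge 1} A_{ij} g^i$.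
\<close>

definition U_char_series :: "Q2 fps" where
  "U_char_series = fredholm_det {1..} (\<lambda>i j. g_coeffs (U_op (g_q ^ j)) i)"

definition fps_value :: "'a::nonarch_field fps \<Rightarrow> 'a \<Rightarrow> 'a" where
  "fps_value P x = (\<Sum>n. fps_nth P n * x ^ n)"

text \<open>
  The order of vanishing at \<open>x\<close> of an everywhere convergent non-zero power series over a field of
  characteristic 0; it is 0 if \<open>x\<close> is not a zero.
\<close>

definition zero_mult :: "'a::nonarch_field fps \<Rightarrow> 'a \<Rightarrow> nat" where
  "zero_mult P x = (LEAST k. fps_value ((fps_deriv ^^ k) P) x \<noteq> 0)"

text \<open>
  \<open>ev 1, ev 2, \<dots>\<close> (the value \<open>ev 0\<close> is irrelevant) are the non-zero eigenvalues of $U$ on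
  $\mathbf{S}_0$ with multiplicities, i.e. the inverses of the zeros of the characteristic power
  series, in order of decreasing absolute value.
\<close>

definition is_eigenvalue_seq ::
  "(Q2 \<Rightarrow> 'c::{nonarch_field, complete_space}) \<Rightarrow> (nat \<Rightarrow> 'c) \<Rightarrow> bool" where
  "is_eigenvalue_seq \<iota> ev \<longleftrightarrow>
     (\<forall>n\<ge>1. ev n \<noteq> 0) \<and>
     (\<forall>n\<ge>1. vabs (ev (Suc n)) \<le> vabs (ev n)) \<and>
     (\<forall>x. x \<noteq> 0 \<longrightarrow> finite {n. n \<ge> 1 \<and> ev n = x} \<and>
        card {n. n \<ge> 1 \<and> ev n = x} =
          zero_mult (Abs_fps (\<lambda>m. \<iota> (fps_nth U_char_series m))) (inverse x))"

end

theory Submission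
  imports Defs
begin

text \<open>
  Write $B = \prod_n (1 - q^{2n-1})$, so that $f = q / B^{24}$. Jacobi's identity
  $B(-q)^8 - B(q)^8 = 16 q \prod_n (1 + q^{2n})^8$ shows that $g(q)$ and $g(-q)$ are the roots of
  $X^2 - (48 h + 64 h^2) X - 64 h$ with $h = g(q^2)$. This gives a recursion for $U(g^j)$, solved by
  $u_{ij} = 3 j (i+j-1)! \, 2^{2i+2j-1} / ((2i-j)! \, (2j-i)!)$.

  Following Buzzard and Calegari, this matrix factors as $L D R$ with $L$ lower and $R$ upper unitriangular
  over $\mathbf{Z}_2$, $L \equiv 1$ modulo 2, and $D$ diagonal with entries
  $d_k = 2^{4k+1} (3k)!^2 k!^2 / (3 (2k)!^4)$ of valuation $1 + 2 v_2((3k)!/k!)$, which is strictly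
  increasing. Hence the coefficient of $X^m$ in $\det(1 - XU)$ has the valuation of
  $d_1 \cdots d_m$, and the Newton polygon of this series has a vertex at every index: for every $n$ there is
  exactly one zero of absolute value $|d_n|^{-1}$, it is simple, and there are no other zeros.
\<close>

section \<open>Infinite products of power series\<close>

text \<open>At q^2, the series U(g^j) takes the value (g(q)^j + g(-q)^j) / 2, half a power sum of
  two roots; this is why a quadratic equation over series in q^2 becomes a two-term recursion in j.
  Jacobi's identity behind that equation is theta_3^4 - theta_4^4 = theta_2^4 rewritten by the
  triple product, and the theta series are there for this purpose. The obstacle is that bounds on
  the entries u_ij only give inequalities for the minors, while the Newton polygon needs exact
  absolute values. The factorization supplies them: row k of D R carries d_k, and every departure
  from the diagonal term of the leading minor costs at least a factor 2, either through an
  off-diagonal entry of L or through a set of rows other than {1, ..., m}. That L D R equals U is a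
  terminating hypergeometric sum, evaluated by a telescoping certificate. The zeros are found by the
  Banach fixed point theorem on the spheres where two neighbouring terms of the series have equal
  size, so existence, uniqueness and simplicity all come from the same estimate of the remaining
  terms.\<close>

definition eq_upto :: "nat \<Rightarrow> 'a::idom fps \<Rightarrow> 'a fps \<Rightarrow> bool" where
  "eq_upto M P Q \<longleftrightarrow> (\<forall>n<M. fps_nth P n = fps_nth Q n)"

lemma eq_upto_refl [simp]: "eq_upto M P P"
  by (simp add: eq_upto_def)

lemma eq_upto_sym: "eq_upto M P Q \<Longrightarrow> eq_upto M Q P"
  by (simp add: eq_upto_def)

lemma eq_upto_trans [trans]: "eq_upto M P Q \<Longrightarrow> eq_upto M Q R \<Longrightarrow> eq_upto M P R"
  by (simp add: eq_upto_def)

lemma eq_upto_mono: "eq_upto N P Q \<Longrightarrow> M \<le> N \<Longrightarrow> eq_upto M P Q"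
  by (simp add: eq_upto_def)

lemma eq_upto_mult: "eq_upto M P P' \<Longrightarrow> eq_upto M Q Q' \<Longrightarrow> eq_upto M (P * Q) (P' * Q')"
  by (auto simp: eq_upto_def fps_mult_nth intro!: sum.cong)

lemma eq_upto_power: "eq_upto M P Q \<Longrightarrow> eq_upto M (P ^ k) (Q ^ k)"
  by (induction k) (auto intro: eq_upto_mult)

lemma eq_upto_sum: "(\<And>x. x \<in> A \<Longrightarrow> eq_upto M (F x) (G x)) \<Longrightarrow> eq_upto M (sum F A) (sum G A)"
  by (auto simp: eq_upto_def fps_sum_nth intro!: sum.cong)

lemma eq_upto_compose: "eq_upto M P Q \<Longrightarrow> eq_upto M (P oo H) (Q oo H)"
  by (auto simp: eq_upto_def fps_compose_nth intro!: sum.cong)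

lemma eq_upto_all_imp_eq: "(\<And>M. eq_upto M P Q) \<Longrightarrow> P = Q"
  by (auto simp: eq_upto_def fps_eq_iff)

text \<open>A factor q^k gains k digits of precision. In the triple product this gain makes up for
  Gaussian binomials known to low order only.\<close>

lemma eq_upto_power_mult: "eq_upto M P Q \<Longrightarrow> eq_upto (M + k) (fps_X ^ k * P) (fps_X ^ k * Q)"
  by (auto simp: eq_upto_def fps_X_power_mult_nth)

definition unit_factors :: "(nat \<Rightarrow> 'a::idom fps) \<Rightarrow> bool" where
  "unit_factors F \<longleftrightarrow> (\<forall>i. eq_upto (Suc i) (F i) 1)"

text \<open>Coefficient n can be read off a finite product because all later factors are 1 modulo
  q^(n+1). With \<open>eq_upto\<close> as congruence modulo a power of q, limits become finite
  comparisons.\<close>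

definition inf_prod :: "(nat \<Rightarrow> 'a::idom fps) \<Rightarrow> 'a fps" where
  "inf_prod F = Abs_fps (\<lambda>n. fps_nth (\<Prod>i<Suc n. F i) n)"

lemma unit_factors_eq_upto:
  assumes "unit_factors F" "M \<le> Suc i"
  shows "eq_upto M (F i) 1"
  using assms eq_upto_mono unfolding unit_factors_def by blast

lemma eq_upto_prod_lessThan:
  assumes "unit_factors F" "M \<le> N"
  shows "eq_upto M (\<Prod>i<N. F i) (\<Prod>i<M. F i)"
  using assms(2)
proof (induction N rule: dec_induct)
  case (step N)
  have "eq_upto M ((\<Prod>i<N. F i) * F N) ((\<Prod>i<M. F i) * 1)"
    using step unit_factors_eq_upto[OF assms(1)] by (intro eq_upto_mult) auto
  thus ?case by simp
qed simp

lemma eq_upto_inf_prod: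
  assumes "unit_factors F" "M \<le> N"
  shows "eq_upto M (inf_prod F) (\<Prod>i<N. F i)"
proof -
  have "fps_nth (\<Prod>i<N. F i) n = fps_nth (\<Prod>i<Suc n. F i) n" if "n < M" for n
    using eq_upto_prod_lessThan[OF assms(1), of "Suc n" N] that assms(2) by (simp add: eq_upto_def)
  thus ?thesis by (simp add: eq_upto_def inf_prod_def)
qed

text \<open>N may depend on M, so it suffices to compare along a subsequence of the partial
  products; \<open>inf_prod_pair\<close> takes N = 2 * M.\<close>

lemma inf_prod_unique:
  assumes "unit_factors F" "\<And>M. \<exists>N\<ge>M. eq_upto M P (\<Prod>i<N. F i)"
  shows "inf_prod F = P"
  by (rule eq_upto_all_imp_eq) (use assms eq_upto_inf_prod eq_upto_trans eq_upto_sym in metis)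

lemma unit_factors_mult: "unit_factors F \<Longrightarrow> unit_factors G \<Longrightarrow> unit_factors (\<lambda>i. F i * G i)"
  unfolding unit_factors_def using eq_upto_mult[of _ _ 1 _ 1] by fastforce

lemma inf_prod_mult:
  assumes "unit_factors F" "unit_factors G"
  shows "inf_prod (\<lambda>i. F i * G i) = inf_prod F * inf_prod G"
  by (rule inf_prod_unique)
     (auto simp: prod.distrib assms intro!: unit_factors_mult eq_upto_mult eq_upto_inf_prod)

lemma unit_factors_compose: "unit_factors F \<Longrightarrow> unit_factors (\<lambda>i. F i oo H)"
  unfolding unit_factors_def by (metis eq_upto_compose fps_compose_1)

lemma inf_prod_compose:
  assumes "unit_factors F" "fps_nth H 0 = 0"
  shows "inf_prod F oo H = inf_prod (\<lambda>i. F i oo H)"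
proof (rule inf_prod_unique[symmetric, OF unit_factors_compose[OF assms(1)]])
  fix M
  have "eq_upto M (inf_prod F oo H) ((\<Prod>i<M. F i) oo H)"
    by (intro eq_upto_compose eq_upto_inf_prod assms) simp
  thus "\<exists>N\<ge>M. eq_upto M (inf_prod F oo H) (\<Prod>i<N. F i oo H)"
    unfolding fps_compose_prod_distrib[OF assms(2)] by blast
qed

lemma prod_lessThan_double: "(\<Prod>i<2*n. f i) = (\<Prod>i<n. f (2*i) * f (Suc (2*i)))"
  for f :: "nat \<Rightarrow> 'a::comm_monoid_mult"
  by (induction n) (auto simp: mult.assoc)

text \<open>Grouping neighbours separates the odd exponents of \<open>prod_minus\<close> from the
  even ones.\<close>

lemma inf_prod_pair:
  assumes "unit_factors F"
  shows "inf_prod F = inf_prod (\<lambda>i. F (2 * i) * F (Suc (2 * i)))"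
proof (rule inf_prod_unique[OF assms])
  fix M
  have q: "unit_factors (\<lambda>i. F (2 * i) * F (Suc (2 * i)))"
    unfolding unit_factors_def using eq_upto_mult[OF unit_factors_eq_upto unit_factors_eq_upto, OF assms _ assms]
    by (metis (no_types, lifting) Suc_le_mono le_SucI le_add1 mult_2 mult_1_right)
  show "\<exists>N\<ge>M. eq_upto M (inf_prod (\<lambda>i. F (2 * i) * F (Suc (2 * i)))) (\<Prod>i<N. F i)"
    using eq_upto_inf_prod[OF q, of M M] unfolding prod_lessThan_double[symmetric]
    by (intro exI[of _ "2 * M"]) auto
qed

lemma inf_prod_nth_0:
  assumes "unit_factors F"
  shows "fps_nth (inf_prod F) 0 = 1"
  using eq_upto_inf_prod[OF assms, of 1 1] unit_factors_eq_upto[OF assms, of 1 0] by (simp add: eq_upto_def)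

section \<open>Euler products: up to powers of q, eta(tau), eta(2 tau) / eta(tau) and the inverse of
  the latter\<close>

definition prod_minus :: "'a::idom fps" where "prod_minus = inf_prod (\<lambda>i. 1 - fps_X ^ Suc i)"
definition prod_plus :: "'a::idom fps" where "prod_plus = inf_prod (\<lambda>i. 1 + fps_X ^ Suc i)"
definition prod_odd_minus :: "'a::idom fps" where "prod_odd_minus = inf_prod (\<lambda>i. 1 - fps_X ^ Suc (2 * i))"

lemma unit_factors_X_power:
  assumes "\<And>i. i < k i"
  shows "unit_factors (\<lambda>i. 1 - fps_X ^ k i)" "unit_factors (\<lambda>i. 1 + fps_X ^ k i)"
  using assms[THEN less_le_trans] by (auto simp: unit_factors_def eq_upto_def fps_X_power_iff not_less_eq)

lemma X_power_compose_X2: "fps_X ^ k oo fps_X ^ 2 = (fps_X ^ (2 * k) :: 'a::idom fps)"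
  by (simp add: fps_X_power_compose flip: power_mult)

lemma prod_minus_nonzero: "prod_minus \<noteq> (0 :: 'a::idom fps)"
proof
  assume "prod_minus = (0 :: 'a fps)"
  thus False using inf_prod_nth_0[OF unit_factors_X_power(1)[of Suc], where ?'a = 'a] by (simp add: prod_minus_def)
qed

lemma prod_minus_X2: "prod_minus oo fps_X ^ 2 = (inf_prod (\<lambda>i. 1 - fps_X ^ (2 * Suc i)) :: 'a::idom fps)"
  unfolding prod_minus_def
  by (subst inf_prod_compose)
     (auto intro!: unit_factors_X_power simp: fps_compose_sub_distrib X_power_compose_X2 simp del: power_Suc)

lemma prod_plus_X2: "prod_plus oo fps_X ^ 2 = (inf_prod (\<lambda>i. 1 + fps_X ^ (2 * Suc i)) :: 'a::idom fps)"
  unfolding prod_plus_def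
  by (subst inf_prod_compose)
     (auto intro!: unit_factors_X_power simp: fps_compose_add_distrib X_power_compose_X2 simp del: power_Suc)

lemma prod_odd_minus_X2: "prod_odd_minus oo fps_X ^ 2 = (inf_prod (\<lambda>i. 1 - fps_X ^ (2 * Suc (2 * i))) :: 'a::idom fps)"
  unfolding prod_odd_minus_def
  by (subst inf_prod_compose)
     (auto intro!: unit_factors_X_power simp: fps_compose_sub_distrib X_power_compose_X2 simp del: power_Suc)

lemma prod_odd_minus_neg: "prod_odd_minus oo - fps_X = (inf_prod (\<lambda>i. 1 + fps_X ^ Suc (2 * i)) :: 'a::idom fps)"
  unfolding prod_odd_minus_def
  by (subst inf_prod_compose)
     (auto intro!: unit_factors_X_power simp: fps_compose_sub_distrib fps_X_power_compose simp del: power_Suc)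

lemma prod_minus_split: "prod_minus = prod_odd_minus * (prod_minus oo fps_X ^ 2)"
  unfolding prod_minus_X2 unfolding prod_minus_def prod_odd_minus_def
  by (subst inf_prod_pair, intro unit_factors_X_power, simp, subst inf_prod_mult[symmetric])
     (auto intro!: unit_factors_X_power simp del: power_Suc)

lemma prod_minus_prod_plus: "prod_minus * prod_plus = prod_minus oo fps_X ^ 2"
  unfolding prod_minus_X2 unfolding prod_minus_def prod_plus_def
  by (subst inf_prod_mult[symmetric], auto intro!: unit_factors_X_power simp del: power_Suc)
     (simp add: algebra_simps flip: power_add mult_2)

text \<open>Euler's identity between partitions into odd and into distinct parts:
  \<open>prod_minus_prod_plus\<close> is put into \<open>prod_minus_split\<close>, and
  \<open>prod_minus\<close> cancels.\<close>

lemma prod_odd_minus_prod_plus: "prod_odd_minus * prod_plus = (1 :: 'a::idom fps)"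
proof -
  have "prod_minus * (prod_odd_minus * prod_plus) = prod_odd_minus * (prod_minus * prod_plus)" by (simp add: ac_simps)
  also have "\<dots> = prod_minus * (1 :: 'a fps)" unfolding prod_minus_prod_plus using prod_minus_split[symmetric] by simp
  finally show ?thesis using prod_minus_nonzero mult_left_cancel by blast
qed

lemma prod_odd_minus_neg_mult_prod_odd_minus: "(prod_odd_minus oo - fps_X) * prod_odd_minus = prod_odd_minus oo fps_X ^ 2"
  unfolding prod_odd_minus_X2 prod_odd_minus_neg unfolding prod_odd_minus_def
  by (subst inf_prod_mult[symmetric], auto intro!: unit_factors_X_power simp del: power_Suc)
     (simp add: algebra_simps flip: power_add mult_2)

text \<open>Eliminates \<open>prod_plus\<close> at q^2 from Jacobi's identity, leaving a relation
  between the values of \<open>prod_odd_minus\<close> at q and -q.\<close>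

lemma prod_odd_minus_neg_prod_odd_minus_prod_plus: "(prod_odd_minus oo - fps_X) * prod_odd_minus * (prod_plus oo fps_X ^ 2) = (1 :: 'a::idom fps)"
  unfolding prod_odd_minus_neg_mult_prod_odd_minus
  by (subst fps_compose_mult_distrib[symmetric]) (auto simp: prod_odd_minus_prod_plus)

section \<open>Gaussian binomials\<close>

text \<open>The q-Pascal rule keeps this a polynomial in Q, so that it makes sense for power series
  without division. The truncated exponent for k > N does no harm, since the factor beside it is
  then 0.\<close>

fun gauss_binomial :: "'a::comm_ring_1 \<Rightarrow> nat \<Rightarrow> nat \<Rightarrow> 'a" where
  "gauss_binomial Q N 0 = 1"
| "gauss_binomial Q 0 (Suc k) = 0"
| "gauss_binomial Q (Suc N) (Suc k) =
     gauss_binomial Q N (Suc k) + Q ^ (N - k) * gauss_binomial Q N k"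

lemma gauss_binomial_eq_0: "N < k \<Longrightarrow> gauss_binomial Q N k = 0"
  by (induction Q N k rule: gauss_binomial.induct) auto

text \<open>The theta products take x = 1 and for y the middle one of the powers of q, so that the
  factors below and above it pair up.\<close>

lemma gauss_binomial_theorem:
  "(\<Prod>i<N. y + x * Q ^ i) =
     (\<Sum>k\<le>N. Q ^ (k choose 2) * gauss_binomial Q N k * x ^ k * y ^ (N - k))"
proof (induction N)
  case (Suc N)
  define a where "a k = Q ^ (k choose 2) * gauss_binomial Q N k * x ^ k * y ^ (N - k)" for k
  have s: "Q ^ (Suc k choose 2) * gauss_binomial Q (Suc N) (Suc k) * x ^ Suc k * y ^ (Suc N - Suc k)
      = (if k < N then y * a (Suc k) else 0) + x * Q ^ N * a k" if "k \<le> N" for k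
  proof -
    have c: "(Suc k choose 2) = k + (k choose 2)"
      by (simp add: numeral_2_eq_2)
    have q: "Q ^ (Suc k choose 2) * Q ^ (N - k) = Q ^ (k choose 2) * Q ^ N"
      using that by (simp add: c flip: power_add)
    have "y ^ (N - k) = (if k < N then y * y ^ (N - Suc k) else 1)"
      using that by (auto simp: Suc_diff_Suc simp flip: power_Suc)
    moreover have "gauss_binomial Q N (Suc k) = 0" if "\<not> k < N"
      using that by (intro gauss_binomial_eq_0) simp
    ultimately show ?thesis
      using q unfolding a_def
      by (cases "k < N") (auto simp: algebra_simps simp del: power_Suc, simp_all add: algebra_simps)
  qed
  have "(\<Sum>k\<le>Suc N. Q ^ (k choose 2) * gauss_binomial Q (Suc N) k * x ^ k * y ^ (Suc N - k))
      = y ^ Suc N + (\<Sum>k\<le>N. (if k < N then y * a (Suc k) else 0) + x * Q ^ N * a k)"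
    unfolding sum.atMost_Suc_shift by (subst sum.cong[OF refl s]) (auto simp: binomial_eq_0)
  also have "(\<Sum>k\<le>N. (if k < N then y * a (Suc k) else 0)) = (\<Sum>k<N. y * a (Suc k))"
    by (intro sum.mono_neutral_cong_right) auto
  hence "y ^ Suc N + (\<Sum>k\<le>N. (if k < N then y * a (Suc k) else 0) + x * Q ^ N * a k)
     = (y * a 0 + (\<Sum>k<N. y * a (Suc k))) + x * Q ^ N * (\<Sum>k\<le>N. a k)"
    by (simp add: sum.distrib a_def sum_distrib_left algebra_simps binomial_eq_0)
  also have "y * a 0 + (\<Sum>k<N. y * a (Suc k)) = y * (\<Sum>k\<le>N. a k)"
    by (simp add: sum_distrib_left sum.lessThan_Suc_shift distrib_left
          del: sum.lessThan_Suc flip: lessThan_Suc_atMost)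
  finally show ?case using Suc.IH by (simp add: a_def algebra_simps)
qed (auto simp: binomial_eq_0)

text \<open>The quotient formula with denominators cleared. By Pascal's rule the induction step is
  (1 - Q^l) + Q^l (1 - Q^k) = 1 - Q^(k+l).\<close>

lemma gauss_binomial_prod:
  "gauss_binomial Q (k + l) k * (\<Prod>i<k. 1 - Q ^ Suc i) * (\<Prod>i<l. 1 - Q ^ Suc i)
     = (\<Prod>i<k+l. 1 - Q ^ Suc i)"
proof (induction "k + l" arbitrary: k l)
  case (Suc n)
  define e where "e k = (\<Prod>i<k. 1 - Q ^ Suc i)" for k
  have e: "e (Suc k) = e k * (1 - Q ^ Suc k)" for k by (simp add: e_def)
  show ?case
  proof (cases k)
    case (Suc k')
    show ?thesis
    proof (cases l)
      case (Suc l')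
      have n: "n = k + l'" "n = k' + l" using Suc.hyps(2) Suc \<open>k = Suc k'\<close> by auto
      have 1: "gauss_binomial Q n k * e k * e l' = e n"
        using Suc.hyps(1)[OF n(1)] n(1) by (simp add: e_def)
      have 2: "gauss_binomial Q n k' * e k' * e l = e n"
        using Suc.hyps(1)[OF n(2)] n(2) by (simp add: e_def)
      have "gauss_binomial Q (k + l) k * e k * e l
          = gauss_binomial Q n k * e k * e l' * (1 - Q ^ l)
            + Q ^ l * (gauss_binomial Q n k' * e k' * e l) * (1 - Q ^ k)"
      proof -
        have g: "gauss_binomial Q (k + l) k = gauss_binomial Q n k + Q ^ l * gauss_binomial Q n k'"
          using n Suc \<open>k = Suc k'\<close> by simp
        have el: "e l = e l' * (1 - Q ^ l)" and ek: "e k = e k' * (1 - Q ^ k)"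
          using Suc \<open>k = Suc k'\<close> e by simp_all
        have "(g1 + q * g2) * (a * P) * (b * R) = g1 * (a * P) * b * R + q * (g2 * a * (b * R)) * P"
          for a b P R g1 g2 q :: 'a by (simp add: algebra_simps)
        thus ?thesis unfolding g el ek .
      qed
      also have "\<dots> = e n * (1 - Q ^ (k + l))"
        unfolding 1 2 by (simp add: algebra_simps power_add)
      also have "\<dots> = e (k + l)" using Suc.hyps(2) e by metis
      finally show ?thesis by (simp add: e_def)
    next
      case 0
      have "gauss_binomial Q k k = 1" for k
        by (induction k) (auto simp: gauss_binomial_eq_0)
      with 0 show ?thesis by simp
    qed
  qed simp
qed simp

section \<open>Theta series\<close>

definition finite_fibres :: "('i \<Rightarrow> nat) \<Rightarrow> bool" where
  "finite_fibres u \<longleftrightarrow> (\<forall>n. finite {x. u x < n})"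

text \<open>A theta series as the generating function of a weight on an index set, so that
  identities reduce to bijections of index sets. An infinite fibre would have \<open>card\<close> 0;
  \<open>finite_fibres\<close> excludes this.\<close>

definition weight_series :: "('i \<Rightarrow> nat) \<Rightarrow> 'a::idom fps" where
  "weight_series u = Abs_fps (\<lambda>n. of_nat (card {x. u x = n}))"

lemma eq_upto_weight_series:
  assumes "finite S" "{x. u x < M} \<subseteq> S"
  shows "eq_upto M (weight_series u) (\<Sum>x\<in>S. fps_X ^ u x)"
proof -
  have "{x. u x = n} = {x \<in> S. u x = n}" if "n < M" for n
    using assms(2) that by auto
  thus ?thesis
    using assms(1) unfolding eq_upto_def weight_series_def
    by (simp add: fps_sum_nth fps_X_power_iff sum.If_cases Int_def eq_commute)
qed

lemma weight_series_unique:
  assumes "finite_fibres u" "\<And>M. eq_upto M P (\<Sum>x\<in>{x. u x < M}. fps_X ^ u x)"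
  shows "P = weight_series u"
proof (rule eq_upto_all_imp_eq)
  fix M
  have "eq_upto M (weight_series u) (\<Sum>x\<in>{x. u x < M}. fps_X ^ u x)"
    using assms(1) by (intro eq_upto_weight_series) (auto simp: finite_fibres_def)
  thus "eq_upto M P (weight_series u)" using assms(2) eq_upto_trans eq_upto_sym by blast
qed

lemma finite_fibres_add:
  assumes "finite_fibres u" "finite_fibres v"
  shows "finite_fibres (\<lambda>(x, y). u x + v y)"
  unfolding finite_fibres_def
proof
  fix n
  have "{p. (case p of (x, y) \<Rightarrow> u x + v y) < n} \<subseteq> {x. u x < n} \<times> {y. v y < n}" by auto
  moreover have "finite ({x. u x < n} \<times> {y. v y < n})"
    using assms by (simp add: finite_fibres_def)
  ultimately show "finite {p. (case p of (x, y) \<Rightarrow> u x + v y) < n}"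
    by (rule finite_subset)
qed

lemma weight_series_mult:
  assumes "finite_fibres u" "finite_fibres v"
  shows "weight_series u * weight_series v = weight_series (\<lambda>(x, y). u x + v y)"
proof (rule eq_upto_all_imp_eq)
  fix M
  define S T where "S = {x. u x < M}" and "T = {y. v y < M}"
  have fin: "finite S" "finite T" using assms by (auto simp: S_def T_def finite_fibres_def)
  have "eq_upto M (weight_series u * weight_series v) ((\<Sum>x\<in>S. fps_X ^ u x) * (\<Sum>y\<in>T. fps_X ^ v y))"
    using fin by (intro eq_upto_mult eq_upto_weight_series) (auto simp: S_def T_def)
  also have "(\<Sum>x\<in>S. fps_X ^ u x) * (\<Sum>y\<in>T. fps_X ^ v y) =
      (\<Sum>p\<in>S\<times>T. fps_X ^ (case p of (x, y) \<Rightarrow> u x + v y))"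
    by (simp add: sum_product sum.cartesian_product power_add case_prod_unfold)
  also have "eq_upto M \<dots> (weight_series (\<lambda>(x, y). u x + v y))"
    using fin by (intro eq_upto_sym[OF eq_upto_weight_series]) (auto simp: S_def T_def)
  finally show "eq_upto M (weight_series u * weight_series v) (weight_series (\<lambda>(x, y). u x + v y))" .
qed

lemma weight_series_split:
  assumes "finite_fibres u" "inj h" "inj k" "range h \<inter> range k = {}" "range h \<union> range k = UNIV"
  shows "(weight_series u :: 'r::idom fps) = weight_series (\<lambda>x. u (h x)) + weight_series (\<lambda>x. u (k x))"
proof (rule fps_ext)
  fix n
  have fin: "finite {x. u x = n}"
    using assms(1) unfolding finite_fibres_def by (rule_tac finite_subset[of _ "{x. u x < Suc n}"]) auto
  have "{x. u x = n} = (h ` {x. u (h x) = n}) \<union> (k ` {x. u (k x) = n})"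
    using assms(5) by auto
  moreover have "(h ` {x. u (h x) = n}) \<inter> (k ` {x. u (k x) = n}) = {}"
    using assms(4) by auto
  ultimately have "card {x. u x = n} = card (h ` {x. u (h x) = n}) + card (k ` {x. u (k x) = n})"
    using fin by (simp only: card_Un_disjoint finite_Un)
  also have "\<dots> = card {x. u (h x) = n} + card {x. u (k x) = n}"
    using assms(2,3) by (simp add: card_image inj_on_def)
  finally show "fps_nth (weight_series u :: 'r fps) n = fps_nth (weight_series (\<lambda>x. u (h x)) + weight_series (\<lambda>x. u (k x))) n"
    by (simp add: weight_series_def)
qed

lemma weight_series_add_const: "weight_series (\<lambda>x. u x + c) = fps_X ^ c * weight_series u"
proof (rule fps_ext)
  fix n
  have "{x. u x + c = n} = (if n < c then {} else {x. u x = n - c})" by auto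
  thus "fps_nth (weight_series (\<lambda>x. u x + c)) n = fps_nth (fps_X ^ c * weight_series u) n"
    by (simp add: weight_series_def fps_X_power_mult_nth)
qed

lemma finite_fibres_double: "finite_fibres u \<Longrightarrow> finite_fibres (\<lambda>x. 2 * u x)"
  unfolding finite_fibres_def
proof
  fix n assume "\<forall>n. finite {x. u x < n}"
  thus "finite {x. 2 * u x < n}"
    by (rule_tac finite_subset[of _ "{x. u x < n}"]) auto
qed

lemma weight_series_compose_X2:
  assumes "finite_fibres u"
  shows "(weight_series u :: 'a::idom fps) oo fps_X ^ 2 = weight_series (\<lambda>x. 2 * u x)"
proof (rule weight_series_unique[OF finite_fibres_double[OF assms]])
  fix M
  have fin: "finite {x. u x < M}" using assms by (simp add: finite_fibres_def)
  have "eq_upto M (weight_series u oo fps_X ^ 2 :: 'a fps) ((\<Sum>x\<in>{x. u x < M}. fps_X ^ u x) oo fps_X ^ 2)"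
    using fin by (intro eq_upto_compose eq_upto_weight_series) auto
  also have "(\<Sum>x\<in>{x. u x < M}. fps_X ^ u x) oo fps_X ^ 2 =
      (\<Sum>x\<in>{x. u x < M}. fps_X ^ (2 * u x) :: 'a fps)"
    unfolding fps_compose_sum_distrib X_power_compose_X2 ..
  also have "eq_upto M \<dots> (weight_series (\<lambda>x. 2 * u x))"
    using fin by (intro eq_upto_sym[OF eq_upto_weight_series]) auto
  also have "eq_upto M \<dots> (\<Sum>x\<in>{x. 2 * u x < M}. fps_X ^ (2 * u x))"
    using finite_fibres_double[OF assms] by (intro eq_upto_weight_series) (auto simp: finite_fibres_def)
  finally show "eq_upto M (weight_series u oo fps_X ^ 2) (\<Sum>x\<in>{x. 2 * u x < M}. fps_X ^ (2 * u x) :: 'a fps)" .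
qed

section \<open>Theta series with exponents l^2 and l (l + 1) = (l + 1/2)^2 - 1/4\<close>

definition square_wt :: "int \<Rightarrow> nat" where "square_wt l = nat (l * l)"
definition pronic_wt :: "int \<Rightarrow> nat" where "pronic_wt l = nat (l * (l + 1))"

lemma pronic_nonneg: "(l::int) * (l + 1) \<ge> 0"
  by (cases "l \<ge> 0") (auto intro: mult_nonpos_nonpos)

lemma int_square_wt: "int (square_wt l) = l * l" and int_pronic_wt: "int (pronic_wt l) = l * (l + 1)"
  using pronic_nonneg[of l] by (simp_all add: square_wt_def pronic_wt_def)

text \<open>These linear bounds give finite fibres and later measure how far the factor q^(weight)
  compensates for the truncation of the products.\<close>

lemma abs_le_square_wt: "\<bar>l\<bar> \<le> int (square_wt l)"
  and le_pronic_wt: "l \<le> int (pronic_wt l)" "- l - 1 \<le> int (pronic_wt l)"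
proof -
  have *: "\<bar>l\<bar> \<le> l * l" for l :: int
    using mult_right_mono[of 1 "\<bar>l\<bar>" "\<bar>l\<bar>"] by (cases "l = 0") auto
  show "\<bar>l\<bar> \<le> int (square_wt l)" by (simp add: int_square_wt *)
  have "int (pronic_wt l) = l * l + l" "int (pronic_wt l) = (l + 1) * (l + 1) - l - 1"
    by (simp_all add: int_pronic_wt algebra_simps)
  with *[of l] *[of "l + 1"] show "l \<le> int (pronic_wt l)" "- l - 1 \<le> int (pronic_wt l)"
    by (smt (verit) zero_le_square)+
qed

lemma finite_fibres_square_wt: "finite_fibres square_wt" and finite_fibres_pronic_wt: "finite_fibres pronic_wt"
proof -
  have "{l. square_wt l < n} \<subseteq> {- int n..int n}" "{l. pronic_wt l < n} \<subseteq> {- int n..int n}" for n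
  proof safe
    fix l assume "square_wt l < n"
    hence "\<bar>l\<bar> \<le> int n" using abs_le_square_wt[of l] by linarith
    thus "l \<in> {- int n..int n}" by auto
  next
    fix l assume "pronic_wt l < n"
    hence "\<bar>l\<bar> \<le> int n" using le_pronic_wt[of l] by linarith
    thus "l \<in> {- int n..int n}" by auto
  qed
  thus "finite_fibres square_wt" "finite_fibres pronic_wt"
    unfolding finite_fibres_def using finite_subset[OF _ finite_atLeastAtMost_int] by blast+
qed

text \<open>
  Here \<open>theta2\<close> is the classical $\theta_2$ without its factor $q^{1/4}$.
\<close>

definition theta3 :: "'a::idom fps" where "theta3 = weight_series square_wt"
definition theta2 :: "'a::idom fps" where "theta2 = weight_series pronic_wt"

text \<open>
  In both squares the pairs of integers are split by the parity of their sum, and the two classes are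
  parametrized by $(u + v, u - v)$ and a shift of it.
\<close>

lemma theta3_square: "(theta3 :: 'a::idom fps) ^ 2 = (theta3 oo fps_X ^ 2) ^ 2 + fps_X * (theta2 oo fps_X ^ 2) ^ 2"
proof -
  define h k :: "int \<times> int \<Rightarrow> int \<times> int" where "h = (\<lambda>(u, v). (u + v, u - v))"
    and "k = (\<lambda>(u, v). (u + v + 1, u - v))"
  have inj: "inj h" "inj k" by (auto simp: h_def k_def inj_def)
  have par: "h p = (m, n) \<Longrightarrow> even (m + n)" "k p = (m, n) \<Longrightarrow> odd (m + n)" for p m n
    by (auto simp: h_def k_def split: prod.splits)
  have "h p \<noteq> k q" for p q
    using par(1)[of p] par(2)[of q] by (cases "h p") force
  hence disj: "range h \<inter> range k = {}" by blast
  have "(m, n) \<in> range h \<union> range k" for m n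
  proof (cases "even (m + n)")
    case True
    then obtain u where u: "m + n = 2 * u" by blast
    have "h (u, m - u) = (m, n)" using u by (simp add: h_def)
    thus ?thesis by (metis UnI1 rangeI)
  next
    case False
    then obtain u where u: "m + n = 2 * u + 1" by (metis oddE)
    have "k (u, m - u - 1) = (m, n)" using u by (simp add: k_def)
    thus ?thesis by (metis UnI2 rangeI)
  qed
  hence cov: "range h \<union> range k = UNIV" by auto
  \<comment> \<open>(u + v)^2 + (u - v)^2 = 2 u^2 + 2 v^2 on the even class. On the odd class the
    shift adds 2 u + 2 v + 1, which gives pronic weights and the extra factor q.\<close>
  have 1: "(case h p of (x, y) \<Rightarrow> square_wt x + square_wt y) = (case p of (x, y) \<Rightarrow> 2 * square_wt x + 2 * square_wt y)" for p
    by (cases p) (simp add: h_def int_square_wt algebra_simps flip: of_nat_eq_iff[where ?'a = int])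
  have 2: "(case k p of (x, y) \<Rightarrow> square_wt x + square_wt y) = (case p of (x, y) \<Rightarrow> 2 * pronic_wt x + 2 * pronic_wt y) + 1" for p
    by (cases p) (simp add: k_def int_square_wt int_pronic_wt algebra_simps flip: of_nat_eq_iff[where ?'a = int])
  have 3: "theta3 ^ 2 = (weight_series (\<lambda>(x, y). square_wt x + square_wt y) :: 'a fps)"
    by (simp add: theta3_def power2_eq_square weight_series_mult finite_fibres_square_wt)
  note 4 = weight_series_split[OF finite_fibres_add[OF finite_fibres_square_wt finite_fibres_square_wt] inj disj cov,
      where ?'r = 'a, unfolded 1 2 weight_series_add_const]
  show ?thesis
    unfolding 3 unfolding 4
      theta3_def theta2_def weight_series_compose_X2[OF finite_fibres_square_wt] weight_series_compose_X2[OF finite_fibres_pronic_wt]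
    by (simp add: power2_eq_square finite_fibres_square_wt finite_fibres_pronic_wt weight_series_mult finite_fibres_double)
qed

lemma theta2_square: "(theta2 :: 'a::idom fps) ^ 2 = 2 * (theta2 oo fps_X ^ 2) * (theta3 oo fps_X ^ 2)"
proof -
  define h k :: "int \<times> int \<Rightarrow> int \<times> int" where "h = (\<lambda>(u, v). (u + v, u - v))"
    and "k = (\<lambda>(u, v). (u + v, v - u - 1))"
  have inj: "inj h" "inj k" by (auto simp: h_def k_def inj_def)
  have par: "h p = (m, n) \<Longrightarrow> even (m + n)" "k p = (m, n) \<Longrightarrow> odd (m + n)" for p m n
    by (auto simp: h_def k_def split: prod.splits)
  have "h p \<noteq> k q" for p q
    using par(1)[of p] par(2)[of q] by (cases "h p") force
  hence disj: "range h \<inter> range k = {}" by blast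
  have "(m, n) \<in> range h \<union> range k" for m n
  proof (cases "even (m + n)")
    case True
    then obtain u where u: "m + n = 2 * u" by blast
    have "h (u, m - u) = (m, n)" using u by (simp add: h_def)
    thus ?thesis by (metis UnI1 rangeI)
  next
    case False
    then obtain v where v: "m + n = 2 * v + 1" by (metis oddE)
    have "k (m - v - 1, v + 1) = (m, n)" using v by (simp add: k_def)
    thus ?thesis by (metis UnI2 rangeI)
  qed
  hence cov: "range h \<union> range k = UNIV" by auto
  have 1: "(case h p of (x, y) \<Rightarrow> pronic_wt x + pronic_wt y) = (case p of (x, y) \<Rightarrow> 2 * pronic_wt x + 2 * square_wt y)" for p
    by (cases p) (simp add: h_def int_square_wt int_pronic_wt algebra_simps flip: of_nat_eq_iff[where ?'a = int])
  \<comment> \<open>The shift in \<open>k\<close> is chosen to give the odd class the same weight as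
    the even one, hence the factor 2.\<close>
  have 2: "(case k p of (x, y) \<Rightarrow> pronic_wt x + pronic_wt y) = (case p of (x, y) \<Rightarrow> 2 * pronic_wt x + 2 * square_wt y)" for p
    by (cases p) (simp add: k_def int_square_wt int_pronic_wt algebra_simps flip: of_nat_eq_iff[where ?'a = int])
  have 3: "theta2 ^ 2 = (weight_series (\<lambda>(x, y). pronic_wt x + pronic_wt y) :: 'a fps)"
    by (simp add: theta2_def power2_eq_square weight_series_mult finite_fibres_pronic_wt)
  note 4 = weight_series_split[OF finite_fibres_add[OF finite_fibres_pronic_wt finite_fibres_pronic_wt] inj disj cov,
      where ?'r = 'a, unfolded 1 2 weight_series_add_const]
  show ?thesis
    unfolding 3 unfolding 4
      theta3_def theta2_def weight_series_compose_X2[OF finite_fibres_square_wt] weight_series_compose_X2[OF finite_fibres_pronic_wt]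
    by (simp add: finite_fibres_square_wt finite_fibres_pronic_wt weight_series_mult finite_fibres_double)
qed

section \<open>The triple product from its finite forms\<close>

lemma int_choose_two: "int (2 * (k choose 2)) = int k * (int k - 1)"
  by (induction k) (auto simp: numeral_2_eq_2 algebra_simps binomial_eq_0)

lemma prod_lessThan_add: "(\<Prod>i<m+n. f i) = (\<Prod>i<m. f i) * (\<Prod>i<n. f (m + i))"
  for f :: "nat \<Rightarrow> 'a::comm_monoid_mult"
  by (induction n) (auto simp: mult.assoc)

lemma sum_double_reverse: "int (\<Sum>i<n. 2 * (n - Suc i)) = int n * (int n - 1)"
  unfolding sum.nat_diff_reindex[of "\<lambda>i. 2 * i"]
  by (induction n) (auto simp: algebra_simps)

text \<open>
  The next two identities are finite forms of the Jacobi triple product: the $q$-binomial theorem with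
  base $q^2$ and $y = q^{N-1}$, divided by a power of $q$.
\<close>

lemma prod_odd_square:
  "(\<Prod>i<n. 1 + fps_X ^ Suc (2 * i)) ^ 2 =
     (\<Sum>k\<le>2*n. fps_X ^ square_wt (int k - int n) * gauss_binomial (fps_X ^ 2) (2 * n) k :: 'a::idom fps)"
proof (cases "n = 0")
  case False
  define F where "F i = fps_X ^ (2 * n - 1) + 1 * (fps_X ^ 2 :: 'a fps) ^ i" for i :: nat
  \<comment> \<open>The smaller exponent is extracted from every factor: 2 (n - 1 - i) in the lower
    half, 2 n - 1 in the upper half. Here n > 0 keeps 2 n - 1 from being truncated.\<close>
  define c where "c = (\<Sum>i<n. 2 * (n - Suc i)) + n * (2 * n - 1)"
  define P where "P = (\<Prod>i<n. 1 + fps_X ^ Suc (2 * i) :: 'a fps)"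
  have 1: "F (n - Suc i) = fps_X ^ (2 * (n - Suc i)) * (1 + fps_X ^ Suc (2 * i) :: 'a fps)" if "i < n" for i
  proof -
    have "2 * n - 1 = 2 * (n - Suc i) + Suc (2 * i)" using that by simp
    hence e: "fps_X ^ (2 * n - 1) = fps_X ^ (2 * (n - Suc i)) * (fps_X ^ Suc (2 * i) :: 'a fps)"
      by (metis power_add)
    show ?thesis unfolding F_def power_mult[symmetric] e
      by (simp only: distrib_left mult_1 mult_1_right add.commute)
  qed
  have 2: "F (n + i) = fps_X ^ (2 * n - 1) * (1 + fps_X ^ Suc (2 * i) :: 'a fps)" for i
  proof -
    have "2 * (n + i) = 2 * n - 1 + Suc (2 * i)" using False by simp
    hence e: "fps_X ^ (2 * (n + i)) = fps_X ^ (2 * n - 1) * (fps_X ^ Suc (2 * i) :: 'a fps)"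
      by (metis power_add)
    show ?thesis unfolding F_def power_mult[symmetric] e
      by (simp only: distrib_left mult_1 mult_1_right add.commute)
  qed
  have "(\<Prod>i<n+n. F i :: 'a fps) = (\<Prod>i<n. F (n - Suc i)) * (\<Prod>i<n. F (n + i))"
    unfolding prod_lessThan_add prod.nat_diff_reindex ..
  also have "(\<Prod>i<n. F (n - Suc i)) = fps_X ^ (\<Sum>i<n. 2 * (n - Suc i)) * P"
    unfolding P_def power_sum prod.distrib[symmetric] by (intro prod.cong) (auto simp: 1)
  also have "(\<Prod>i<n. F (n + i)) = fps_X ^ (n * (2 * n - 1)) * P"
    unfolding P_def 2 by (simp add: prod.distrib mult.commute flip: power_mult)
  finally have "(\<Prod>i<n+n. F i) = fps_X ^ c * P ^ 2"
    by (simp only: c_def power_add power2_eq_square mult_ac)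
  hence "(\<Prod>i<2*n. F i) = fps_X ^ c * P ^ 2"
    by (simp only: mult_2)
  moreover have "(\<Prod>i<2*n. F i) = (\<Sum>k\<le>2*n. fps_X ^ c * (fps_X ^ square_wt (int k - int n) *
      gauss_binomial (fps_X ^ 2) (2 * n) k))"
    unfolding F_def gauss_binomial_theorem
  proof (intro sum.cong refl)
    fix k assume k: "k \<in> {..2*n}"
    have a: "int (2 * n - 1) = 2 * int n - 1" "int (2 * n - k) = 2 * int n - int k"
      using k False by auto
    \<comment> \<open>Completing the square in k.\<close>
    have "int (2 * (k choose 2) + (2 * n - 1) * (2 * n - k)) = int (c + square_wt (int k - int n))"
      unfolding of_nat_add int_choose_two c_def sum_double_reverse int_square_wt
      unfolding of_nat_mult a by (simp add: algebra_simps)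
    hence "2 * (k choose 2) + (2 * n - 1) * (2 * n - k) = c + square_wt (int k - int n)"
      by (simp only: of_nat_eq_iff)
    hence "(fps_X ^ 2) ^ (k choose 2) * (fps_X ^ (2 * n - 1)) ^ (2 * n - k)
      = fps_X ^ c * (fps_X ^ square_wt (int k - int n) :: 'a fps)"
      by (simp only: power_add[symmetric] power_mult[symmetric])
    thus "(fps_X ^ 2) ^ (k choose 2) * gauss_binomial (fps_X ^ 2) (2 * n) k * 1 ^ k *
         (fps_X ^ (2 * n - 1)) ^ (2 * n - k) =
         fps_X ^ c * (fps_X ^ square_wt (int k - int n) * gauss_binomial (fps_X ^ 2) (2 * n) k :: 'a fps)"
      by (simp add: mult_ac)
  qed
  ultimately have "fps_X ^ c * P ^ 2 = fps_X ^ c *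
     (\<Sum>k\<le>2*n. fps_X ^ square_wt (int k - int n) * gauss_binomial (fps_X ^ 2) (2 * n) k)"
    by (simp only: sum_distrib_left)
  thus ?thesis unfolding P_def by simp
qed (simp add: square_wt_def)

lemma prod_even_square:
  "2 * (\<Prod>i<n. 1 + fps_X ^ (2 * Suc i)) ^ 2 =
     (\<Sum>k\<le>2*n+1. fps_X ^ pronic_wt (int k - int n - 1) * gauss_binomial (fps_X ^ 2) (2 * n + 1) k
       :: 'a::idom fps)"
proof -
  define F where "F i = fps_X ^ (2 * n) + 1 * (fps_X ^ 2 :: 'a fps) ^ i" for i :: nat
  define c where "c = (\<Sum>i<n. 2 * (n - Suc i)) + 2 * n + n * (2 * n)"
  define P where "P = (\<Prod>i<n. 1 + fps_X ^ (2 * Suc i) :: 'a fps)"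
  have 1: "F (n - Suc i) = fps_X ^ (2 * (n - Suc i)) * (1 + fps_X ^ (2 * Suc i) :: 'a fps)"
    if "i < n" for i
  proof -
    have "2 * n = 2 * (n - Suc i) + 2 * Suc i" using that by simp
    hence "fps_X ^ (2 * n) = fps_X ^ (2 * (n - Suc i)) * (fps_X ^ (2 * Suc i) :: 'a fps)"
      by (metis power_add)
    thus ?thesis unfolding F_def by (simp only: power_mult[symmetric] algebra_simps)
  qed
  have 2: "F (Suc n + i) = fps_X ^ (2 * n) * (1 + fps_X ^ (2 * Suc i) :: 'a fps)" for i
  proof -
    have "2 * (Suc n + i) = 2 * n + 2 * Suc i" by simp
    hence e: "fps_X ^ (2 * (Suc n + i)) = fps_X ^ (2 * n) * (fps_X ^ (2 * Suc i) :: 'a fps)"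
      by (metis power_add)
    show ?thesis unfolding F_def power_mult[symmetric] e
      by (simp only: distrib_left mult_1 mult_1_right add.commute)
  qed
  have "(\<Prod>i<Suc n+n. F i :: 'a fps) = (\<Prod>i<n. F (n - Suc i)) * F n * (\<Prod>i<n. F (Suc n + i))"
    unfolding prod_lessThan_add prod.nat_diff_reindex by simp
  also have "(\<Prod>i<n. F (n - Suc i)) = fps_X ^ (\<Sum>i<n. 2 * (n - Suc i)) * P"
    unfolding P_def power_sum prod.distrib[symmetric] by (intro prod.cong) (auto simp: 1)
  also have "(\<Prod>i<n. F (Suc n + i)) = fps_X ^ (n * (2 * n)) * P"
    unfolding P_def 2 by (simp add: prod.distrib mult.commute flip: power_mult)
  \<comment> \<open>The number of factors is odd, and the middle one, whose two summands coincide,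
    is the source of the 2 in \<open>theta2\<close>.\<close>
  also have "F n = 2 * (fps_X ^ (2 * n) :: 'a fps)"
    by (simp add: F_def flip: power_mult mult_2)
  finally have "(\<Prod>i<Suc n+n. F i) = fps_X ^ c * (2 * P ^ 2)"
    by (simp only: c_def power_add power2_eq_square mult_ac)
  hence "(\<Prod>i<2*n+1. F i) = fps_X ^ c * (2 * P ^ 2)"
    by (simp only: mult_2[of n] add_Suc Suc_eq_plus1[symmetric])
  moreover have "(\<Prod>i<2*n+1. F i) = (\<Sum>k\<le>2*n+1. fps_X ^ c * (fps_X ^ pronic_wt (int k - int n - 1) *
      gauss_binomial (fps_X ^ 2) (2 * n + 1) k))"
    unfolding F_def gauss_binomial_theorem
  proof (intro sum.cong refl)
    fix k assume k: "k \<in> {..2*n+1}"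
    have a: "int (2 * n + 1 - k) = 2 * int n + 1 - int k" using k by auto
    have "int (2 * (k choose 2) + (2 * n) * (2 * n + 1 - k)) = int (c + pronic_wt (int k - int n - 1))"
      unfolding of_nat_add int_choose_two c_def sum_double_reverse int_pronic_wt
      unfolding of_nat_mult a by (simp add: algebra_simps)
    hence "2 * (k choose 2) + (2 * n) * (2 * n + 1 - k) = c + pronic_wt (int k - int n - 1)"
      by (simp only: of_nat_eq_iff)
    hence "(fps_X ^ 2) ^ (k choose 2) * (fps_X ^ (2 * n)) ^ (2 * n + 1 - k)
      = fps_X ^ c * (fps_X ^ pronic_wt (int k - int n - 1) :: 'a fps)"
      by (simp only: power_add[symmetric] power_mult[symmetric])
    thus "(fps_X ^ 2) ^ (k choose 2) * gauss_binomial (fps_X ^ 2) (2 * n + 1) k * 1 ^ k *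
         (fps_X ^ (2 * n)) ^ (2 * n + 1 - k) =
         fps_X ^ c * (fps_X ^ pronic_wt (int k - int n - 1) *
           gauss_binomial (fps_X ^ 2) (2 * n + 1) k :: 'a fps)"
      by (simp add: mult_ac)
  qed
  ultimately have "fps_X ^ c * (2 * P ^ 2) = fps_X ^ c *
     (\<Sum>k\<le>2*n+1. fps_X ^ pronic_wt (int k - int n - 1) * gauss_binomial (fps_X ^ 2) (2 * n + 1) k)"
    by (simp only: sum_distrib_left)
  thus ?thesis unfolding P_def by simp
qed

lemma unit_factors_prod_minus_X2: "unit_factors (\<lambda>i. 1 - fps_X ^ (2 * Suc i))"
  by (intro unit_factors_X_power) simp

text \<open>In \<open>gauss_binomial_prod\<close> each of the three products agrees with the
  infinite one modulo q^M; cancelling one copy of the latter, a unit, leaves the claim.\<close>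

lemma eq_upto_gauss_binomial:
  assumes "M \<le> k" "M \<le> l"
  shows "eq_upto M (gauss_binomial (fps_X ^ 2) (k + l) k * (prod_minus oo fps_X ^ 2)) (1 :: 'a::field fps)"
proof -
  define e where "e m = (\<Prod>i<m. 1 - (fps_X ^ 2) ^ Suc i :: 'a fps)" for m
  define E where "E = (prod_minus oo fps_X ^ 2 :: 'a fps)"
  have e: "eq_upto M E (e m)" if "M \<le> m" for m
    using eq_upto_inf_prod[OF unit_factors_prod_minus_X2 that, where ?'a = 'a]
    unfolding e_def E_def prod_minus_X2 power_mult .
  define G where "G = gauss_binomial (fps_X ^ 2 :: 'a fps) (k + l) k"
  have E0: "fps_nth E 0 \<noteq> 0"
    unfolding E_def prod_minus_X2 using inf_prod_nth_0[OF unit_factors_prod_minus_X2, where ?'a = 'a] by simp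
  have "eq_upto M (G * E * E) (G * e k * e l)"
    using assms by (intro eq_upto_mult e) auto
  also have "G * e k * e l = e (k + l)"
    unfolding G_def e_def by (rule gauss_binomial_prod)
  also have "eq_upto M \<dots> E" by (rule eq_upto_sym[OF e]) (use assms in simp)
  finally have "eq_upto M (G * E * E * inverse E) (E * inverse E)"
    by (intro eq_upto_mult) auto
  thus ?thesis
    unfolding G_def E_def[symmetric] using E0 by (simp add: mult.assoc inverse_mult_eq_1' )
qed

text \<open>The Gaussian binomial of index k is known only to order min(k, 2n - k), which is bad at
  both ends. There the exponent (k - n)^2 is large, and min(k, 2n - k) + |k - n| = n, so every
  summand is correct modulo q^n.\<close>

lemma theta3_eq_prod: "(theta3 :: 'a::field fps) = (prod_odd_minus oo - fps_X) ^ 2 * (prod_minus oo fps_X ^ 2)"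
proof (rule sym, rule eq_upto_all_imp_eq)
  fix n
  define E where "E = (prod_minus oo fps_X ^ 2 :: 'a fps)"
  define h where "h k = int k - int n" for k
  have inj: "inj_on h A" for A by (auto simp: h_def inj_on_def)
  have q: "unit_factors (\<lambda>i. 1 + fps_X ^ Suc (2 * i) :: 'a fps)" by (intro unit_factors_X_power) simp
  have "eq_upto n ((prod_odd_minus oo - fps_X) ^ 2 * E) ((\<Prod>i<n. 1 + fps_X ^ Suc (2 * i)) ^ 2 * E)"
    unfolding prod_odd_minus_neg by (intro eq_upto_mult eq_upto_power eq_upto_inf_prod q eq_upto_refl order_refl)
  also have "(\<Prod>i<n. 1 + fps_X ^ Suc (2 * i)) ^ 2 * E =
     (\<Sum>k\<le>2*n. fps_X ^ square_wt (h k) * (gauss_binomial (fps_X ^ 2) (2 * n) k * E))"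
    unfolding prod_odd_square h_def by (simp add: sum_distrib_right mult.assoc)
  also have "eq_upto n \<dots> (\<Sum>k\<le>2*n. fps_X ^ square_wt (h k) * 1)"
  proof (intro eq_upto_sum)
    fix k assume "k \<in> {..2*n}"
    hence k: "k \<le> 2 * n" by simp
    define M where "M = min k (2 * n - k)"
    have "eq_upto M (gauss_binomial (fps_X ^ 2) (2 * n) k * E) 1"
      using eq_upto_gauss_binomial[of M k "2 * n - k", where ?'a = 'a] k by (simp add: M_def E_def)
    hence "eq_upto (M + square_wt (h k)) (fps_X ^ square_wt (h k) * (gauss_binomial (fps_X ^ 2) (2 * n) k * E))
       (fps_X ^ square_wt (h k) * 1)"
      by (rule eq_upto_power_mult)
    moreover have "n \<le> M + square_wt (h k)"
      using abs_le_square_wt[of "h k"] k unfolding h_def M_def by linarith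
    ultimately show "eq_upto n (fps_X ^ square_wt (h k) * (gauss_binomial (fps_X ^ 2) (2 * n) k * E))
       (fps_X ^ square_wt (h k) * 1)"
      by (rule eq_upto_mono)
  qed
  also have "(\<Sum>k\<le>2*n. fps_X ^ square_wt (h k) * 1) = (\<Sum>l\<in>h ` {..2*n}. fps_X ^ square_wt l :: 'a fps)"
    by (subst sum.reindex[OF inj]) (simp add: o_def)
  also have "eq_upto n \<dots> theta3"
    unfolding theta3_def
  proof (intro eq_upto_sym[OF eq_upto_weight_series])
    show "{l. square_wt l < n} \<subseteq> h ` {..2*n}"
    proof safe
      fix l assume "square_wt l < n"
      hence "\<bar>l\<bar> < int n" using abs_le_square_wt[of l] by linarith
      thus "l \<in> h ` {..2*n}"
        by (intro image_eqI[of _ _ "nat (l + int n)"]) (auto simp: h_def)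
    qed
  qed auto
  finally show "eq_upto n ((prod_odd_minus oo - fps_X) ^ 2 * (prod_minus oo fps_X ^ 2)) (theta3 :: 'a fps)"
    by (simp add: E_def)
qed

lemma theta2_eq_prod: "(theta2 :: 'a::field fps) = 2 * (prod_plus oo fps_X ^ 2) ^ 2 * (prod_minus oo fps_X ^ 2)"
proof (rule sym, rule eq_upto_all_imp_eq)
  fix n
  define E where "E = (prod_minus oo fps_X ^ 2 :: 'a fps)"
  define h where "h k = int k - int n - 1" for k
  have inj: "inj_on h A" for A by (auto simp: h_def inj_on_def)
  have q: "unit_factors (\<lambda>i. 1 + fps_X ^ (2 * Suc i) :: 'a fps)" by (intro unit_factors_X_power) simp
  have "eq_upto n (2 * (prod_plus oo fps_X ^ 2) ^ 2 * E) (2 * (\<Prod>i<n. 1 + fps_X ^ (2 * Suc i)) ^ 2 * E)"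
    unfolding prod_plus_X2 by (intro eq_upto_mult eq_upto_power eq_upto_inf_prod q eq_upto_refl order_refl)
  also have "2 * (\<Prod>i<n. 1 + fps_X ^ (2 * Suc i)) ^ 2 * E =
     (\<Sum>k\<le>2*n+1. fps_X ^ pronic_wt (h k) * (gauss_binomial (fps_X ^ 2) (2 * n + 1) k * E))"
    unfolding prod_even_square h_def sum_distrib_right mult.assoc ..
  also have "eq_upto n \<dots> (\<Sum>k\<le>2*n+1. fps_X ^ pronic_wt (h k) * 1)"
  proof (intro eq_upto_sum)
    fix k assume "k \<in> {..2*n+1}"
    hence k: "k \<le> 2 * n + 1" by simp
    define M where "M = min k (2 * n + 1 - k)"
    have "eq_upto M (gauss_binomial (fps_X ^ 2) (2 * n + 1) k * E) 1"
      using eq_upto_gauss_binomial[of M k "2 * n + 1 - k", where ?'a = 'a] k by (simp add: M_def E_def)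
    hence "eq_upto (M + pronic_wt (h k)) (fps_X ^ pronic_wt (h k) * (gauss_binomial (fps_X ^ 2) (2 * n + 1) k * E))
       (fps_X ^ pronic_wt (h k) * 1)"
      by (rule eq_upto_power_mult)
    moreover have "n \<le> M + pronic_wt (h k)"
      using le_pronic_wt[of "h k"] k unfolding h_def M_def by linarith
    ultimately show "eq_upto n (fps_X ^ pronic_wt (h k) * (gauss_binomial (fps_X ^ 2) (2 * n + 1) k * E))
       (fps_X ^ pronic_wt (h k) * 1)"
      by (rule eq_upto_mono)
  qed
  also have "(\<Sum>k\<le>2*n+1. fps_X ^ pronic_wt (h k) * 1) = (\<Sum>l\<in>h ` {..2*n+1}. fps_X ^ pronic_wt l :: 'a fps)"
    by (subst sum.reindex[OF inj]) (simp add: o_def)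
  also have "eq_upto n \<dots> theta2"
    unfolding theta2_def
  proof (intro eq_upto_sym[OF eq_upto_weight_series])
    show "{l. pronic_wt l < n} \<subseteq> h ` {..2*n+1}"
    proof safe
      fix l assume "pronic_wt l < n"
      hence "l < int n" "- l - 1 < int n" using le_pronic_wt[of l] by linarith+
      thus "l \<in> h ` {..2*n+1}"
        by (intro image_eqI[of _ _ "nat (l + int n + 1)"]) (auto simp: h_def)
    qed
  qed auto
  finally show "eq_upto n (2 * (prod_plus oo fps_X ^ 2) ^ 2 * (prod_minus oo fps_X ^ 2)) (theta2 :: 'a fps)"
    by (simp add: E_def)
qed

lemma compose_neg_X2: "(F oo fps_X ^ 2) oo - fps_X = F oo (fps_X ^ 2 :: 'a::idom fps)"
proof -
  have "(F oo fps_X ^ 2) oo - fps_X = F oo ((fps_X ^ 2) oo - fps_X)"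
    by (intro fps_compose_assoc[symmetric]) auto
  also have "(fps_X ^ 2) oo - fps_X = (fps_X ^ 2 :: 'a fps)"
    by (simp add: fps_X_power_compose)
  finally show ?thesis .
qed

text \<open>With a and b the values of \<open>theta3\<close> and \<open>theta2\<close> at q^2, the
  squares of \<open>theta3\<close> at q and -q are a^2 + q b^2 and a^2 - q b^2. The difference of
  their squares is q (2ab)^2 = q \<open>theta2\<close>^4; dividing by the fourth power of
  \<open>prod_minus\<close> at q^2 gives the identity.\<close>

lemma jacobi_abstrusa:
  "(prod_odd_minus oo - fps_X) ^ 8 - prod_odd_minus ^ 8 = 16 * fps_X * ((prod_plus :: 'a::field_char_0 fps) oo fps_X ^ 2) ^ 8"
proof -
  define A B C E where "A = (prod_odd_minus oo - fps_X :: 'a fps)" and "B = (prod_odd_minus :: 'a fps)"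
    and "C = (prod_plus oo fps_X ^ 2 :: 'a fps)" and "E = (prod_minus oo fps_X ^ 2 :: 'a fps)"
  define a b where "a = (theta3 oo fps_X ^ 2 :: 'a fps)" and "b = (theta2 oo fps_X ^ 2 :: 'a fps)"
  have BA: "A oo - fps_X = B"
  proof -
    have "(prod_odd_minus oo - fps_X) oo - fps_X = prod_odd_minus oo (- fps_X oo - fps_X :: 'a fps)"
      by (intro fps_compose_assoc[symmetric]) auto
    thus ?thesis by (simp add: A_def B_def fps_compose_uminus)
  qed
  have 1: "(theta3 :: 'a fps) = A ^ 2 * E" "theta2 = 2 * C ^ 2 * E"
    unfolding theta3_eq_prod theta2_eq_prod by (simp_all add: A_def C_def E_def)
  have 2: "(A ^ 2 * E) ^ 2 = a ^ 2 + fps_X * b ^ 2"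
    unfolding 1[symmetric] a_def b_def by (rule theta3_square)
  have 3: "(2 * C ^ 2 * E) ^ 2 = 2 * b * a"
    unfolding 1[symmetric] a_def b_def by (rule theta2_square)
  have "((A ^ 2 * E) ^ 2) oo - fps_X = (a ^ 2 + fps_X * b ^ 2) oo - fps_X"
    by (simp only: 2)
  hence 4: "(B ^ 2 * E) ^ 2 = a ^ 2 - fps_X * b ^ 2"
    by (simp add: fps_compose_mult_distrib fps_compose_add_distrib BA E_def a_def b_def compose_neg_X2
         flip: fps_compose_power)
  have "E ^ 4 * (A ^ 8 - B ^ 8) = ((A ^ 2 * E) ^ 2) ^ 2 - ((B ^ 2 * E) ^ 2) ^ 2"
    by (simp add: algebra_simps flip: power_mult)
  also have "\<dots> = fps_X * (2 * b * a) ^ 2"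
    unfolding 2 4 by (simp add: algebra_simps power2_eq_square)
  also have "\<dots> = E ^ 4 * (16 * fps_X * C ^ 8)"
    unfolding 3[symmetric] by (simp add: algebra_simps flip: power_mult)
  finally have "E ^ 4 * (A ^ 8 - B ^ 8) = E ^ 4 * (16 * fps_X * C ^ 8)" .
  moreover have "E \<noteq> 0"
  proof
    assume "E = 0"
    thus False unfolding E_def prod_minus_X2
      using inf_prod_nth_0[OF unit_factors_prod_minus_X2, where ?'a = 'a] by simp
  qed
  ultimately show ?thesis by (simp add: A_def B_def C_def)
qed

section \<open>The quadratic equation for $g$\<close>

text \<open>Links the topological product in \<open>Delta_q\<close> to the products handled by
  truncation.\<close>

lemma Delta_q_eq: "Delta_q = fps_X * prod_minus ^ 24"
proof -
  define F where "F i = (1 - fps_X ^ Suc i :: Q2 fps) ^ 24" for i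
  have q: "unit_factors (\<lambda>i. 1 - fps_X ^ Suc i :: Q2 fps)"
    by (intro unit_factors_X_power) simp
  have "(\<lambda>N. \<Prod>i\<le>N. F i) \<longlonglongrightarrow> prod_minus ^ 24"
  proof (rule tendsto_fpsI)
    fix n
    have "fps_nth (\<Prod>i\<le>N. F i) n = fps_nth (prod_minus ^ 24) n" if "n \<le> N" for N
    proof -
      have "eq_upto (Suc n) (prod_minus ^ 24 :: Q2 fps) ((\<Prod>i<Suc N. 1 - fps_X ^ Suc i) ^ 24)"
        unfolding prod_minus_def using that by (intro eq_upto_power eq_upto_inf_prod q Suc_le_mono[THEN iffD2])
      also have "((\<Prod>i<Suc N. 1 - fps_X ^ Suc i) ^ 24) = (\<Prod>i\<le>N. F i)"
        unfolding F_def lessThan_Suc_atMost prod_power_distrib ..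
      finally show ?thesis by (simp add: eq_upto_def)
    qed
    thus "eventually (\<lambda>N. fps_nth (\<Prod>i\<le>N. F i) n = fps_nth (prod_minus ^ 24) n) sequentially"
      by (auto simp: eventually_sequentially)
  qed
  moreover have "prod_minus ^ 24 \<noteq> (0 :: Q2 fps)" using prod_minus_nonzero by simp
  ultimately have "F has_prod (prod_minus ^ 24)"
    by (simp add: has_prod_def raw_has_prod_def)
  hence "prodinf F = prod_minus ^ 24" by (rule has_prod_unique[symmetric])
  thus ?thesis unfolding Delta_q_def F_def by simp
qed

lemma f_q_prod_odd_minus: "f_q * prod_odd_minus ^ 24 = fps_X"
proof -
  define E where "E = prod_minus oo (fps_X ^ 2 :: Q2 fps)"
  have "Delta_q oo fps_X ^ 2 = fps_X ^ 2 * E ^ 24"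
    unfolding Delta_q_eq E_def by (simp add: fps_compose_mult_distrib flip: fps_compose_power)
  also have "\<dots> * prod_odd_minus ^ 24 = Delta_q * fps_X"
  proof -
    have "prod_minus = prod_odd_minus * E" unfolding E_def by (rule prod_minus_split)
    hence "prod_minus ^ 24 = (prod_odd_minus * E) ^ 24" by (rule arg_cong)
    hence "prod_minus ^ 24 = prod_odd_minus ^ 24 * E ^ 24" by (simp only: power_mult_distrib)
    thus ?thesis unfolding Delta_q_eq by (simp only: power2_eq_square mult_ac)
  qed
  finally have 1: "(Delta_q oo fps_X ^ 2) * prod_odd_minus ^ 24 = Delta_q * fps_X" .
  have nz: "Delta_q \<noteq> 0" using subdegree_Delta_q(1) by force
  have "prod_odd_minus * prod_plus = (1 :: Q2 fps)" by (rule prod_odd_minus_prod_plus)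
  hence "prod_odd_minus ^ 24 * prod_plus ^ 24 = (1 :: Q2 fps)" by (simp flip: power_mult_distrib)
  note BC = this
  have "(Delta_q oo fps_X ^ 2) * (prod_odd_minus ^ 24 * prod_plus ^ 24) = Delta_q * (fps_X * prod_plus ^ 24)"
    unfolding mult.assoc[symmetric] 1 ..
  hence "(Delta_q oo fps_X ^ 2) = Delta_q * (fps_X * prod_plus ^ 24)"
    unfolding BC by (simp only: mult_1_right)
  hence "f_q = fps_X * prod_plus ^ 24"
    unfolding f_q_def by (simp only: nonzero_mult_div_cancel_left[OF nz])
  hence "f_q * prod_odd_minus ^ 24 = fps_X * prod_plus ^ 24 * prod_odd_minus ^ 24" by (rule arg_cong)
  hence "f_q * prod_odd_minus ^ 24 = fps_X * (prod_odd_minus ^ 24 * prod_plus ^ 24)" by (simp only: mult_ac)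
  thus ?thesis unfolding BC by (simp only: mult_1_right)
qed

text \<open>With u, v the eighth powers of \<open>prod_odd_minus\<close> at -q and q, f(q) + f(-q) =
  q (u^3 - v^3) / (uv)^3. Jacobi's identity becomes (u - v) uv = 16 q, and u^3 - v^3 = (u - v)^3 +
  3uv (u - v) produces the constants 16^3 = 4096 and 3 * 16 = 48. Scaling by 64 turns 4096 into
  64.\<close>

lemma g_q_quadratic:
  fixes g' h :: "Q2 fps"
  defines "g' \<equiv> g_q oo - fps_X" and "h \<equiv> g_q oo fps_X ^ 2"
  shows "g_q + g' = 48 * h + 64 * h ^ 2" "g_q * g' = - 64 * h"
proof -
  define A B C where "A = (prod_odd_minus oo - fps_X :: Q2 fps)" and "B = (prod_odd_minus :: Q2 fps)"
    and "C = (prod_plus oo fps_X ^ 2 :: Q2 fps)"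
  define f' k where "f' = f_q oo - fps_X" and "k = f_q oo fps_X ^ 2"
  define u v where "u = A ^ 8" and "v = B ^ 8"
  have f: "f_q * v ^ 3 = fps_X"
    using f_q_prod_odd_minus by (simp add: v_def B_def flip: power_mult)
  have "(f_q * prod_odd_minus ^ 24) oo - fps_X = fps_X oo - fps_X"
    by (simp only: f_q_prod_odd_minus)
  hence f': "f' * u ^ 3 = - fps_X"
    by (simp add: f'_def u_def A_def fps_compose_mult_distrib flip: fps_compose_power power_mult)
  have "(f_q * prod_odd_minus ^ 24) oo fps_X ^ 2 = fps_X oo fps_X ^ 2"
    by (simp only: f_q_prod_odd_minus)
  hence "k * (prod_odd_minus oo fps_X ^ 2) ^ 24 = fps_X ^ 2"
    by (simp add: k_def fps_compose_mult_distrib flip: fps_compose_power)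
  hence k: "k * (u * v) ^ 3 = fps_X ^ 2"
    by (simp add: u_def v_def A_def B_def flip: prod_odd_minus_neg_mult_prod_odd_minus power_mult power_mult_distrib)
  have "(A * B * C) ^ 8 = 1"
    unfolding A_def B_def C_def prod_odd_minus_neg_prod_odd_minus_prod_plus by simp
  hence C: "u * v * C ^ 8 = 1"
    by (simp add: u_def v_def power_mult_distrib)
  \<comment> \<open>Multiplication by u v removes C, as u v C^8 = 1.\<close>
  have "(u - v) * (u * v) = 16 * fps_X * (u * v * C ^ 8)"
    using jacobi_abstrusa[where ?'a = Q2] by (simp add: u_def v_def A_def B_def C_def mult_ac)
  hence J: "(u - v) * (u * v) = 16 * fps_X" by (simp add: C)
  have nz: "u * v \<noteq> 0" using C by auto
  have "(u ^ 3 - v ^ 3) * (u * v) ^ 3 = ((u - v) * (u * v)) ^ 3 + 3 * ((u - v) * (u * v)) * (u * v) ^ 3"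
    by (simp add: power3_eq_cube algebra_simps)
  also have "\<dots> = 4096 * fps_X ^ 3 + 48 * fps_X * (u * v) ^ 3"
    unfolding J by (simp add: power_mult_distrib algebra_simps)
  finally have J3: "(u ^ 3 - v ^ 3) * (u * v) ^ 3 = 4096 * fps_X ^ 3 + 48 * fps_X * (u * v) ^ 3" .
  have "(f_q + f') * ((u * v) ^ 3 * (u * v) ^ 3)
      = (f_q * v ^ 3 * u ^ 3 + f' * u ^ 3 * v ^ 3) * (u * v) ^ 3"
    by (simp add: power_mult_distrib algebra_simps)
  also have "\<dots> = fps_X * ((u ^ 3 - v ^ 3) * (u * v) ^ 3)"
    unfolding f f' by (simp add: algebra_simps)
  also have "\<dots> = 48 * (k * (u * v) ^ 3) * (u * v) ^ 3 + 4096 * (k * (u * v) ^ 3) ^ 2"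
    unfolding J3 k by (simp add: algebra_simps eval_nat_numeral)
  also have "\<dots> = (48 * k + 4096 * k ^ 2) * ((u * v) ^ 3 * (u * v) ^ 3)"
    by (simp add: power2_eq_square algebra_simps)
  finally have s: "f_q + f' = 48 * k + 4096 * k ^ 2"
    using nz by simp
  have "f_q * f' * (u * v) ^ 3 = (f_q * v ^ 3) * (f' * u ^ 3)"
    by (simp add: power_mult_distrib algebra_simps)
  also have "\<dots> = - k * (u * v) ^ 3"
    unfolding f f' by (simp add: k power2_eq_square)
  finally have p: "f_q * f' = - k"
    using nz by (metis mult_right_cancel power_not_zero)
  have c: "fps_const (2 ^ 6) = (64 :: Q2 fps)"
    by (simp add: numeral_fps_const)
  have g: "g_q = 64 * f_q" "g' = 64 * f'" "h = 64 * k"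
    unfolding g'_def h_def f'_def k_def g_q_def c
    by (simp_all add: fps_compose_mult_distrib numeral_fps_const)
  show "g_q + g' = 48 * h + 64 * h ^ 2"
  proof -
    have "g_q + g' = 64 * (f_q + f')" by (simp add: g algebra_simps)
    thus ?thesis unfolding s g by (simp add: power_mult_distrib algebra_simps)
  qed
  show "g_q * g' = - 64 * h"
  proof -
    have "g_q * g' = 64 * 64 * (f_q * f')" by (simp add: g algebra_simps)
    thus ?thesis unfolding p g by simp
  qed
qed

section \<open>The action of U on the powers of g\<close>

lemma U_op_add: "U_op (F + G) = U_op F + U_op G"
  by (simp add: U_op_def fps_eq_iff)

lemma fps_nth_compose_X2:
  "fps_nth ((F :: 'a::comm_ring_1 fps) oo fps_X ^ 2) n = (if even n then fps_nth F (n div 2) else 0)"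
proof -
  have "fps_nth (F oo fps_X ^ 2) n = (\<Sum>i=0..n. if n = 2 * i then fps_nth F i else 0)"
    unfolding fps_compose_nth power_mult[symmetric] by (intro sum.cong refl) (simp add: fps_X_power_iff)
  also have "\<dots> = (if even n then fps_nth F (n div 2) else 0)"
  proof (cases "even n")
    case True
    then obtain m where n: "n = 2 * m" by blast
    have "(\<Sum>i=0..n. if n = 2 * i then fps_nth F i else 0) = (\<Sum>i=0..n. if i = m then fps_nth F i else 0)"
      by (intro sum.cong) (auto simp: n)
    thus ?thesis using n by simp
  next
    case False
    hence "n \<noteq> 2 * i" for i by auto
    thus ?thesis using False by simp
  qed
  finally show ?thesis .
qed

text \<open>The projection formula: U is linear over series in q^2. Hence an algebraic equation for
  g over such series becomes a linear recursion for the U(g^j).\<close>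

lemma U_op_mult_compose_X2: "U_op (F * (H oo fps_X ^ 2)) = U_op F * H"
proof (rule fps_ext)
  fix n
  have "fps_nth (U_op (F * (H oo fps_X ^ 2))) n
      = (\<Sum>i=0..2*n. fps_nth (H oo fps_X ^ 2) i * fps_nth F (2 * n - i))"
    by (simp add: U_op_def fps_mult_nth mult.commute[of F "H oo _"])
  also have "\<dots> = (\<Sum>j=0..n. fps_nth H j * fps_nth F (2 * (n - j)))"
    unfolding fps_nth_compose_X2
  proof (subst sum.mono_neutral_right[where S = "(\<lambda>j. 2 * j) ` {0..n}"])
    show "\<forall>i\<in>{0..2*n} - (\<lambda>j. 2 * j) ` {0..n}.
        (if even i then fps_nth H (i div 2) else 0) * fps_nth F (2 * n - i) = 0"
    proof
      fix i assume i: "i \<in> {0..2*n} - (\<lambda>j. 2 * j) ` {0..n}"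
      have "odd i"
      proof
        assume "even i"
        then obtain j where "i = 2 * j" by blast
        with i show False by auto
      qed
      thus "(if even i then fps_nth H (i div 2) else 0) * fps_nth F (2 * n - i) = 0" by simp
    qed
  qed (auto simp: sum.reindex inj_on_def diff_mult_distrib2)
  also have "\<dots> = fps_nth (U_op F * H) n"
    by (simp add: U_op_def fps_mult_nth mult.commute[of "Abs_fps _" H])
  finally show "fps_nth (U_op (F * (H oo fps_X ^ 2))) n = fps_nth (U_op F * H) n" .
qed

lemma U_op_one: "U_op 1 = 1"
  by (auto simp: U_op_def fps_eq_iff)

text \<open>The even coefficients of g(q) and g(-q) agree, so U(g) is half the trace, read as a
  series in q^2.\<close>

lemma U_op_g: "U_op g_q = 24 * g_q + 32 * g_q ^ 2"
proof (rule fps_ext)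
  fix n
  have "fps_nth (g_q oo - fps_X) (2 * n) = fps_nth g_q (2 * n)"
    by (simp add: fps_compose_uminus')
  hence "2 * fps_nth g_q (2 * n) = fps_nth (g_q + (g_q oo - fps_X)) (2 * n)"
    by simp
  also have "\<dots> = fps_nth ((48 * g_q + 64 * g_q ^ 2) oo fps_X ^ 2) (2 * n)"
    unfolding g_q_quadratic
    by (simp add: fps_compose_add_distrib fps_compose_mult_distrib numeral_fps_const flip: fps_compose_power)
  also have "\<dots> = fps_nth (2 * (24 * g_q + 32 * g_q ^ 2)) n"
    by (simp add: fps_nth_compose_X2)
  finally show "fps_nth (U_op g_q) n = fps_nth (24 * g_q + 32 * g_q ^ 2) n"
    by (simp add: U_op_def numeral_fps_const distrib_left[of "2::Q2", symmetric]
         del: distrib_left_numeral)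
qed

text \<open>The quadratic equation multiplied by g^j; its coefficients come out of U by the
  projection formula.\<close>

lemma U_op_rec:
  "U_op (g_q ^ Suc (Suc j)) = (48 * g_q + 64 * g_q ^ 2) * U_op (g_q ^ Suc j) + 64 * g_q * U_op (g_q ^ j)"
proof -
  define g' h where "g' = g_q oo - fps_X" and "h = g_q oo fps_X ^ 2"
  note q = g_q_quadratic[folded g'_def h_def]
  have "g_q ^ 2 = (g_q + g') * g_q - g_q * g'" by (simp add: algebra_simps power2_eq_square)
  hence "g_q ^ 2 = (48 * h + 64 * h ^ 2) * g_q + 64 * h" unfolding q by simp
  hence "g_q ^ Suc (Suc j) = g_q ^ Suc j * (48 * h + 64 * h ^ 2) + g_q ^ j * (64 * h)"
  proof -
    assume *: "g_q ^ 2 = (48 * h + 64 * h ^ 2) * g_q + 64 * h"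
    have "g_q ^ Suc (Suc j) = g_q ^ j * g_q ^ 2" by (simp add: power2_eq_square mult_ac)
    thus ?thesis unfolding * by (simp only: power_Suc2 distrib_left mult_ac)
  qed
  also have "48 * h + 64 * h ^ 2 = (48 * g_q + 64 * g_q ^ 2) oo fps_X ^ 2"
    by (simp add: h_def fps_compose_add_distrib fps_compose_mult_distrib numeral_fps_const flip: fps_compose_power)
  also have "64 * h = (64 * g_q) oo fps_X ^ 2"
    by (simp add: h_def fps_compose_mult_distrib numeral_fps_const)
  finally show ?thesis
    by (simp only: U_op_add U_op_mult_compose_X2 mult.commute)
qed

section \<open>The matrix of $U$\<close>

text \<open>
  The convention $1/n! = 0$ for $n < 0$ keeps the recursion valid for all integers, so that no boundary
  terms appear below.
\<close>

definition rfact :: "int \<Rightarrow> 'a::field_char_0" where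
  "rfact n = (if n < 0 then 0 else inverse (fact (nat n)))"

lemma rfact_of_nat: "rfact (int n) = inverse (fact n)"
  by (simp add: rfact_def)

lemma rfact_neg [simp]: "n < 0 \<Longrightarrow> rfact n = 0"
  by (simp add: rfact_def)

lemma rfact_rec: "rfact (n - 1) = of_int n * rfact n"
proof (cases "n > 0")
  case True
  then obtain m where "n = int (Suc m)" using pos_int_cases by (metis Suc_pred' of_nat_0_less_iff)
  moreover have "int (Suc m) - 1 = int m" by simp
  ultimately show ?thesis
    by (simp only: rfact_of_nat fact_Suc of_int_of_nat_eq inverse_mult_distrib mult.assoc[symmetric])
       (simp del: of_nat_Suc)
next
  case False
  thus ?thesis by (cases "n = 0") auto
qed

lemma rfact_pred: "m = n - 1 \<Longrightarrow> of_int n = t \<Longrightarrow> rfact m = t * rfact n"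
  using rfact_rec by blast

text \<open>The u_ij of the overview, with 4^(i+j) / 2 = 2^(2i+2j-1). The formula would give 0 in
  column 0, which is therefore set by hand to U(1) = 1.\<close>

definition Umat :: "nat \<Rightarrow> nat \<Rightarrow> 'a::field_char_0" where
  "Umat i j = (if j = 0 then (if i = 0 then 1 else 0) else
     3 * of_nat j * 4 ^ (i + j) / 2 * fact (i + j - 1) *
       rfact (2 * int i - int j) * rfact (2 * int j - int i))"

text \<open>All four entries are polynomial multiples of one hypergeometric term, and a polynomial
  identity remains. The lowest column is \<open>Suc j\<close>, since column 0 does not follow the
  formula.\<close>

lemma Umat_rec:
  "Umat (Suc (Suc i)) (Suc (Suc (Suc j))) = 48 * Umat (Suc i) (Suc (Suc j)) +
     64 * Umat i (Suc (Suc j)) + (64 * Umat (Suc i) (Suc j) :: 'a::field_char_0)"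
proof -
  \<comment> \<open>The largest arguments that occur, so that the other reciprocal factorials are
    polynomial multiples of these.\<close>
  define a b :: 'a where "a = rfact (2 * int i - int j + 1)" and "b = rfact (2 * int j - int i + 4)"
  define x y :: 'a where "x = of_nat i" and "y = of_nat j"
  have a: "rfact (2 * int i - int j) = (2 * x - y + 1) * a"
    "rfact (2 * int i - int j - 1) = (2 * x - y) * (2 * x - y + 1) * a"
    "rfact (2 * int i - int j - 2) = (2 * x - y - 1) * (2 * x - y) * (2 * x - y + 1) * a"
  proof -
    show 1: "rfact (2 * int i - int j) = (2 * x - y + 1) * a"
      unfolding a_def by (rule rfact_pred) (simp_all add: x_def y_def)
    have 2: "rfact (2 * int i - int j - 1) = (2 * x - y) * rfact (2 * int i - int j)"
      by (rule rfact_pred) (simp_all add: x_def y_def)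
    have 3: "rfact (2 * int i - int j - 2) = (2 * x - y - 1) * rfact (2 * int i - int j - 1)"
      by (rule rfact_pred) (simp_all add: x_def y_def)
    show "rfact (2 * int i - int j - 1) = (2 * x - y) * (2 * x - y + 1) * a"
      "rfact (2 * int i - int j - 2) = (2 * x - y - 1) * (2 * x - y) * (2 * x - y + 1) * a"
      unfolding 3 2 1 by (simp_all only: mult.assoc)
  qed
  have b: "rfact (2 * int j - int i + 3) = (2 * y - x + 4) * b"
    "rfact (2 * int j - int i + 2) = (2 * y - x + 3) * (2 * y - x + 4) * b"
    "rfact (2 * int j - int i + 1) = (2 * y - x + 2) * (2 * y - x + 3) * (2 * y - x + 4) * b"
  proof -
    show 1: "rfact (2 * int j - int i + 3) = (2 * y - x + 4) * b"
      unfolding b_def by (rule rfact_pred) (simp_all add: x_def y_def)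
    have 2: "rfact (2 * int j - int i + 2) = (2 * y - x + 3) * rfact (2 * int j - int i + 3)"
      by (rule rfact_pred) (simp_all add: x_def y_def)
    have 3: "rfact (2 * int j - int i + 1) = (2 * y - x + 2) * rfact (2 * int j - int i + 2)"
      by (rule rfact_pred) (simp_all add: x_def y_def)
    show "rfact (2 * int j - int i + 2) = (2 * y - x + 3) * (2 * y - x + 4) * b"
      "rfact (2 * int j - int i + 1) = (2 * y - x + 2) * (2 * y - x + 3) * (2 * y - x + 4) * b"
      unfolding 3 2 1 by (simp_all only: mult.assoc)
  qed
  define P :: 'a where "P = fact (i + j + 1)"
  have i: "2 * int (Suc (Suc i)) - int (Suc (Suc (Suc j))) = 2 * int i - int j + 1"
     "2 * int (Suc i) - int (Suc (Suc j)) = 2 * int i - int j"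
     "2 * int i - int (Suc (Suc j)) = 2 * int i - int j - 2"
     "2 * int (Suc i) - int (Suc j) = 2 * int i - int j + 1"
     "2 * int (Suc (Suc (Suc j))) - int (Suc (Suc i)) = 2 * int j - int i + 4"
     "2 * int (Suc (Suc j)) - int (Suc i) = 2 * int j - int i + 3"
     "2 * int (Suc (Suc j)) - int i = 2 * int j - int i + 4"
     "2 * int (Suc j) - int (Suc i) = 2 * int j - int i + 1"
    by simp_all
  have n: "Suc (Suc i) + Suc (Suc (Suc j)) - 1 = Suc (Suc (Suc (i + j + 1)))"
     "Suc i + Suc (Suc j) - 1 = Suc (i + j + 1)" "i + Suc (Suc j) - 1 = i + j + 1"
     "Suc i + Suc j - 1 = i + j + 1" by simp_all
  have "Umat (Suc (Suc i)) (Suc (Suc (Suc j))) =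
     3 * (y + 3) * (4 ^ (i + j) * 1024) / 2 * ((x + y + 4) * (x + y + 3) * (x + y + 2) * P) * a * b"
    unfolding Umat_def i n fact_Suc by (simp add: x_def y_def a_def b_def P_def algebra_simps)
  moreover have "Umat (Suc i) (Suc (Suc j)) =
     3 * (y + 2) * (4 ^ (i + j) * 64) / 2 * ((x + y + 2) * P) * ((2 * x - y + 1) * a) * ((2 * y - x + 4) * b)"
    unfolding Umat_def i n fact_Suc a b by (simp add: x_def y_def P_def algebra_simps)
  moreover have "Umat i (Suc (Suc j)) = 3 * (y + 2) * (4 ^ (i + j) * 16) / 2 * P *
     ((2 * x - y - 1) * (2 * x - y) * (2 * x - y + 1) * a) * b"
    unfolding Umat_def i n fact_Suc a b by (simp add: x_def y_def b_def P_def)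
  moreover have "Umat (Suc i) (Suc j) = 3 * (y + 1) * (4 ^ (i + j) * 16) / 2 * P * a *
     ((2 * y - x + 2) * (2 * y - x + 3) * (2 * y - x + 4) * b)"
    unfolding Umat_def i n fact_Suc a b by (simp add: x_def y_def a_def P_def)
  moreover have "3 * (y + 3) * (e * 1024) / 2 * ((x + y + 4) * (x + y + 3) * (x + y + 2) * P) * a * b =
     48 * (3 * (y + 2) * (e * 64) / 2 * ((x + y + 2) * P) * ((2 * x - y + 1) * a) * ((2 * y - x + 4) * b)) +
     64 * (3 * (y + 2) * (e * 16) / 2 * P * ((2 * x - y - 1) * (2 * x - y) * (2 * x - y + 1) * a) * b) +
     64 * (3 * (y + 1) * (e * 16) / 2 * P * a * ((2 * y - x + 2) * (2 * y - x + 3) * (2 * y - x + 4) * b))" for e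
    by algebra
  ultimately show ?thesis by simp
qed

lemma Umat_eq_0: "j > 0 \<Longrightarrow> 2 * j < i \<Longrightarrow> Umat i j = 0" "2 * i < j \<Longrightarrow> Umat i j = 0"
  by (auto simp: Umat_def)

definition Ufps :: "nat \<Rightarrow> 'a::field_char_0 fps" where
  "Ufps j = Abs_fps (\<lambda>i. Umat i j)"

lemma nth_X_mult: "fps_nth (fps_X * (F :: 'a::comm_ring_1 fps)) i = (case i of 0 \<Rightarrow> 0 | Suc i \<Rightarrow> fps_nth F i)"
  by (cases i) auto

lemma Ufps_1: "Ufps 1 = 24 * fps_X + (32 * fps_X ^ 2 :: 'a::field_char_0 fps)"
proof (rule fps_ext)
  fix i :: nat
  consider "i = 0" | "i = 1" | "i = 2" | "i > 2" by linarith
  thus "fps_nth (Ufps 1) i = fps_nth (24 * fps_X + (32 * fps_X ^ 2 :: 'a fps)) i"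
    by cases (auto simp: Ufps_def Umat_eq_0 numeral_fps_const fps_X_power_iff,
       auto simp: Umat_def rfact_def fact_numeral eval_nat_numeral)
qed

text \<open>The one step of the recursion that involves the exceptional column 0, checked
  coefficient by coefficient.\<close>

lemma Ufps_2: "Ufps 2 = (48 * fps_X + 64 * fps_X ^ 2) * Ufps 1 + 64 * (fps_X :: 'a::field_char_0 fps)"
proof (rule fps_ext)
  fix i :: nat
  have e: "(48 * fps_X + 64 * fps_X ^ 2) * Ufps 1 + 64 * fps_X =
    64 * fps_X + 1152 * fps_X ^ 2 + 3072 * fps_X ^ 3 + (2048 * fps_X ^ 4 :: 'a fps)"
    unfolding Ufps_1 by (simp add: algebra_simps eval_nat_numeral)
  consider "i = 0" | "i = 1" | "i = 2" | "i = 3" | "i = 4" | "i > 4" by linarith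
  thus "fps_nth (Ufps 2) i = fps_nth ((48 * fps_X + 64 * fps_X ^ 2) * Ufps 1 + 64 * (fps_X :: 'a fps)) i"
    unfolding e
    by cases (auto simp: Ufps_def Umat_eq_0 numeral_fps_const fps_X_power_iff,
       auto simp: Umat_def rfact_def fact_numeral eval_nat_numeral)
qed

lemma Ufps_rec:
  "Ufps (Suc (Suc j)) = (48 * fps_X + 64 * fps_X ^ 2) * Ufps (Suc j) + 64 * fps_X * (Ufps j :: 'a::field_char_0 fps)"
proof (cases j)
  case 0
  have "Ufps 0 = (1 :: 'a fps)" by (auto simp: Ufps_def Umat_def fps_eq_iff)
  thus ?thesis using Ufps_2 by (simp add: 0 numeral_2_eq_2)
next
  case (Suc k)
  show ?thesis
  proof (rule fps_ext)
    fix i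
    have "fps_nth ((48 * fps_X + 64 * fps_X ^ 2) * Ufps (Suc j) + 64 * fps_X * Ufps j) i
      = 48 * fps_nth (fps_X * Ufps (Suc j)) i + 64 * fps_nth (fps_X * (fps_X * Ufps (Suc j))) i
         + (64 * fps_nth (fps_X * Ufps j) i :: 'a)"
      by (simp add: numeral_fps_const power2_eq_square ring_distribs mult.assoc)
    also have "\<dots> = fps_nth (Ufps (Suc (Suc j))) i"
      unfolding nth_X_mult Ufps_def using Umat_rec[of _ k, where ?'a = 'a]
      by (auto simp: Suc Umat_eq_0 split: nat.splits)
    finally show "fps_nth (Ufps (Suc (Suc j))) i =
      fps_nth ((48 * fps_X + 64 * fps_X ^ 2) * Ufps (Suc j) + 64 * fps_X * (Ufps j :: 'a fps)) i" ..
  qed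
qed

lemma U_op_power: "U_op (g_q ^ j) = Ufps j oo g_q"
proof (induction j rule: induct_nat_012)
  case 0
  have "Ufps 0 = (1 :: Q2 fps)" by (auto simp: Ufps_def Umat_def fps_eq_iff)
  thus ?case by (simp add: U_op_one)
next
  case 1
  have "Ufps (Suc 0) = 24 * fps_X + (32 * fps_X ^ 2 :: Q2 fps)" using Ufps_1 by simp
  thus ?case
    by (simp add: U_op_g fps_compose_add_distrib fps_compose_mult_distrib g_q_nth(1) numeral_fps_const
         flip: fps_compose_power)
next
  case (ge2 j)
  show ?case unfolding U_op_rec Ufps_rec ge2
    by (simp add: fps_compose_add_distrib fps_compose_mult_distrib g_q_nth(1) numeral_fps_const
         flip: fps_compose_power)
qed

text \<open>U(g^j) is a polynomial in g, so its coefficients tend to 0, as the uniqueness of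
  \<open>g_coeffs\<close> requires.\<close>

lemma g_coeffs_U_op: "j > 0 \<Longrightarrow> g_coeffs (U_op (g_q ^ j)) i = Umat i j"
proof -
  assume j: "j > 0"
  have "eventually (\<lambda>i. Umat i j = (0 :: Q2)) sequentially"
    using eventually_gt_at_top[of "2 * j"] by eventually_elim (simp add: Umat_eq_0 j)
  hence "(\<lambda>i. Umat i j :: Q2) \<longlonglongrightarrow> 0" by (rule tendsto_eventually)
  thus ?thesis
    unfolding U_op_power Ufps_def by (simp add: g_coeffs_compose)
qed

section \<open>A terminating hypergeometric sum\<close>

text \<open>The summand of index k in the (i, j) entry of L D R, stripped of the factors that do not
  depend on k; see \<open>Lmat_Cmat\<close>.\<close>

definition LUterm :: "nat \<Rightarrow> nat \<Rightarrow> nat \<Rightarrow> 'a::field_char_0" where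
  "LUterm i j k = 4 * of_nat k * fact (2 * k + i - 1) * fact (2 * k + j - 1) *
     rfact (2 * int k - int i) * rfact (2 * int k - int j) * rfact (int i - int k) *
     rfact (int j - int k) * rfact (int i + int k) * rfact (int j + int k)"

text \<open>
  The Wilf--Zeilberger certificate for the recursion in \<open>i\<close> of the sums of \<open>LUterm\<close>.
\<close>

definition LUcert :: "nat \<Rightarrow> nat \<Rightarrow> nat \<Rightarrow> 'a::field_char_0" where
  "LUcert i j k = - 2 * (3 * of_nat i + 2) * fact (2 * k + i - 1) * fact (2 * k + j - 1) *
     rfact (2 * int k - int i - 2) * rfact (2 * int k - int j - 2) * rfact (int i + 1 - int k) *
     rfact (int j - int k) * rfact (int i + int k) * rfact (int j + int k - 1)"

text \<open>A first-order recursion operator in i, applied to the summand, is a difference in k. The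
  factor x + y + 1 clears the denominator of the certificate; dividing by a common term leaves a
  polynomial identity.\<close>

lemma LUterm_telescope:
  fixes x y :: "'a::field_char_0" and i j :: nat
  defines "x \<equiv> of_nat i" and "y \<equiv> of_nat j"
  assumes k: "k > 0"
  shows "(x + y + 1) * ((x + 1) * (2 * x - y + 1) * (2 * x - y + 2) * LUterm (Suc i) j k
     - 2 * (x + y) * (2 * x + 1) * (2 * y - x) * LUterm i j k) = LUcert i j (Suc k) - LUcert i j k"
proof -
  define z :: 'a where "z = of_nat k"
  \<comment> \<open>Again each reciprocal factorial is taken at the largest argument that
    occurs.\<close>
  define a b c d e h :: 'a where "a = rfact (2 * int k - int i)" and "b = rfact (2 * int k - int j)"
    and "c = rfact (int i + 1 - int k)" and "d = rfact (int j - int k)"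
    and "e = rfact (int i + int k + 1)" and "h = rfact (int j + int k)"
  define P Q :: 'a where "P = fact (2 * k + i - 1)" and "Q = fact (2 * k + j - 1)"
  note r = rfact_rec[where ?'a = 'a]
  have a: "rfact (2 * int k - int i - 1) = (2 * z - x) * a"
     "rfact (2 * int k - int i - 2) = (2 * z - x - 1) * ((2 * z - x) * a)"
  proof -
    show 1: "rfact (2 * int k - int i - 1) = (2 * z - x) * a"
      unfolding a_def by (rule rfact_pred) (simp_all add: x_def z_def)
    show "rfact (2 * int k - int i - 2) = (2 * z - x - 1) * ((2 * z - x) * a)"
      unfolding 1[symmetric] by (rule rfact_pred) (simp_all add: x_def z_def)
  qed
  have b: "rfact (2 * int k - int j - 2) = (2 * z - y - 1) * ((2 * z - y) * b)"
  proof -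
    have 1: "rfact (2 * int k - int j - 1) = (2 * z - y) * b"
      unfolding b_def by (rule rfact_pred) (simp_all add: y_def z_def)
    show ?thesis
      unfolding 1[symmetric] by (rule rfact_pred) (simp_all add: y_def z_def)
  qed
  have c: "rfact (int i - int k) = (x + 1 - z) * c"
    using r[of "int i + 1 - int k"] by (simp add: c_def x_def z_def)
  have d: "rfact (int j - int k - 1) = (y - z) * d"
    using r[of "int j - int k"] by (simp add: d_def y_def z_def)
  have e: "rfact (int i + int k) = (x + z + 1) * e"
    using r[of "int i + int k + 1"] by (simp add: e_def x_def z_def)
  have h: "rfact (int j + int k - 1) = (y + z) * h"
    using r[of "int j + int k"] by (simp add: h_def y_def z_def)
  have n: "2 * Suc k + i - 1 = Suc (Suc (2 * k + i - 1))" "2 * Suc k + j - 1 = Suc (Suc (2 * k + j - 1))"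
    "2 * k + Suc i - 1 = Suc (2 * k + i - 1)" using k by auto
  have P: "fact (Suc (2 * k + i - 1)) = (2 * z + x) * P"
     "fact (Suc (Suc (2 * k + i - 1))) = (2 * z + x + 1) * ((2 * z + x) * P)"
    using k unfolding fact_Suc P_def by (simp_all add: z_def x_def)
  have Q: "fact (Suc (Suc (2 * k + j - 1))) = (2 * z + y + 1) * ((2 * z + y) * Q)"
    using k unfolding fact_Suc Q_def by (simp_all add: z_def y_def)
  have ix: "2 * int k - int (Suc i) = 2 * int k - int i - 1" "int (Suc i) - int k = int i + 1 - int k"
     "int (Suc i) + int k = int i + int k + 1" "2 * int (Suc k) - int i - 2 = 2 * int k - int i"
     "2 * int (Suc k) - int j - 2 = 2 * int k - int j" "int i + 1 - int (Suc k) = int i - int k"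
     "int j - int (Suc k) = int j - int k - 1" "int i + int (Suc k) = int i + int k + 1"
     "int j + int (Suc k) - 1 = int j + int k" by simp_all
  define W where "W = a * b * c * d * e * h * P * Q"
  have "LUterm (Suc i) j k = 4 * z * (2 * z + x) * (2 * z - x) * W"
    unfolding LUterm_def ix n P a by (simp add: W_def a_def b_def c_def d_def e_def h_def Q_def z_def)
  moreover have "LUterm i j k = 4 * z * (x + 1 - z) * (x + z + 1) * W"
    unfolding LUterm_def c e by (simp add: W_def a_def b_def d_def h_def Q_def z_def P_def)
  moreover have "LUcert i j (Suc k) = - 2 * (3 * x + 2) * (2 * z + x) * (2 * z + x + 1) * (2 * z + y) *
      (2 * z + y + 1) * (x + 1 - z) * (y - z) * W"
    unfolding LUcert_def ix n P Q c d by (simp add: W_def a_def b_def e_def h_def x_def)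
  moreover have "LUcert i j k = - 2 * (3 * x + 2) * (2 * z - x) * (2 * z - x - 1) * (2 * z - y) *
      (2 * z - y - 1) * (x + z + 1) * (y + z) * W"
    unfolding LUcert_def a b e h by (simp add: W_def c_def d_def P_def Q_def x_def)
  moreover have "(x + y + 1) * ((x + 1) * (2 * x - y + 1) * (2 * x - y + 2) * (4 * z * (2 * z + x) * (2 * z - x) * W)
     - 2 * (x + y) * (2 * x + 1) * (2 * y - x) * (4 * z * (x + 1 - z) * (x + z + 1) * W)) =
    - 2 * (3 * x + 2) * (2 * z + x) * (2 * z + x + 1) * (2 * z + y) * (2 * z + y + 1) * (x + 1 - z) * (y - z) * W
   - (- 2 * (3 * x + 2) * (2 * z - x) * (2 * z - x - 1) * (2 * z - y) * (2 * z - y - 1) * (x + z + 1) * (y + z) * W)"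
    by algebra
  ultimately show ?thesis by (simp only:)
qed

definition LUsum :: "nat \<Rightarrow> nat \<Rightarrow> 'a::field_char_0" where
  "LUsum i j = fact (i + j - 1) * fact (2 * i) * fact (2 * j) / (fact i ^ 2 * fact j ^ 2) *
     rfact (2 * int i - int j) * rfact (2 * int j - int i)"

lemma LUsum_rec:
  fixes x y :: "'a::field_char_0" and i j :: nat
  defines "x \<equiv> of_nat i" and "y \<equiv> of_nat j"
  assumes j: "j > 0"
  shows "(x + 1) * (2 * x - y + 1) * (2 * x - y + 2) * LUsum (Suc i) j =
     2 * (x + y) * (2 * x + 1) * (2 * y - x) * LUsum i j"
proof -
  define a b :: 'a where "a = rfact (2 * int i - int j + 2)" and "b = rfact (2 * int j - int i)"
  have a: "rfact (2 * int i - int j) = (2 * x - y + 1) * ((2 * x - y + 2) * a)"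
  proof -
    have 1: "rfact (2 * int i - int j + 1) = (2 * x - y + 2) * a"
      unfolding a_def by (rule rfact_pred) (simp_all add: x_def y_def)
    show ?thesis
      unfolding 1[symmetric] by (rule rfact_pred) (simp_all add: x_def y_def)
  qed
  have b: "rfact (2 * int j - int i - 1) = (2 * y - x) * b"
    unfolding b_def by (rule rfact_pred) (simp_all add: x_def y_def)
  have n: "Suc i + j - 1 = Suc (i + j - 1)" "2 * Suc i = Suc (Suc (2 * i))"
     "2 * int (Suc i) - int j = 2 * int i - int j + 2" "2 * int j - int (Suc i) = 2 * int j - int i - 1"
    using j by simp_all
  have f: "fact (Suc (i + j - 1)) = (x + y) * fact (i + j - 1)"
     "fact (Suc (Suc (2 * i))) = (2 * x + 2) * ((2 * x + 1) * (fact (2 * i) :: 'a))"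
     "fact (Suc i) = (x + 1) * (fact i :: 'a)"
    unfolding fact_Suc using j by (simp_all add: x_def y_def algebra_simps)
  have nz: "x + 1 \<noteq> 0" by (metis x_def of_nat_Suc of_nat_neq_0 add.commute)
  have "LUsum (Suc i) j = (x + y) * fact (i + j - 1) * ((2 * x + 2) * ((2 * x + 1) * fact (2 * i))) * fact (2 * j) /
     (((x + 1) * fact i) ^ 2 * fact j ^ 2) * a * ((2 * y - x) * b)"
    unfolding LUsum_def n f b by (simp add: a_def)
  also have "\<dots> = 2 * (x + y) * (2 * x + 1) * (2 * y - x) *
       (fact (i + j - 1) * fact (2 * i) * fact (2 * j) / (fact i ^ 2 * fact j ^ 2) * a * b) / (x + 1)"
    using nz by (simp add: divide_simps power2_eq_square) algebra
  finally have 0: "LUsum (Suc i) j = 2 * (x + y) * (2 * x + 1) * (2 * y - x) *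
       (fact (i + j - 1) * fact (2 * i) * fact (2 * j) / (fact i ^ 2 * fact j ^ 2) * a * b) / (x + 1)" .
  have 1: "(x + 1) * LUsum (Suc i) j = 2 * (x + y) * (2 * x + 1) * (2 * y - x) *
       (fact (i + j - 1) * fact (2 * i) * fact (2 * j) / (fact i ^ 2 * fact j ^ 2) * a * b)"
    unfolding 0 by (simp only: times_divide_eq_right nonzero_mult_div_cancel_left[OF nz])
  have "LUsum i j = (2 * x - y + 1) * (2 * x - y + 2) *
       (fact (i + j - 1) * fact (2 * i) * fact (2 * j) / (fact i ^ 2 * fact j ^ 2) * a * b)"
    unfolding LUsum_def a by (simp add: b_def)
  thus ?thesis using 1 by algebra
qed

text \<open>Both sides satisfy the same first-order recursion in i: the sums by telescoping, the
  closed form by \<open>LUsum_rec\<close>. At i = 2 j only the summand k = j survives.\<close>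

lemma sum_LUterm:
  assumes "i > 0" "j > 0"
  shows "(\<Sum>k=1..j. LUterm i j k) = (LUsum i j :: 'a::field_char_0)"
proof -
  \<comment> \<open>The recursion in \<open>i\<close> degenerates at \<open>i = 2 * j\<close>, so the induction runs downwards from there.\<close>
  have big: "(\<Sum>k=1..j. LUterm i j k) = (LUsum i j :: 'a)" if "i \<ge> 2 * j" for i
  proof (cases "i = 2 * j")
    case True
    have "(\<Sum>k=1..j. LUterm i j k) = (\<Sum>k\<in>{j}. LUterm i j k :: 'a)"
      using assms(2) by (intro sum.mono_neutral_right) (auto simp: LUterm_def True)
    also have "\<dots> = LUsum i j"
    proof -
      have 1: "2 * int j - int (2 * j) = int 0" "2 * int j - int j = int j" "int (2 * j) - int j = int j"
        "int j - int j = int 0" "int (2 * j) + int j = int (3 * j)" "int j + int j = int (2 * j)"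
        "2 * int (2 * j) - int j = int (3 * j)"
        by auto
      have 2: "2 * j + 2 * j - 1 = 4 * j - 1" "2 * j + j - 1 = 3 * j - 1" "2 * (2 * j) = 4 * j" by simp_all
      have "fact (4 * j) = 4 * of_nat j * (fact (4 * j - 1) :: 'a)"
        using assms(2) by (subst fact_reduce) auto
      thus ?thesis
        by (simp only: True LUterm_def LUsum_def sum.insert sum.empty finite.emptyI empty_iff not_False_eq_True
              1 2 rfact_of_nat) (simp add: field_simps power2_eq_square)
    qed
    finally show ?thesis .
  next
    case False
    with that have i: "i > 2 * j" by simp
    hence "LUterm i j k = (0 :: 'a)" if "k \<le> j" for k
      using that by (simp add: LUterm_def)
    thus ?thesis using i by (simp add: LUsum_def)
  qed
  show ?thesis
  proof (cases "i \<ge> 2 * j")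
    case False
    hence "i \<le> 2 * j" by simp
    from this assms(1) show ?thesis
    proof (induction i rule: inc_induct)
      case (step i)
      define x y :: 'a where "x = of_nat i" and "y = of_nat j"
      have IH: "(\<Sum>k=1..j. LUterm (Suc i) j k) = (LUsum (Suc i) j :: 'a)" by (rule step.IH) simp
      have "(\<Sum>k=1..j. LUcert i j (Suc k) - LUcert i j k) = LUcert i j (Suc j) - (LUcert i j 1 :: 'a)"
        using assms(2) by (subst sum_Suc_diff) auto
      \<comment> \<open>The upper end vanishes through \<open>rfact (-1)\<close>, the lower one
        through \<open>rfact (- int i)\<close> with i > 0.\<close>
      also have "\<dots> = 0"
        using step.prems by (simp add: LUcert_def)
      finally have tel: "(\<Sum>k=1..j. LUcert i j (Suc k) - LUcert i j k) = (0 :: 'a)" .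
      have "(x + y + 1) * ((x + 1) * (2 * x - y + 1) * (2 * x - y + 2) * (\<Sum>k=1..j. LUterm (Suc i) j k)
         - 2 * (x + y) * (2 * x + 1) * (2 * y - x) * (\<Sum>k=1..j. LUterm i j k)) =
         (\<Sum>k=1..j. (x + y + 1) * ((x + 1) * (2 * x - y + 1) * (2 * x - y + 2) * LUterm (Suc i) j k
         - 2 * (x + y) * (2 * x + 1) * (2 * y - x) * LUterm i j k))"
        unfolding sum_distrib_left[of "(x + 1) * (2 * x - y + 1) * (2 * x - y + 2)"]
          sum_distrib_left[of "2 * (x + y) * (2 * x + 1) * (2 * y - x)"] sum_subtractf[symmetric]
        by (rule sum_distrib_left)
      also have "\<dots> = (\<Sum>k=1..j. LUcert i j (Suc k) - LUcert i j k)"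
        unfolding x_def y_def by (intro sum.cong refl LUterm_telescope) auto
      finally have eq: "(x + y + 1) * ((x + 1) * (2 * x - y + 1) * (2 * x - y + 2) * LUsum (Suc i) j
         - 2 * (x + y) * (2 * x + 1) * (2 * y - x) * (\<Sum>k=1..j. LUterm i j k)) = 0"
        unfolding tel IH .
      have "x + y + 1 = of_nat (Suc (i + j))" "x + y = of_nat (i + j)" "2 * x + 1 = of_nat (Suc (2 * i))"
        "2 * y - x = of_nat (2 * j - i)"
        using step.hyps by (simp_all add: x_def y_def of_nat_diff)
      hence nz: "x + y + 1 \<noteq> 0" "2 * (x + y) * (2 * x + 1) * (2 * y - x) \<noteq> 0"
        using step.hyps assms by (simp_all only: of_nat_eq_0_iff mult_eq_0_iff) auto
      have "2 * (x + y) * (2 * x + 1) * (2 * y - x) * (\<Sum>k=1..j. LUterm i j k) =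
          2 * (x + y) * (2 * x + 1) * (2 * y - x) * LUsum i j"
        using eq nz(1) unfolding LUsum_rec[OF assms(2), of i, where ?'a = 'a, folded x_def y_def]
        by (simp only: mult_eq_0_iff right_minus_eq) auto
      thus ?case using nz(2) mult_left_cancel by blast
    qed (use big in simp)
  qed (rule big)
qed

section \<open>Non-archimedean fields\<close>

lemma vabs_0 [simp]: "vabs (0 :: 'a::nonarch_field) = 0"
  using dist_vabs[of "0::'a" 0] by simp

lemma vabs_nonneg [simp]: "vabs x \<ge> 0"
  using dist_vabs[of x 0] zero_le_dist[of x 0] by simp

lemma vabs_eq_0_iff [simp]: "vabs x = 0 \<longleftrightarrow> x = 0"
  using dist_vabs[of x 0] dist_eq_0_iff[of x 0] by simp

lemma vabs_pos_iff [simp]: "vabs x > 0 \<longleftrightarrow> x \<noteq> 0"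
  using vabs_nonneg[of x] vabs_eq_0_iff[of x] by linarith

lemma vabs_1 [simp]: "vabs (1 :: 'a::nonarch_field) = 1"
  using vabs_mult[of "1::'a" 1] by simp

lemma vabs_minus [simp]: "vabs (- x :: 'a::nonarch_field) = vabs x"
proof -
  have "vabs (- 1 :: 'a) * vabs (- 1 :: 'a) = 1" using vabs_mult[of "- 1 :: 'a" "- 1"] by simp
  hence "vabs (- 1 :: 'a) = 1" using vabs_nonneg[of "- 1 :: 'a"] by (simp add: square_eq_1_iff)
  thus ?thesis using vabs_mult[of "- 1" x] by simp
qed

lemma vabs_minus_commute: "vabs (x - y) = vabs (y - x :: 'a::nonarch_field)"
  by (metis minus_diff_eq vabs_minus)

lemma vabs_diff: "vabs (x - y) \<le> max (vabs x) (vabs y)"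
  using vabs_add[of x "- y"] by simp

lemma vabs_add_le: "vabs x \<le> B \<Longrightarrow> vabs y \<le> B \<Longrightarrow> vabs (x + y) \<le> B"
  using vabs_add[of x y] by simp

lemma vabs_sum_le:
  assumes "B \<ge> 0" "\<And>i. i \<in> A \<Longrightarrow> vabs (f i) \<le> B"
  shows "vabs (sum f A) \<le> B"
  using assms(2)
  by (induction A rule: infinite_finite_induct) (auto simp: assms(1) intro: vabs_add_le)

lemma vabs_prod: "vabs (prod f A) = (\<Prod>i\<in>A. vabs (f i))"
  by (induction A rule: infinite_finite_induct) (auto simp: vabs_mult)

lemma vabs_power: "vabs (x ^ n) = vabs x ^ n"
  by (induction n) (auto simp: vabs_mult)

lemma vabs_inverse: "vabs (inverse x) = inverse (vabs x)"
proof (cases "x = 0")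
  case False
  hence "vabs x * vabs (inverse x) = 1" using vabs_mult[of x "inverse x"] by simp
  thus ?thesis by (metis inverse_unique)
qed auto

lemma vabs_divide: "vabs (x / y) = vabs x / vabs y"
  by (simp add: divide_inverse vabs_mult vabs_inverse)

lemma vabs_of_nat_le: "vabs (of_nat n) \<le> 1"
  by (induction n) (auto intro: vabs_add_le)

lemma vabs_of_int_le: "vabs (of_int n) \<le> 1"
  by (cases n rule: int_cases2) (auto intro: vabs_of_nat_le)

text \<open>Strict dominance of one summand is how exact absolute values of sums are obtained
  below.\<close>

lemma vabs_add_eq:
  assumes "vabs y < vabs x"
  shows "vabs (x + y) = vabs x"
proof (rule antisym)
  show "vabs (x + y) \<le> vabs x" using assms by (intro vabs_add_le) auto
  show "vabs x \<le> vabs (x + y)"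
    using vabs_diff[of "x + y" y] assms by (auto simp: max_def split: if_splits)
qed

lemma vabs_Q2_odd: "odd n \<Longrightarrow> vabs (of_nat n :: Q2) = 1"
proof -
  assume n: "odd n"
  hence "n \<noteq> 0" by (rule_tac notI) simp
  hence "abs2 (of_nat n) = 2 powi (int (multiplicity 2 (1::int)) - int (multiplicity 2 (int n)))"
    using abs2_divide[of "int n" 1] by simp
  also have "multiplicity 2 (int n) = 0" using n by (intro not_dvd_imp_multiplicity_0) simp
  finally show ?thesis by (simp add: vabs_Q2_of_nat)
qed

lemma vabs_Q2_2: "vabs (2 :: Q2) = 1 / 2"
proof -
  have "abs2 (of_nat 2) = 2 powi (int (multiplicity 2 (1::int)) - int (multiplicity 2 (2::int)))"
    using abs2_divide[of 2 1] by simp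
  also have "multiplicity 2 (2::int) = 1" by (intro multiplicity_self) auto
  finally show ?thesis using vabs_Q2_of_nat[of 2] by (simp add: power_int_minus)
qed

lemma vabs_Q2_even: "even n \<Longrightarrow> vabs (of_nat n :: Q2) \<le> 1 / 2"
proof -
  assume "even n"
  then obtain m where "n = 2 * m" by blast
  thus ?thesis using vabs_of_nat_le[of m, where ?'a = Q2] by (simp add: vabs_mult vabs_Q2_2)
qed

section \<open>2-adic absolute values of factorials\<close>

definition wfact :: "nat \<Rightarrow> real" where "wfact n = vabs (fact n :: Q2)"

lemma wfact_pos [simp]: "wfact n > 0"
  by (simp add: wfact_def)

lemma wfact_Suc: "wfact (Suc n) = vabs (of_nat (Suc n) :: Q2) * wfact n"
  unfolding wfact_def fact_Suc by (simp only: vabs_mult)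

lemma wfact_Suc_double: "wfact (Suc (2 * n)) = wfact (2 * n)"
  unfolding wfact_Suc by (simp add: vabs_Q2_odd del: of_nat_Suc)

text \<open>(2n)! is 2^n n! times odd numbers. This takes the place of Legendre's formula.\<close>

lemma wfact_double: "wfact (2 * n) = (1 / 2) ^ n * wfact n"
proof (induction n)
  case (Suc n)
  have "wfact (2 * Suc n) = vabs (of_nat (2 * Suc n) :: Q2) * wfact (Suc (2 * n))"
    using wfact_Suc[of "Suc (2 * n)"] by simp
  also have "vabs (of_nat (2 * Suc n) :: Q2) = 1 / 2 * vabs (of_nat (Suc n) :: Q2)"
    unfolding of_nat_mult vabs_mult by (simp add: vabs_Q2_2)
  finally show ?case unfolding wfact_Suc_double Suc.IH wfact_Suc[of n] by simp
qed simp

lemma wfact_antimono: "m \<le> n \<Longrightarrow> wfact n \<le> wfact m"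
proof (induction n rule: dec_induct)
  case (step n)
  have "wfact (Suc n) \<le> 1 * wfact n"
    unfolding wfact_Suc by (intro mult_right_mono vabs_of_nat_le) (simp add: less_imp_le)
  thus ?case using step.IH by simp
qed simp

section \<open>The triangular factorization of the matrix of $U$\<close>

text \<open>The part of \<open>LUterm\<close> that involves i, normalised by a factor in k so that
  the diagonal is 1. The reciprocal factorials confine column k to k <= i <= 2k.\<close>

definition Lmat :: "nat \<Rightarrow> nat \<Rightarrow> 'a::field_char_0" where
  "Lmat i k = 4 ^ i / 4 ^ k * fact i ^ 2 * fact (2 * k + i - 1) * fact (2 * k) ^ 2 /
     (fact k * fact (3 * k - 1) * fact (2 * i)) *
     rfact (2 * int k - int i) * rfact (int i - int k) * rfact (int i + int k)"

definition Dmat :: "nat \<Rightarrow> 'a::field_char_0" where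
  "Dmat k = 2 * 16 ^ k * fact (3 * k) ^ 2 * fact k ^ 2 / (3 * fact (2 * k) ^ 4)"

text \<open>This is D R. As u_ij / j is symmetric in i and j, R is the transpose of L conjugated by
  the diagonal matrix of the indices.\<close>

definition Cmat :: "nat \<Rightarrow> nat \<Rightarrow> 'a::field_char_0" where
  "Cmat k j = Dmat k * (Lmat j k * of_nat j / of_nat k)"

lemma Lmat_Cmat:
  assumes k: "k > 0"
  shows "Lmat i k * Cmat k j =
    3 * of_nat j * 4 ^ (i + j) / 2 * (fact i ^ 2 * fact j ^ 2 / (fact (2 * i) * fact (2 * j))) *
    (LUterm i j k :: 'a::field_char_0)"
proof -
  define P :: 'a where "P = fact (3 * k - 1)"
  define z :: 'a where "z = of_nat k"
  define q :: 'a where "q = 4 ^ k"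
  define F :: 'a where "F = fact k"
  define F2 :: 'a where "F2 = fact (2 * k)"
  have nz: "P \<noteq> 0" "z \<noteq> 0" "q \<noteq> 0" "F \<noteq> 0" "F2 \<noteq> 0" "fact (2 * i) \<noteq> (0::'a)" "fact (2 * j) \<noteq> (0::'a)"
    using k by (auto simp: P_def z_def q_def F_def F2_def)
  have f: "fact (3 * k) = 3 * z * P"
    unfolding P_def z_def using k by (subst fact_reduce) auto
  have q: "(16 :: 'a) ^ k = q * q" by (simp add: q_def flip: power_mult_distrib)
  have D: "Dmat k = 2 * (q * q) * (3 * z * P) ^ 2 * F ^ 2 / (3 * F2 ^ 4)"
    unfolding Dmat_def f q F_def F2_def ..
  have L: "Lmat i k = 4 ^ i / q * fact i ^ 2 * fact (2 * k + i - 1) * F2 ^ 2 /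
     (F * P * fact (2 * i)) * rfact (2 * int k - int i) * rfact (int i - int k) * rfact (int i + int k)" for i
    unfolding Lmat_def q_def F_def F2_def P_def ..
  show ?thesis
    unfolding Cmat_def D L LUterm_def z_def[symmetric] using nz
    by (simp add: divide_simps power_add eval_nat_numeral)
qed

lemma Cmat_eq_0: "j < k \<Longrightarrow> Cmat k j = 0"
  by (simp add: Cmat_def Lmat_def)

lemma Lmat_eq_0: "i < k \<Longrightarrow> Lmat i k = 0" "2 * k < i \<Longrightarrow> Lmat i k = 0"
  by (simp_all add: Lmat_def)

lemma Umat_factorization:
  assumes "i > 0" "j > 0" "j \<le> N"
  shows "Umat i j = (\<Sum>k=1..N. Lmat i k * Cmat k j :: 'a::field_char_0)"
proof -
  have "(\<Sum>k=1..N. Lmat i k * Cmat k j) = (\<Sum>k=1..j. Lmat i k * (Cmat k j :: 'a))"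
    using assms(3) by (intro sum.mono_neutral_right) (auto simp: Cmat_eq_0)
  also have "\<dots> = 3 * of_nat j * 4 ^ (i + j) / 2 *
      (fact i ^ 2 * fact j ^ 2 / (fact (2 * i) * fact (2 * j))) * (\<Sum>k=1..j. LUterm i j k)"
    unfolding sum_distrib_left by (intro sum.cong refl Lmat_Cmat) auto
  also have "\<dots> = Umat i j"
    unfolding sum_LUterm[OF assms(1,2)] LUsum_def Umat_def using assms(2)
    by (simp add: field_simps power2_eq_square)
  finally show ?thesis ..
qed

lemma Lmat_diag: "k > 0 \<Longrightarrow> Lmat k k = (1 :: 'a::field_char_0)"
proof -
  assume k: "k > 0"
  have 1: "2 * int k - int k = int k" "int k - int k = int 0" "int k + int k = int (2 * k)"
    and 2: "2 * k + k - 1 = 3 * k - 1" by simp_all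
  show ?thesis
    unfolding Lmat_def 1 2 rfact_of_nat by (simp add: field_simps power2_eq_square)
qed

text \<open>
  With $i = k + r$ every factorial of an even number is reduced by $|(2n)!| = 2^{-n} |n!|$; what remains is
  a power of 2 and three quotients that are visibly integral.
\<close>

lemma vabs_Lmat:
  assumes k: "k > 0" and r: "r \<le> k"
  shows "vabs (Lmat (k + r) k :: Q2) = (1/2) ^ (r - r div 2) * (wfact (k + r) / wfact (k + r div 2)) *
     vabs (of_nat (k choose r) :: Q2) * (wfact (3 * k - 1 + r) / wfact (3 * k - 1))"
proof -
  define s where "s = r div 2"
  define p :: real where "p = 1 / 2"
  have p: "p > 0" by (simp add: p_def)
  have v4: "vabs (4 :: Q2) = p ^ 2"
    using vabs_mult[of "2::Q2" 2] by (simp add: vabs_Q2_2 p_def power2_eq_square)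
  have vr: "vabs (rfact (int n) :: Q2) = inverse (wfact n)" for n
    by (simp add: rfact_of_nat vabs_inverse wfact_def)
  have i: "2 * int k - int (k + r) = int (k - r)" "int (k + r) - int k = int r"
    "int (k + r) + int k = int (2 * k + r)" and n: "2 * k + (k + r) - 1 = 3 * k - 1 + r"
    using r k by simp_all
  have e: "2 * k + r = 2 * (k + s) \<or> 2 * k + r = Suc (2 * (k + s))"
    unfolding s_def by presburger
  hence w2: "wfact (2 * k + r) = p ^ (k + s) * wfact (k + s)"
    using wfact_double[of "k + s"] wfact_Suc_double[of "k + s"] by (auto simp: p_def)
  have w: "wfact (2 * k) = p ^ k * wfact k" "wfact (2 * (k + r)) = p ^ (k + r) * wfact (k + r)"
    unfolding p_def by (rule wfact_double)+
  have "of_nat (fact r * fact (k - r) * (k choose r)) = (of_nat (fact k) :: Q2)"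
    by (simp only: binomial_fact_lemma[OF r])
  hence ch: "wfact k = wfact r * wfact (k - r) * vabs (of_nat (k choose r) :: Q2)"
    unfolding wfact_def by (simp only: of_nat_mult of_nat_fact flip: vabs_mult)
  have p_split: "p ^ r = p ^ (r - s) * p ^ s"
    by (simp add: s_def flip: power_add)
  have nz: "wfact n \<noteq> 0" for n using wfact_pos[of n] by linarith
  have "vabs (Lmat (k + r) k :: Q2) =
     (p ^ 2) ^ (k + r) / (p ^ 2) ^ k * wfact (k + r) ^ 2 * wfact (3 * k - 1 + r) * wfact (2 * k) ^ 2 /
     (wfact k * wfact (3 * k - 1) * wfact (2 * (k + r))) * inverse (wfact (k - r)) *
     inverse (wfact r) * inverse (wfact (2 * k + r))"
    unfolding Lmat_def i n by (simp only: vabs_mult vabs_divide vabs_power v4 vr wfact_def[symmetric])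
  \<comment> \<open>The exponents of 1/2 add up to 2 r + 2 k - (k + r) - (k + s) = r - s.\<close>
  also have "\<dots> = p ^ (r - s) * (wfact (k + r) / wfact (k + s)) *
      (wfact k / (wfact r * wfact (k - r))) * (wfact (3 * k - 1 + r) / wfact (3 * k - 1))"
    unfolding w2 w power_add p_split power2_eq_square[of "wfact _"] power2_eq_square[of "_ * _"]
    using p nz by (simp add: field_simps power_mult_distrib power2_eq_square) (simp add: p_split)
  also have "wfact k / (wfact r * wfact (k - r)) = vabs (of_nat (k choose r) :: Q2)"
    unfolding ch using nz[of r] nz[of "k - r"] by simp
  finally show ?thesis by (simp add: s_def p_def)
qed

lemma vabs_Lmat_aux:
  assumes k: "k > 0" and r: "r \<le> k"
  shows "vabs (Lmat (k + r) k :: Q2) \<le> (1/2) ^ (r - r div 2) * vabs (of_nat (k choose r) :: Q2)"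
proof -
  have "wfact (k + r) / wfact (k + r div 2) \<le> 1" "wfact (3 * k - 1 + r) / wfact (3 * k - 1) \<le> 1"
    using wfact_antimono[of "k + r div 2" "k + r"] wfact_antimono[of "3 * k - 1" "3 * k - 1 + r"] by auto
  hence "(wfact (k + r) / wfact (k + r div 2)) * (wfact (3 * k - 1 + r) / wfact (3 * k - 1)) \<le> 1 * 1"
    by (intro mult_mono) (auto simp: less_imp_le)
  hence "(1/2) ^ (r - r div 2) * vabs (of_nat (k choose r) :: Q2) *
     ((wfact (k + r) / wfact (k + r div 2)) * (wfact (3 * k - 1 + r) / wfact (3 * k - 1)))
      \<le> (1/2) ^ (r - r div 2) * vabs (of_nat (k choose r) :: Q2) * (1 * 1)"
    by (intro mult_left_mono) auto
  thus ?thesis unfolding vabs_Lmat[OF assms] by (simp add: mult_ac)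
qed

lemma vabs_Lmat_le_half: "k > 0 \<Longrightarrow> i \<noteq> k \<Longrightarrow> vabs (Lmat i k :: Q2) \<le> 1 / 2"
proof -
  assume k: "k > 0" and ik: "i \<noteq> k"
  consider "i < k" | "2 * k < i" | "k \<le> i" "i \<le> 2 * k" by linarith
  thus ?thesis
  proof cases
    case 3
    define r where "r = i - k"
    have r: "r \<le> k" "i = k + r" "r > 0" using 3 ik by (auto simp: r_def)
    have "vabs (Lmat (k + r) k :: Q2) \<le> (1/2) ^ (r - r div 2) * vabs (of_nat (k choose r) :: Q2)"
      by (rule vabs_Lmat_aux[OF k r(1)])
    \<comment> \<open>For r > 0 the exponent r - r div 2 is at least 1.\<close>
    also have "\<dots> \<le> (1/2) ^ 1 * 1"
      using r(3) by (intro mult_mono power_decreasing vabs_of_nat_le) auto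
    finally show ?thesis by (simp add: r)
  qed (auto simp: Lmat_eq_0)
qed

lemma vabs_Lmat_le_1: "k > 0 \<Longrightarrow> vabs (Lmat i k :: Q2) \<le> 1"
  using vabs_Lmat_le_half[of k i] by (cases "i = k") (auto simp: Lmat_diag)

text \<open>The denominator k is absorbed by the binomial coefficient in
  \<open>vabs_Lmat_aux\<close>: k divides (k choose r) r, hence also (k choose r) (k + r).\<close>

lemma vabs_Cmat_le: "k > 0 \<Longrightarrow> vabs (Cmat k j :: Q2) \<le> vabs (Dmat k :: Q2)"
proof -
  assume k: "k > 0"
  have "vabs (Lmat j k * of_nat j / of_nat k :: Q2) \<le> 1"
  proof -
    consider "j < k" | "2 * k < j" | "k \<le> j" "j \<le> 2 * k" by linarith
    thus ?thesis
    proof cases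
      case 3
      define r where "r = j - k"
      have r: "r \<le> k" "j = k + r" using 3 by (auto simp: r_def)
      obtain m where m: "(k choose r) * (k + r) = k * m"
      proof (cases r)
        case (Suc r')
        obtain k' where k': "k = Suc k'" using k by (cases k) auto
        have "(k choose r) * r = k * (k' choose r')"
          using Suc_times_binomial_eq[of k' r'] by (simp add: Suc k' mult.commute)
        hence "(k choose r) * (k + r) = k * ((k choose r) + (k' choose r'))"
          by (simp add: algebra_simps)
        thus ?thesis using that by blast
      qed (use that in auto)
      have "vabs (Lmat j k * of_nat j / of_nat k :: Q2)
          = vabs (Lmat (k + r) k :: Q2) * vabs (of_nat (k + r) :: Q2) / vabs (of_nat k :: Q2)"
        unfolding r(2) vabs_mult vabs_divide ..
      also have "\<dots> \<le> ((1/2) ^ (r - r div 2) * vabs (of_nat (k choose r) :: Q2)) *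
          vabs (of_nat (k + r) :: Q2) / vabs (of_nat k :: Q2)"
        by (intro divide_right_mono mult_right_mono vabs_Lmat_aux k r) auto
      also have "\<dots> = (1/2) ^ (r - r div 2) * (vabs (of_nat ((k choose r) * (k + r)) :: Q2) / vabs (of_nat k :: Q2))"
        by (simp only: of_nat_mult vabs_mult times_divide_eq_right mult.assoc)
      also have "\<dots> = (1/2) ^ (r - r div 2) * vabs (of_nat m :: Q2)"
        unfolding m of_nat_mult vabs_mult using k by simp
      also have "\<dots> \<le> 1 * 1"
        by (intro mult_mono vabs_of_nat_le power_le_one) auto
      finally show ?thesis by simp
    qed (auto simp: Lmat_eq_0)
  qed
  hence "vabs (Dmat k :: Q2) * vabs (Lmat j k * of_nat j / of_nat k :: Q2) \<le> vabs (Dmat k :: Q2) * 1"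
    by (intro mult_left_mono) auto
  thus ?thesis unfolding Cmat_def vabs_mult[of "Dmat k"] by simp
qed

lemma Cmat_diag: "k > 0 \<Longrightarrow> Cmat k k = Dmat k"
  by (simp add: Cmat_def Lmat_diag)

definition slope_abs :: "nat \<Rightarrow> real" where
  "slope_abs k = vabs (Dmat k :: Q2)"

text \<open>16^k cancels the powers of 2 that \<open>wfact_double\<close> extracts from (2k)!^4; a
  k!^4 is left in the denominator, and 3 is a unit.\<close>

lemma slope_abs_eq: "slope_abs k = 1 / 2 * (wfact (3 * k) / wfact k) ^ 2"
proof -
  have v16: "vabs (16 :: Q2) = (1 / 2) ^ 4"
    using vabs_power[of "2::Q2" 4] by (simp add: vabs_Q2_2)
  have v3: "vabs (3 :: Q2) = 1" using vabs_Q2_odd[of 3] by simp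
  have nz: "wfact n \<noteq> 0" for n using wfact_pos[of n] by linarith
  have "slope_abs k = (1 / 2) * ((1 / 2) ^ 4) ^ k * wfact (3 * k) ^ 2 * wfact k ^ 2 / wfact (2 * k) ^ 4"
    unfolding slope_abs_def Dmat_def
    by (simp only: vabs_mult vabs_divide vabs_power vabs_Q2_2 v16 v3 wfact_def mult_1)
  also have "((1 / 2) ^ 4) ^ k = (((1 / 2) ^ k) ^ 4 :: real)"
    by (simp only: mult.commute flip: power_mult)
  finally show ?thesis
    unfolding wfact_double[of k] using nz[of k]
    by (simp add: power_mult_distrib power_divide field_simps eval_nat_numeral)
qed

lemma slope_abs_pos [simp]: "slope_abs k > 0"
  unfolding slope_abs_eq using wfact_pos by (simp add: less_imp_neq[THEN not_sym])

text \<open>The quotient (3k)! / k! grows by 3 (3k + 1) (3k + 2), where one of two consecutive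
  numbers is even; it enters squared.\<close>

lemma slope_abs_Suc: "slope_abs (Suc k) \<le> slope_abs k / 4"
proof -
  define a b where "a = vabs (of_nat (3 * k + 1) :: Q2)" and "b = vabs (of_nat (3 * k + 2) :: Q2)"
  have "3 * Suc k = Suc (Suc (Suc (3 * k)))" by simp
  hence "wfact (3 * Suc k) = vabs (of_nat (3 * Suc k) :: Q2) * (b * (a * wfact (3 * k)))"
    by (simp only: wfact_Suc) (simp add: a_def b_def algebra_simps)
  also have "vabs (of_nat (3 * Suc k) :: Q2) = vabs (of_nat (Suc k) :: Q2)"
    unfolding of_nat_mult vabs_mult using vabs_Q2_odd[of 3] by simp
  finally have "wfact (3 * Suc k) / wfact (Suc k) = (a * b) * (wfact (3 * k) / wfact k)"
    unfolding wfact_Suc[of k] by (simp del: of_nat_Suc)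
  hence "slope_abs (Suc k) = (a * b) ^ 2 * slope_abs k"
    unfolding slope_abs_eq by (simp only: power_mult_distrib mult_ac)
  also have "\<dots> \<le> (1 / 2) ^ 2 * slope_abs k"
  proof (intro mult_right_mono power_mono)
    have "a \<le> 1" "b \<le> 1" unfolding a_def b_def by (rule vabs_of_nat_le)+
    moreover have "a \<ge> 0" "b \<ge> 0" by (simp_all add: a_def b_def)
    moreover have "a \<le> 1 / 2 \<or> b \<le> 1 / 2"
    proof -
      have "even (3 * k + 1) \<or> even (3 * k + 2)" by simp
      thus ?thesis unfolding a_def b_def using vabs_Q2_even by blast
    qed
    ultimately show "a * b \<le> 1 / 2"
      using mult_mono[of a "1/2" b 1] mult_mono[of a 1 b "1/2"] by auto
  qed (auto simp: a_def b_def less_imp_le)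
  finally show ?thesis by (simp add: power2_eq_square)
qed

section \<open>Non-archimedean summation\<close>

text \<open>A family tending to 0 along the cofinite filter is summable. The Fredholm coefficients
  are unordered sums over finite sets of indices, so the sequential version would not do.\<close>

lemma nonarch_has_sum:
  fixes f :: "'i \<Rightarrow> 'a::{nonarch_field, complete_space}"
  assumes fin: "\<And>e. e > 0 \<Longrightarrow> finite {x \<in> A. vabs (f x) \<ge> e}"
  obtains L where "(f has_sum L) A"
proof -
  define F where "F n = {x \<in> A. vabs (f x) \<ge> inverse (real (Suc n))}" for n
  have finF: "finite (F n)" for n unfolding F_def by (intro fin) simp
  have FA: "F n \<subseteq> A" for n by (auto simp: F_def)
  have tail: "vabs (sum f G - sum f (F n)) \<le> inverse (real (Suc n))"
    if "finite G" "F n \<subseteq> G" "G \<subseteq> A" for G n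
  proof -
    have "sum f G - sum f (F n) = sum f (G - F n)"
      using that by (simp add: sum_diff)
    also have "vabs \<dots> \<le> inverse (real (Suc n))"
      using that by (intro vabs_sum_le) (auto simp: F_def)
    finally show ?thesis .
  qed
  have mono: "F m \<subseteq> F n" if "m \<le> n" for m n
  proof -
    have le: "inverse (real (Suc n)) \<le> inverse (real (Suc m))"
      using that by (intro le_imp_inverse_le) auto
    show ?thesis
    proof
      fix x assume "x \<in> F m"
      thus "x \<in> F n" using order_trans[OF le] by (simp add: F_def)
    qed
  qed
  have "Cauchy (\<lambda>n. sum f (F n))"
  proof (rule CauchyI')
    fix e :: real assume "e > 0"
    then obtain M where M: "inverse (real (Suc M)) < e" using reals_Archimedean by blast
    have "dist (sum f (F m)) (sum f (F n)) < e" if "m \<ge> M" "m < n" for m n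
    proof -
      have "dist (sum f (F m)) (sum f (F n)) \<le> inverse (real (Suc m))"
      proof -
        have "dist (sum f (F m)) (sum f (F n)) = vabs (sum f (F n) - sum f (F m))"
          by (metis dist_commute dist_vabs)
        thus ?thesis using tail[OF finF mono FA, of m n] that by simp
      qed
      also have "\<dots> \<le> inverse (real (Suc M))"
        using that by (intro le_imp_inverse_le) auto
      finally show ?thesis using M by simp
    qed
    thus "\<exists>M. \<forall>m\<ge>M. \<forall>n>m. dist (sum f (F m)) (sum f (F n)) < e" by blast
  qed
  then obtain L where L: "(\<lambda>n. sum f (F n)) \<longlonglongrightarrow> L"
    using Cauchy_convergent convergent_def by blast
  have "(sum f \<longlongrightarrow> L) (finite_subsets_at_top A)"
  proof (rule tendstoI)
    fix e :: real assume e: "e > 0"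
    then obtain M where M: "inverse (real (Suc M)) < e" using reals_Archimedean by blast
    obtain n where n: "n \<ge> M" "dist (sum f (F n)) L < e"
      using metric_LIMSEQ_D[OF L e] by (meson nle_le)
    have "dist (sum f G) L < e" if "finite G" "F n \<subseteq> G" "G \<subseteq> A" for G
    proof -
      have "inverse (real (Suc n)) \<le> inverse (real (Suc M))"
        using n by (intro le_imp_inverse_le) auto
      hence "vabs (sum f G - sum f (F n)) < e" using tail[OF that] M by linarith
      moreover have "vabs (sum f (F n) - L) < e" using n by (simp add: dist_vabs)
      moreover have "sum f G - L = (sum f G - sum f (F n)) + (sum f (F n) - L)" by simp
      ultimately show ?thesis
        unfolding dist_vabs by (metis vabs_add le_less_trans max_less_iff_conj)
    qed
    thus "eventually (\<lambda>G. dist (sum f G) L < e) (finite_subsets_at_top A)"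
      unfolding eventually_finite_subsets_at_top
      by (intro exI[of _ "F n"] conjI allI impI finF FA) (elim conjE)
  qed
  thus ?thesis using that by (simp add: has_sum_def)
qed

lemma vabs_infsum_dominant:
  fixes f :: "'i \<Rightarrow> 'a::{nonarch_field, complete_space}"
  assumes "\<And>e. e > 0 \<Longrightarrow> finite {x \<in> A. vabs (f x) \<ge> e}"
    and x0: "x0 \<in> A" and B: "B \<ge> 0" "\<And>x. x \<in> A \<Longrightarrow> x \<noteq> x0 \<Longrightarrow> vabs (f x) \<le> B"
  shows "vabs (infsum f A - f x0) \<le> B"
proof -
  obtain L where L: "(f has_sum L) A" using nonarch_has_sum[OF assms(1)] by blast
  have "vabs (L - f x0) \<le> B + e" if e: "e > 0" for e
  proof -
    have "eventually (\<lambda>G. dist (sum f G) L < e) (finite_subsets_at_top A)"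
      using L e unfolding has_sum_def tendsto_iff by blast
    then obtain G0 where G0: "finite G0" "G0 \<subseteq> A"
      "\<forall>G. finite G \<and> G0 \<subseteq> G \<and> G \<subseteq> A \<longrightarrow> dist (sum f G) L < e"
      unfolding eventually_finite_subsets_at_top by (elim exE conjE) (rule that)
    define G where "G = insert x0 G0"
    have G: "finite G" "G0 \<subseteq> G" "G \<subseteq> A" "x0 \<in> G" using G0 x0 by (auto simp: G_def)
    have 1: "vabs (L - sum f G) < e" using G0(3) G by (simp add: dist_commute flip: dist_vabs)
    have "sum f G - f x0 = sum f (G - {x0})" using G by (simp add: sum_diff1)
    moreover have "vabs (sum f (G - {x0})) \<le> B"
      using G(3) B by (intro vabs_sum_le) auto
    ultimately have "vabs (sum f G - f x0) \<le> B" by simp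
    hence "vabs ((L - sum f G) + (sum f G - f x0)) \<le> B + e"
      using 1 e B(1) by (intro vabs_add_le) auto
    thus ?thesis by simp
  qed
  hence "vabs (L - f x0) \<le> B" by (rule field_le_epsilon)
  thus ?thesis using infsumI[OF L] by simp
qed

section \<open>Minors of a factored matrix\<close>

text \<open>Composition with the transposition of the two rows flips all signs, so the minor is its
  own negative, and 2 is not 0.\<close>

lemma minor_repeated_row:
  fixes C :: "'i \<Rightarrow> 'i \<Rightarrow> 'a::field_char_0"
  assumes "finite S" "a \<in> S" "b \<in> S" "a \<noteq> b" "\<And>j. C a j = C b j"
  shows "minor C S = 0"
proof -
  define t where "t = Transposition.transpose a b"
  have t: "t permutes S" using assms by (simp add: t_def permutes_swap_id)
  have tt: "t \<circ> t = id" by (simp add: t_def)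
  have Ct: "C (t i) j = C i j" for i j
  proof (cases "i = a \<or> i = b")
    case True
    thus ?thesis using assms(5)[of j] by (auto simp: t_def)
  next
    case False
    thus ?thesis by (simp add: t_def)
  qed
  have "minor C S = (\<Sum>p | p permutes S. of_int (sign (p \<circ> t)) * (\<Prod>i\<in>S. C i ((p \<circ> t) i)))"
    unfolding minor_def
    by (rule sum.reindex_bij_witness[of _ "\<lambda>p. p \<circ> t" "\<lambda>p. p \<circ> t"])
       (auto simp: o_assoc[symmetric] tt intro: permutes_compose[OF t])
  also have "\<dots> = (\<Sum>p | p permutes S. - (of_int (sign p) * (\<Prod>i\<in>S. C i (p i))))"
  proof (intro sum.cong refl)
    fix p assume "p \<in> {p. p permutes S}"
    hence p: "p permutes S" by simp
    have "sign (p \<circ> t) = sign p * sign t"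
      using p t assms(1) permutation_permutes by (intro sign_compose) blast+
    hence "sign (p \<circ> t) = - sign p"
      using assms(4) by (simp add: t_def sign_swap_id)
    moreover have "(\<Prod>i\<in>S. C i (p i)) = (\<Prod>i\<in>S. C (t i) (p (t i)))"
      using prod.permute[OF t, of "\<lambda>i. C i (p i)"] by (simp add: o_def)
    hence "(\<Prod>i\<in>S. C i ((p \<circ> t) i)) = (\<Prod>i\<in>S. C i (p i))"
      by (simp add: Ct)
    ultimately show "of_int (sign (p \<circ> t)) * (\<Prod>i\<in>S. C i ((p \<circ> t) i)) = - (of_int (sign p) * (\<Prod>i\<in>S. C i (p i)))"
      by simp
  qed
  also have "\<dots> = - minor C S" by (simp add: minor_def sum_negf)
  finally show ?thesis by (simp add: eq_neg_iff_add_eq_0 flip: mult_2)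
qed

text \<open>The Cauchy-Binet expansion before maps with the same image are grouped, which suits
  termwise estimates.\<close>

lemma minor_product:
  fixes L C M :: "nat \<Rightarrow> nat \<Rightarrow> 'a::comm_ring_1"
  assumes S: "finite S" and K: "finite K"
    and M: "\<And>i j. i \<in> S \<Longrightarrow> j \<in> S \<Longrightarrow> M i j = (\<Sum>k\<in>K. L i k * C k j)"
  shows "minor M S = (\<Sum>\<phi>\<in>PiE S (\<lambda>_. K). (\<Prod>i\<in>S. L i (\<phi> i)) * minor (\<lambda>i. C (\<phi> i)) S)"
proof -
  have "minor M S = (\<Sum>p | p permutes S. of_int (sign p) * (\<Prod>i\<in>S. \<Sum>k\<in>K. L i k * C k (p i)))"
    unfolding minor_def by (intro sum.cong arg_cong2[where f = "(*)"] prod.cong refl M) (auto simp: permutes_in_image)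
  also have "\<dots> = (\<Sum>p | p permutes S. \<Sum>\<phi>\<in>PiE S (\<lambda>_. K).
      (\<Prod>i\<in>S. L i (\<phi> i)) * (of_int (sign p) * (\<Prod>i\<in>S. C (\<phi> i) (p i))))"
    unfolding prod_sum_PiE[OF S K] sum_distrib_left prod.distrib
    by (intro sum.cong refl) (simp add: mult_ac)
  also have "\<dots> = (\<Sum>\<phi>\<in>PiE S (\<lambda>_. K). (\<Prod>i\<in>S. L i (\<phi> i)) * minor (\<lambda>i. C (\<phi> i)) S)"
    unfolding minor_def sum_distrib_left by (rule sum.swap)
  finally show ?thesis .
qed

text \<open>A permutation of a set of naturals with p i >= i throughout is the identity; any other
  one meets a zero below the diagonal.\<close>

lemma minor_upper_triangular:
  fixes C :: "nat \<Rightarrow> nat \<Rightarrow> 'a::comm_ring_1"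
  assumes S: "finite S" and C: "\<And>i j. j < i \<Longrightarrow> C i j = 0"
  shows "minor C S = (\<Prod>i\<in>S. C i i)"
proof -
  have "(\<Prod>i\<in>S. C i (p i)) = 0" if p: "p permutes S" "p \<noteq> id" for p
  proof -
    obtain i where "i \<in> S" "p i < i"
      using permutes_natset_ge[OF p(1)] p(2) by (metis not_le)
    thus ?thesis using C S by (auto intro!: prod_zero)
  qed
  hence "minor C S = (\<Sum>p\<in>{id}. of_int (sign p) * (\<Prod>i\<in>S. C i (p i)))"
    unfolding minor_def using S
    by (intro sum.mono_neutral_right) (auto simp: finite_permutations permutes_id)
  thus ?thesis by simp
qed

lemma vabs_minor_le:
  fixes C :: "'i \<Rightarrow> 'i \<Rightarrow> 'a::nonarch_field"
  assumes "\<And>i j. i \<in> S \<Longrightarrow> j \<in> S \<Longrightarrow> vabs (C i j) \<le> b i"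
  shows "vabs (minor C S) \<le> (\<Prod>i\<in>S. b i)"
proof -
  have b: "b i \<ge> 0" if "i \<in> S" for i
    using assms[OF that that] vabs_nonneg order_trans by blast
  show ?thesis
    unfolding minor_def
  proof (rule vabs_sum_le)
    show "(\<Prod>i\<in>S. b i) \<ge> 0" using b by (rule prod_nonneg)
    fix p assume "p \<in> {p. p permutes S}"
    hence "(\<Prod>i\<in>S. vabs (C i (p i))) \<le> (\<Prod>i\<in>S. b i)"
      using assms by (intro prod_mono) (auto simp: permutes_in_image)
    hence "vabs (of_int (sign p) :: 'a) * (\<Prod>i\<in>S. vabs (C i (p i))) \<le> 1 * (\<Prod>i\<in>S. b i)"
      by (intro mult_mono vabs_of_int_le prod_nonneg) auto
    thus "vabs (of_int (sign p) * (\<Prod>i\<in>S. C i (p i))) \<le> (\<Prod>i\<in>S. b i)"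
      by (simp add: vabs_mult vabs_prod)
  qed
qed

text \<open>Remove x = Max T >= Suc m. If x = Suc m, then T is {1..Suc m}; otherwise \<delta> x is
  at most \<delta> (m + 2), and a factor 1/4 is lost.\<close>

lemma prod_quarter_decreasing:
  fixes \<delta> :: "nat \<Rightarrow> real"
  assumes pos: "\<And>k. \<delta> k > 0" and dec: "\<And>k. \<delta> (Suc k) \<le> \<delta> k / 4"
  assumes "finite T" "T \<subseteq> {1..}" "card T = m"
  shows "(\<Prod>k\<in>T. \<delta> k) \<le> (\<Prod>k=1..m. \<delta> k) * (if T = {1..m} then 1 else 1 / 4)"
  using assms(3-)
proof (induction m arbitrary: T)
  case (Suc m)
  have anti: "\<delta> k \<le> \<delta> l" if "l \<le> k" for k l
    using that
  proof (induction k rule: dec_induct)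
    case (step n)
    thus ?case using dec[of n] pos[of n] by linarith
  qed simp
  define x where "x = Max T"
  have ne: "T \<noteq> {}" using Suc.prems by auto
  have x: "x \<in> T" "\<And>y. y \<in> T \<Longrightarrow> y \<le> x" using Suc.prems ne by (auto simp: x_def)
  have sub: "T \<subseteq> {1..x}" using x Suc.prems by auto
  have "Suc m \<le> x" using card_mono[OF _ sub] Suc.prems by simp
  have P0: "(\<Prod>k=1..m. \<delta> k) \<ge> 0" using pos by (simp add: prod_nonneg less_imp_le)
  have "(\<Prod>k\<in>T. \<delta> k) = \<delta> x * (\<Prod>k\<in>T-{x}. \<delta> k)"
    using Suc.prems x by (simp add: prod.remove)
  also have "\<dots> \<le> \<delta> x * ((\<Prod>k=1..m. \<delta> k) * (if T - {x} = {1..m} then 1 else 1 / 4))"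
    using Suc.prems x pos[of x] by (intro mult_left_mono Suc.IH) auto
  also have "\<dots> \<le> \<delta> x * ((\<Prod>k=1..m. \<delta> k) * 1)"
    using P0 pos[of x] by (intro mult_left_mono) auto
  finally have le: "(\<Prod>k\<in>T. \<delta> k) \<le> \<delta> x * (\<Prod>k=1..m. \<delta> k)" by simp
  have "\<delta> x \<le> \<delta> (Suc m) * (if T = {1..Suc m} then 1 else 1 / 4)"
  proof (cases "x = Suc m")
    case True
    have "T = {1..Suc m}" using sub True Suc.prems by (intro card_subset_eq) auto
    thus ?thesis using True by simp
  next
    case False
    hence "\<delta> x \<le> \<delta> (Suc (Suc m))" using \<open>Suc m \<le> x\<close> by (intro anti) auto
    hence "\<delta> x \<le> \<delta> (Suc m) / 4" using dec[of "Suc m"] by linarith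
    thus ?thesis using pos[of "Suc m"] by (auto split: if_splits)
  qed
  hence "\<delta> x * (\<Prod>k=1..m. \<delta> k) \<le> \<delta> (Suc m) * (if T = {1..Suc m} then 1 else 1 / 4) * (\<Prod>k=1..m. \<delta> k)"
    using P0 by (rule mult_right_mono)
  thus ?case using le by (simp add: mult_ac)
qed simp

text \<open>
  Multilinearity in the rows writes a minor of $LC$ as a sum over maps \<open>\<phi>\<close> from \<open>S\<close> to row indices of \<open>C\<close>.
  Row \<open>k\<close> of \<open>C\<close> is divisible by $\delta_k$ and \<open>L\<close> is the identity modulo 2, so only $S = \{1, \dots, m\}$ and
  $\phi = \mathrm{id}$ give a term of the maximal absolute value.
\<close>

lemma vabs_minor_factored:
  fixes L C M :: "nat \<Rightarrow> nat \<Rightarrow> 'a::{nonarch_field, field_char_0}"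
  assumes pos: "\<And>k. \<delta> k > 0" and dec: "\<And>k. \<delta> (Suc k) \<le> \<delta> k / 4"
    and M: "\<And>i j N. i > 0 \<Longrightarrow> j > 0 \<Longrightarrow> j \<le> N \<Longrightarrow> M i j = (\<Sum>k=1..N. L i k * C k j)"
    and L1: "\<And>k. k > 0 \<Longrightarrow> L k k = 1" and L2: "\<And>i k. k > 0 \<Longrightarrow> i \<noteq> k \<Longrightarrow> vabs (L i k) \<le> 1 / 2"
    and C0: "\<And>k j. j < k \<Longrightarrow> C k j = 0" and C1: "\<And>k. k > 0 \<Longrightarrow> vabs (C k k) = \<delta> k"
    and C2: "\<And>k j. k > 0 \<Longrightarrow> vabs (C k j) \<le> \<delta> k"
    and S: "finite S" "S \<subseteq> {1..}" "card S = m"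
  shows "S \<noteq> {1..m} \<Longrightarrow> vabs (minor M S) \<le> (\<Prod>k=1..m. \<delta> k) / 2"
    and "S = {1..m} \<Longrightarrow> vabs (minor M S) = (\<Prod>k=1..m. \<delta> k)"
proof -
  define P where "P = (\<Prod>k=1..m. \<delta> k)"
  have P: "P > 0" using pos by (simp add: P_def prod_pos)
  \<comment> \<open>A cutoff above all of S; the 0 is inserted for the empty S, where m = 0.\<close>
  define N where "N = Max (insert 0 S)"
  have SN: "S \<subseteq> {1..N}" using S by (auto simp: N_def)
  define t where "t \<phi> = (\<Prod>i\<in>S. L i (\<phi> i)) * minor (\<lambda>i. C (\<phi> i)) S" for \<phi>
  have min: "minor M S = (\<Sum>\<phi>\<in>PiE S (\<lambda>_. {1..N}). t \<phi>)"
    unfolding t_def using SN S by (intro minor_product M) auto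
  have L3: "vabs (L i k) \<le> 1" if "k > 0" for i k
    using L1[OF that] L2[OF that, of i] by (cases "i = k") auto
  have t_le: "vabs (t \<phi>) \<le> P / 2"
    if \<phi>: "\<phi> \<in> PiE S (\<lambda>_. {1..N})" "\<not> (\<forall>i\<in>S. \<phi> i = i) \<or> S \<noteq> {1..m}" for \<phi>
  proof (cases "inj_on \<phi> S")
    case False
    then obtain a b where "a \<in> S" "b \<in> S" "a \<noteq> b" "\<phi> a = \<phi> b" by (auto simp: inj_on_def)
    hence "minor (\<lambda>i. C (\<phi> i)) S = 0"
      using S by (intro minor_repeated_row[of S a b]) auto
    thus ?thesis using P by (simp add: t_def)
  next
    case True
    have \<phi>pos: "\<phi> i > 0" if "i \<in> S" for i using \<phi> that by (force simp: PiE_iff)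
    have T: "finite (\<phi> ` S)" "\<phi> ` S \<subseteq> {1..}" "card (\<phi> ` S) = m"
      using S True \<phi>pos by (auto simp: card_image Suc_le_eq)
    have "vabs (minor (\<lambda>i. C (\<phi> i)) S) \<le> (\<Prod>i\<in>S. \<delta> (\<phi> i))"
      using C2 \<phi>pos by (intro vabs_minor_le) auto
    also have "\<dots> = (\<Prod>k\<in>\<phi>`S. \<delta> k)"
      using True by (simp add: prod.reindex)
    also have "\<dots> \<le> P * (if \<phi> ` S = {1..m} then 1 else 1 / 4)"
      unfolding P_def using T by (intro prod_quarter_decreasing pos dec)
    finally have m: "vabs (minor (\<lambda>i. C (\<phi> i)) S) \<le> P * (if \<phi> ` S = {1..m} then 1 else 1 / 4)" .
    have l: "vabs (\<Prod>i\<in>S. L i (\<phi> i)) \<le> (if \<phi> ` S = {1..m} then 1 / 2 else 1)"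
    proof (cases "\<phi> ` S = {1..m}")
      case True
      \<comment> \<open>If \<phi> fixed S pointwise, then S would be its image {1..m}, contrary to
        the assumption on \<phi>.\<close>
      have "\<not> (\<forall>i\<in>S. \<phi> i = i)" using \<phi>(2) True by auto
      then obtain i where i: "i \<in> S" "\<phi> i \<noteq> i" by blast
      have "vabs (\<Prod>i\<in>S. L i (\<phi> i)) = vabs (L i (\<phi> i)) * (\<Prod>i\<in>S-{i}. vabs (L i (\<phi> i)))"
        unfolding vabs_prod using S(1) i(1) by (rule prod.remove)
      also have "\<dots> \<le> 1 / 2 * 1"
        using i \<phi>pos L2 L3 by (intro mult_mono prod_le_1 prod_nonneg) auto
      finally show ?thesis using True by simp
    next
      case False
      have "(\<Prod>i\<in>S. vabs (L i (\<phi> i))) \<le> 1"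
        using \<phi>pos L3 by (intro prod_le_1) auto
      thus ?thesis using False by (simp add: vabs_prod)
    qed
    have "vabs (t \<phi>) \<le> (if \<phi> ` S = {1..m} then 1 / 2 else 1) * (P * (if \<phi> ` S = {1..m} then 1 else 1 / 4))"
      unfolding t_def vabs_mult using l m by (intro mult_mono) auto
    \<comment> \<open>The loss is 1/2 from L when the image is {1..m}, and 1/4 from the row factors
      otherwise.\<close>
    also have "\<dots> \<le> P / 2" using P by auto
    finally show ?thesis .
  qed
  show "vabs (minor M S) \<le> (\<Prod>k=1..m. \<delta> k) / 2" if "S \<noteq> {1..m}"
    unfolding min P_def[symmetric] using P that t_le by (intro vabs_sum_le) auto
  show "vabs (minor M S) = (\<Prod>k=1..m. \<delta> k)" if Sm: "S = {1..m}"
  proof -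
    \<comment> \<open>The identity as an element of \<open>PiE\<close>, hence
      \<open>undefined\<close> outside S.\<close>
    define \<phi>0 where "\<phi>0 = restrict (\<lambda>i. i) S"
    have \<phi>0: "\<phi>0 \<in> PiE S (\<lambda>_. {1..N})" using SN by (auto simp: \<phi>0_def)
    have "(\<Prod>i\<in>S. L i (\<phi>0 i)) = (\<Prod>i\<in>S. 1)"
      using S L1 by (intro prod.cong) (auto simp: \<phi>0_def)
    moreover have "minor (\<lambda>i. C (\<phi>0 i)) S = minor C S"
      unfolding minor_def by (intro sum.cong arg_cong2[where f = "(*)"] prod.cong refl) (auto simp: \<phi>0_def)
    moreover have "minor C S = (\<Prod>i\<in>S. C i i)" using S C0 by (intro minor_upper_triangular)
    ultimately have t0: "t \<phi>0 = (\<Prod>i\<in>S. C i i)" by (simp add: t_def)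
    have vt0: "vabs (t \<phi>0) = P"
      unfolding t0 vabs_prod P_def Sm using C1 by (intro prod.cong) auto
    have "minor M S = t \<phi>0 + (\<Sum>\<phi>\<in>PiE S (\<lambda>_. {1..N}) - {\<phi>0}. t \<phi>)"
      unfolding min using S \<phi>0 by (intro sum.remove finite_PiE) auto
    moreover have "vabs (\<Sum>\<phi>\<in>PiE S (\<lambda>_. {1..N}) - {\<phi>0}. t \<phi>) \<le> P / 2"
    proof (intro vabs_sum_le)
      fix \<phi> assume \<phi>: "\<phi> \<in> PiE S (\<lambda>_. {1..N}) - {\<phi>0}"
      have "\<not> (\<forall>i\<in>S. \<phi> i = i)"
      proof
        assume "\<forall>i\<in>S. \<phi> i = i"
        hence "\<phi> = \<phi>0" using \<phi> by (auto simp: \<phi>0_def PiE_iff extensional_def fun_eq_iff)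
        thus False using \<phi> by simp
      qed
      thus "vabs (t \<phi>) \<le> P / 2" using \<phi> by (intro t_le) auto
    qed (use P in auto)
    hence "vabs (\<Sum>\<phi>\<in>PiE S (\<lambda>_. {1..N}) - {\<phi>0}. t \<phi>) < vabs (t \<phi>0)"
      using P vt0 by linarith
    ultimately have "vabs (minor M S) = vabs (t \<phi>0)" by (simp add: vabs_add_eq)
    thus ?thesis by (simp add: vt0 P_def)
  qed
qed

section \<open>The characteristic series\<close>

lemma slope_abs_antimono: "l \<le> k \<Longrightarrow> slope_abs k \<le> slope_abs l"
proof (induction k rule: dec_induct)
  case (step n)
  thus ?case using slope_abs_Suc[of n] slope_abs_pos[of n] by linarith
qed simp

lemma slope_abs_le: "slope_abs k \<le> (1 / 4) ^ k"
proof (induction k)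
  case 0
  show ?case by (simp add: slope_abs_eq wfact_def)
next
  case (Suc k)
  thus ?case using slope_abs_Suc[of k] by simp
qed

text \<open>Row i tends to 0 uniformly in j, which expresses compactness of U: a non-zero
  \<open>Lmat i k\<close> has 2 k >= i, and \<open>Cmat k j\<close> is bounded by
  \<open>slope_abs k\<close>.\<close>

lemma vabs_Umat_le:
  assumes "i > 0" "j > 0"
  shows "vabs (Umat i j :: Q2) \<le> slope_abs (i div 2)"
  unfolding Umat_factorization[OF assms order_refl]
proof (rule vabs_sum_le)
  fix k assume "k \<in> {1..j}"
  hence k: "k > 0" by simp
  show "vabs (Lmat i k * Cmat k j :: Q2) \<le> slope_abs (i div 2)"
  proof (cases "2 * k < i")
    case False
    have "vabs (Lmat i k * Cmat k j :: Q2) \<le> 1 * slope_abs k"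
      unfolding vabs_mult slope_abs_def by (intro mult_mono vabs_Lmat_le_1 vabs_Cmat_le k) auto
    also have "\<dots> \<le> slope_abs (i div 2)"
      using False by (auto intro: slope_abs_antimono)
    finally show ?thesis .
  qed (simp add: Lmat_eq_0 less_imp_le)
qed (simp add: less_imp_le)

text \<open>The minor over {1..m} is at least twice as large as every other one, so it alone
  determines the absolute value of the infinite sum.\<close>

lemma vabs_U_char_series: "vabs (fps_nth U_char_series m) = (\<Prod>k=1..m. slope_abs k)"
proof -
  define I where "I = {S :: nat set. S \<subseteq> {1..} \<and> finite S \<and> card S = m}"
  define f :: "nat set \<Rightarrow> Q2" where "f S = minor Umat S" for S
  have f: "minor (\<lambda>i j. g_coeffs (U_op (g_q ^ j)) i) S = (f S :: Q2)" if "S \<in> I" for S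
    unfolding f_def minor_def
  proof (intro sum.cong arg_cong2[where f = "(*)"] prod.cong refl)
    fix p i assume "p \<in> {p. p permutes S}" "i \<in> S"
    hence "p i > 0" using that by (auto simp: I_def permutes_in_image subset_iff Suc_le_eq)
    thus "g_coeffs (U_op (g_q ^ p i)) i = Umat i (p i)" by (rule g_coeffs_U_op)
  qed
  note vm = vabs_minor_factored[where L = "Lmat :: _ \<Rightarrow> _ \<Rightarrow> Q2" and C = Cmat and M = Umat and \<delta> = slope_abs,
      OF slope_abs_pos slope_abs_Suc Umat_factorization Lmat_diag vabs_Lmat_le_half Cmat_eq_0 _ 
        vabs_Cmat_le[folded slope_abs_def]]
  have le: "vabs (f S) \<le> (\<Prod>k=1..m. slope_abs k) / 2" if "S \<in> I" "S \<noteq> {1..m}" for S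
    unfolding f_def using that by (intro vm(1)) (auto simp: I_def Cmat_diag slope_abs_def)
  have eq: "vabs (f {1..m}) = (\<Prod>k=1..m. slope_abs k)"
    unfolding f_def by (intro vm(2)) (auto simp: Cmat_diag slope_abs_def)
  have fin: "finite {S \<in> I. vabs (f S) \<ge> e}" if e: "e > 0" for e
  proof -
    obtain N where N: "(1 / 4) ^ N < e" using e real_arch_pow_inv[of e "1/4"] by auto
    \<comment> \<open>A minor is at most the product of its row bounds, all at most 1, so a single
      large index in S makes it small.\<close>
    have "S \<subseteq> {..2 * N}" if S: "S \<in> I" "vabs (f S) \<ge> e" for S
    proof
      fix i assume i: "i \<in> S"
      have S': "finite S" "\<And>i. i \<in> S \<Longrightarrow> i > 0" using S(1) by (auto simp: I_def subset_iff Suc_le_eq)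
      have s1: "slope_abs k \<le> 1" for k
        using slope_abs_le[of k] power_le_one[of "1/4::real" k] by linarith
      have "vabs (f S) \<le> (\<Prod>i\<in>S. slope_abs (i div 2))"
        unfolding f_def using S' by (intro vabs_minor_le vabs_Umat_le) auto
      also have "\<dots> = slope_abs (i div 2) * (\<Prod>i\<in>S-{i}. slope_abs (i div 2))"
        using S'(1) i by (rule prod.remove)
      also have "\<dots> \<le> slope_abs (i div 2) * 1"
        using s1 by (intro mult_left_mono prod_le_1) (auto simp: less_imp_le)
      finally have "(1 / 4) ^ N < slope_abs (i div 2)" using S(2) N by simp
      also have "\<dots> \<le> (1 / 4) ^ (i div 2)" by (rule slope_abs_le)
      finally have "i div 2 < N" by (simp add: power_strict_decreasing_iff)
      thus "i \<in> {..2 * N}" by simp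
    qed
    hence "{S \<in> I. vabs (f S) \<ge> e} \<subseteq> Pow {..2 * N}" by blast
    thus ?thesis by (rule finite_subset) simp
  qed
  have P: "(\<Prod>k=1..m. slope_abs k) > 0" by (simp add: prod_pos)
  have inf: "vabs (infsum f I - f {1..m}) \<le> (\<Prod>k=1..m. slope_abs k) / 2"
    using P le fin by (intro vabs_infsum_dominant) (auto simp: I_def)
  have "infsum f I = f {1..m} + (infsum f I - f {1..m})" by simp
  also have "vabs \<dots> = vabs (f {1..m})"
    using inf P unfolding eq[symmetric] by (intro vabs_add_eq) linarith
  finally have "vabs (infsum f I) = (\<Prod>k=1..m. slope_abs k)" unfolding eq .
  moreover have "fps_nth U_char_series m = (-1) ^ m * infsum f I"
    unfolding U_char_series_def fredholm_det_def fps_nth_Abs_fps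
    unfolding I_def[symmetric] using f by (simp cong: infsum_cong)
  ultimately show ?thesis by (simp add: vabs_mult vabs_power)
qed

section \<open>Non-archimedean power series\<close>

lemma nonarch_tendsto_iff:
  "f \<longlonglongrightarrow> L \<longleftrightarrow> (\<forall>e>0. \<exists>N. \<forall>n\<ge>N. vabs (f n - L :: 'a::nonarch_field) < e)"
  unfolding lim_sequentially dist_vabs ..

text \<open>The class \<open>nonarch_field\<close> carries a metric and an ultrametric absolute
  value; linearity of limits is derived from the latter.\<close>

lemma nonarch_sums_diff:
  fixes f g :: "nat \<Rightarrow> 'a::nonarch_field"
  assumes "f sums a" "g sums b"
  shows "(\<lambda>n. f n - g n) sums (a - b)"
  unfolding sums_def nonarch_tendsto_iff
proof (intro allI impI)
  fix e :: real assume e: "e > 0"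
  obtain M N where M: "\<And>n. n \<ge> M \<Longrightarrow> vabs (sum f {..<n} - a) < e"
    and N: "\<And>n. n \<ge> N \<Longrightarrow> vabs (sum g {..<n} - b) < e"
    using assms e unfolding sums_def nonarch_tendsto_iff by blast
  have "vabs ((\<Sum>i<n. f i - g i) - (a - b)) < e" if n: "n \<ge> max M N" for n
  proof -
    have "(\<Sum>i<n. f i - g i) - (a - b) = (sum f {..<n} - a) - (sum g {..<n} - b)"
      by (simp add: sum_subtractf)
    also have "vabs \<dots> < e"
      using vabs_diff[of "sum f {..<n} - a" "sum g {..<n} - b"] M[of n] N[of n] n by simp
    finally show ?thesis .
  qed
  thus "\<exists>N. \<forall>n\<ge>N. vabs ((\<Sum>i<n. f i - g i) - (a - b)) < e" by blast
qed

lemma nonarch_sums_mult: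
  fixes f :: "nat \<Rightarrow> 'a::nonarch_field"
  assumes "f sums a"
  shows "(\<lambda>n. z * f n) sums (z * a)"
  unfolding sums_def nonarch_tendsto_iff
proof (intro allI impI)
  fix e :: real assume e: "e > 0"
  show "\<exists>N. \<forall>n\<ge>N. vabs ((\<Sum>i<n. z * f i) - z * a) < e"
  proof (cases "z = 0")
    case False
    hence z: "vabs z > 0" by simp
    then obtain N where N: "\<And>n. n \<ge> N \<Longrightarrow> vabs (sum f {..<n} - a) < e / vabs z"
      using assms e unfolding sums_def nonarch_tendsto_iff by (meson divide_pos_pos)
    have "vabs ((\<Sum>i<n. z * f i) - z * a) < e" if "n \<ge> N" for n
    proof -
      have "(\<Sum>i<n. z * f i) - z * a = z * (sum f {..<n} - a)"
        by (simp add: sum_distrib_left right_diff_distrib)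
      thus ?thesis using N[OF that] z by (simp only: vabs_mult) (simp add: field_simps)
    qed
    thus ?thesis by blast
  qed (use e in auto)
qed

lemma nonarch_sums_Suc:
  fixes f :: "nat \<Rightarrow> 'a::nonarch_field"
  assumes "f 0 = 0" "(\<lambda>n. f (Suc n)) sums s"
  shows "f sums s"
proof -
  have "(\<lambda>n. sum f {..<Suc n}) \<longlonglongrightarrow> s"
    using assms unfolding sums_def by (simp add: sum.lessThan_Suc_shift del: sum.lessThan_Suc)
  thus ?thesis unfolding sums_def by (rule LIMSEQ_imp_Suc)
qed

lemma nonarch_summable:
  fixes f :: "nat \<Rightarrow> 'a::{nonarch_field, complete_space}"
  assumes "(\<lambda>n. vabs (f n)) \<longlonglongrightarrow> 0"
  shows "summable f"
proof -
  have "Cauchy (\<lambda>n. sum f {..<n})"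
  proof (rule CauchyI')
    fix e :: real assume e: "e > 0"
    hence "eventually (\<lambda>n. vabs (f n) < e / 2) sequentially"
      using assms by (intro order_tendstoD) auto
    then obtain N where N: "\<And>n. n \<ge> N \<Longrightarrow> vabs (f n) < e / 2"
      by (auto simp: eventually_sequentially)
    have "dist (sum f {..<m}) (sum f {..<n}) < e" if "m \<ge> N" "m < n" for m n
    proof -
      have "sum f {..<n} - sum f {..<m} = sum f ({..<n} - {..<m})"
        using that by (subst sum_diff) auto
      also have "vabs \<dots> \<le> e / 2"
        using N that e by (intro vabs_sum_le) (auto intro: less_imp_le)
      finally show ?thesis
        using e by (metis dist_commute dist_vabs field_sum_of_halves le_less_trans less_add_same_cancel2 half_gt_zero)
    qed
    thus "\<exists>M. \<forall>m\<ge>M. \<forall>n>m. dist (sum f {..<m}) (sum f {..<n}) < e" by blast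
  qed
  thus ?thesis unfolding summable_iff_convergent by (rule Cauchy_convergent)
qed

lemma vabs_suminf_diff_le:
  fixes f :: "nat \<Rightarrow> 'a::{nonarch_field, complete_space}"
  assumes lim: "(\<lambda>n. vabs (f n)) \<longlonglongrightarrow> 0"
    and F: "finite F" and B: "B \<ge> 0" "\<And>m. m \<notin> F \<Longrightarrow> vabs (f m) \<le> B"
  shows "vabs (suminf f - sum f F) \<le> B"
proof (rule field_le_epsilon)
  fix e :: real assume e: "e > 0"
  have "(\<lambda>n. sum f {..<n}) \<longlonglongrightarrow> suminf f"
    using summable_LIMSEQ[OF nonarch_summable[OF lim]] .
  then obtain N where N: "\<And>n. n \<ge> N \<Longrightarrow> vabs (sum f {..<n} - suminf f) < e"
    using e unfolding nonarch_tendsto_iff by blast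
  obtain M where M: "F \<subseteq> {..<M}" using F finite_nat_set_iff_bounded by auto
  define n where "n = max M N"
  have "F \<subseteq> {..<n}" using M by (auto simp: n_def)
  hence "sum f {..<n} - sum f F = sum f ({..<n} - F)" using F by (simp add: sum_diff)
  also have "vabs \<dots> \<le> B" using B by (intro vabs_sum_le) auto
  finally have "vabs ((suminf f - sum f {..<n}) + (sum f {..<n} - sum f F)) \<le> B + e"
    using N[of n] e B(1) unfolding vabs_minus_commute[of "sum f {..<n}" "suminf f"]
    by (intro vabs_add_le) (auto simp: n_def)
  thus "vabs (suminf f - sum f F) \<le> B + e" by simp
qed

text \<open>The cofactor of x - y has absolute value at most r^(k-1). Writing
  \<open>r ^ k / r\<close> covers k = 0 as well.\<close>

lemma vabs_power_diff_le:
  fixes x y :: "'a::nonarch_field"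
  assumes "vabs x = r" "vabs y = r" "r > 0"
  shows "vabs (x ^ k - y ^ k) \<le> vabs (x - y) * (r ^ k / r)"
proof (induction k)
  case (Suc k)
  have "x ^ Suc k - y ^ Suc k = x * (x ^ k - y ^ k) + (x - y) * y ^ k"
    by (simp add: algebra_simps)
  also have "vabs \<dots> \<le> vabs (x - y) * (r ^ Suc k / r)"
  proof (rule vabs_add_le)
    show "vabs (x * (x ^ k - y ^ k)) \<le> vabs (x - y) * (r ^ Suc k / r)"
      using mult_left_mono[OF Suc, of r] assms unfolding vabs_mult by (simp add: field_simps)
    show "vabs ((x - y) * y ^ k) \<le> vabs (x - y) * (r ^ Suc k / r)"
      using assms by (simp add: vabs_mult vabs_power)
  qed
  finally show ?case .
qed (use assms in simp)

text \<open>Needed for either sign of m - l: the contraction below divides the terms of the series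
  by x^(n-1).\<close>

lemma vabs_power_quot_diff_le:
  fixes x y :: "'a::nonarch_field"
  assumes "vabs x = r" "vabs y = r" "r > 0"
  shows "vabs (x ^ m / x ^ l - y ^ m / y ^ l) \<le> vabs (x - y) * (r ^ m / (r ^ l * r))"
proof -
  have nz: "x \<noteq> 0" "y \<noteq> 0" using assms by auto
  show ?thesis
  proof (cases "l \<le> m")
    case True
    then obtain k where k: "m = l + k" using le_Suc_ex by blast
    have "x ^ m / x ^ l - y ^ m / y ^ l = x ^ k - y ^ k"
      using nz by (simp add: k power_add)
    moreover have "r ^ m / (r ^ l * r) = r ^ k / r" using assms(3) by (simp add: k power_add)
    ultimately show ?thesis using vabs_power_diff_le[OF assms, of k] by simp
  next
    case False
    then obtain k where k: "l = m + k" using nat_le_linear le_Suc_ex by blast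
    have "x ^ m / x ^ l - y ^ m / y ^ l = - ((x ^ k - y ^ k) / (x ^ k * y ^ k))"
      using nz by (simp add: k power_add field_simps)
    hence "vabs (x ^ m / x ^ l - y ^ m / y ^ l) = vabs (x ^ k - y ^ k) / (r ^ k * r ^ k)"
      using assms(1,2) by (simp add: vabs_divide vabs_mult vabs_power)
    also have "\<dots> \<le> vabs (x - y) * (r ^ k / r) / (r ^ k * r ^ k)"
      using assms(3) by (intro divide_right_mono vabs_power_diff_le assms) auto
    also have "\<dots> = vabs (x - y) * (r ^ m / (r ^ l * r))"
      using assms(3) by (simp add: k power_add field_simps)
    finally show ?thesis .
  qed
qed

section \<open>Zeros of a power series with a steep Newton polygon\<close>

text \<open>The characteristic series seen over the larger field. In its Newton polygon each
  \<open>\<delta> k\<close> with k >= 1 contributes one segment of length 1, and the factor 4 keeps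
  the slopes well apart.\<close>

locale steep_series =
  fixes c :: "nat \<Rightarrow> 'c::{nonarch_field, complete_space}" and \<delta> :: "nat \<Rightarrow> real"
  assumes \<delta>_pos: "\<delta> k > 0" and \<delta>_Suc: "\<delta> (Suc k) \<le> \<delta> k / 4"
    and vabs_c: "vabs (c m) = (\<Prod>k=1..m. \<delta> k)"
begin

lemma \<delta>_nonneg [simp]: "\<delta> k \<ge> 0"
  using \<delta>_pos[of k] by simp

lemma \<delta>_antimono: "l \<le> k \<Longrightarrow> \<delta> k \<le> \<delta> l"
proof (induction k rule: dec_induct)
  case (step n)
  thus ?case using \<delta>_Suc[of n] \<delta>_pos[of n] by linarith
qed simp

lemma \<delta>_less: "l < k \<Longrightarrow> \<delta> k < \<delta> l"
  using \<delta>_antimono[of "Suc l" k] \<delta>_Suc[of l] \<delta>_pos[of l] by simp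

lemma \<delta>_le: "\<delta> k \<le> \<delta> 0 * (1 / 4) ^ k"
proof (induction k)
  case (Suc k)
  thus ?case using \<delta>_Suc[of k] by simp
qed simp

lemma \<delta>_LIMSEQ: "\<delta> \<longlonglongrightarrow> 0"
proof (rule tendsto_sandwich[OF _ _ tendsto_const])
  show "(\<lambda>k. \<delta> 0 * (1 / 4) ^ k) \<longlonglongrightarrow> 0"
    by (intro tendsto_mult_right_zero LIMSEQ_power_zero) simp
qed (auto simp: \<delta>_le)

text \<open>The size of the term of index m on the sphere of radius r; consecutive sizes have the
  ratio \<open>\<delta> (Suc m) * r\<close>, which decreases with m.\<close>

definition w :: "real \<Rightarrow> nat \<Rightarrow> real" where
  "w r m = (\<Prod>k=1..m. \<delta> k) * r ^ m"

lemma w_eq: "w r m = vabs (c m) * r ^ m"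
  by (simp add: w_def vabs_c)

lemma w_Suc: "w r (Suc m) = (\<delta> (Suc m) * r) * w r m"
  by (simp add: w_def)

lemma w_pos: "r > 0 \<Longrightarrow> w r m > 0"
  by (simp add: w_def prod_pos \<delta>_pos)

lemma vabs_term: "vabs (c m * x ^ m) = w (vabs x) m"
  by (simp add: vabs_mult vabs_power vabs_c w_def)

lemma w_decreasing:
  assumes "r > 0" "\<And>k. k > a \<Longrightarrow> \<delta> k * r \<le> 1" "a \<le> b"
  shows "w r b \<le> w r a"
  using assms(3)
proof (induction b rule: dec_induct)
  case (step n)
  have "w r (Suc n) \<le> 1 * w r n"
    unfolding w_Suc using assms(2)[of "Suc n"] step.hyps w_pos[OF assms(1), of n]
    by (intro mult_right_mono) auto
  thus ?case using step.IH by simp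
qed simp

lemma w_increasing:
  assumes "r > 0" "\<And>k. k \<le> b \<Longrightarrow> 1 \<le> \<delta> k * r" "a \<le> b"
  shows "w r a \<le> w r b"
  using assms(3,2)
proof (induction b rule: dec_induct)
  case (step n)
  have "1 * w r n \<le> w r (Suc n)"
    unfolding w_Suc using step.prems[of "Suc n"] w_pos[OF assms(1), of n]
    by (intro mult_right_mono) auto
  thus ?case using step.IH step.prems by simp
qed simp

lemma w_LIMSEQ:
  assumes "r > 0"
  shows "w r \<longlonglongrightarrow> 0"
proof (rule summable_LIMSEQ_zero)
  have "(\<lambda>k. \<delta> (Suc k) * r) \<longlonglongrightarrow> 0"
    using LIMSEQ_Suc[OF \<delta>_LIMSEQ] by (rule tendsto_mult_left_zero)
  hence "eventually (\<lambda>k. \<delta> (Suc k) * r < 1 / 2) sequentially"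
    by (rule order_tendstoD) simp
  then obtain N where N: "\<And>k. k \<ge> N \<Longrightarrow> \<delta> (Suc k) * r < 1 / 2"
    by (auto simp: eventually_sequentially)
  show "summable (w r)"
  proof (rule summable_ratio_test)
  show "norm (w r (Suc n)) \<le> 1 / 2 * norm (w r n)" if "n \<ge> N" for n
    using N[OF that] w_pos[OF assms, of n] w_pos[OF assms, of "Suc n"] mult_right_mono[of "\<delta> (Suc n) * r" "1/2" "w r n"]
    by (simp add: w_Suc)
  qed simp
qed

definition P :: "'c fps" where "P = Abs_fps c"

lemma P_sums:
  assumes "x \<noteq> 0"
  shows "(\<lambda>m. c m * x ^ m) sums fps_value P x"
proof -
  have "summable (\<lambda>m. c m * x ^ m)"
    using w_LIMSEQ[of "vabs x"] assms by (intro nonarch_summable) (simp add: vabs_term)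
  thus ?thesis by (simp add: fps_value_def P_def summable_sums)
qed

text \<open>Away from the critical radii 1 / \<delta> n one term strictly dominates, namely that of
  the index \<open>m0\<close> at which the ratio of consecutive sizes falls below 1.\<close>

lemma P_nonzero:
  assumes x: "x \<noteq> 0" and r: "\<And>n. n > 0 \<Longrightarrow> \<delta> n * vabs x \<noteq> 1"
  shows "fps_value P x \<noteq> 0"
proof -
  define r where "r = vabs x"
  have rp: "r > 0" using x by (simp add: r_def)
  have ex: "\<exists>n. \<delta> (Suc n) * r < 1"
  proof -
    have "(\<lambda>k. \<delta> k * r) \<longlonglongrightarrow> 0" using \<delta>_LIMSEQ by (rule tendsto_mult_left_zero)
    hence "eventually (\<lambda>k. \<delta> k * r < 1) sequentially" by (rule order_tendstoD) simp
    thus ?thesis unfolding eventually_sequentially by (meson le_SucI order_refl)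
  qed
  define m0 where "m0 = (LEAST n. \<delta> (Suc n) * r < 1)"
  have m0: "\<delta> (Suc m0) * r < 1" unfolding m0_def using ex by (rule LeastI_ex)
  have m0': "\<delta> n * r > 1" if "n > 0" "n \<le> m0" for n
  proof -
    have "\<not> \<delta> (Suc (n - 1)) * r < 1"
      using that unfolding m0_def by (intro not_less_Least) auto
    thus ?thesis using r[of n] that by (simp add: r_def)
  qed
  \<comment> \<open>The larger of the relative sizes of the two neighbours of the dominant term; for
    m0 = 0 there is no left neighbour.\<close>
  define \<theta> where "\<theta> = max (\<delta> (Suc m0) * r) (if m0 = 0 then 0 else 1 / (\<delta> m0 * r))"
  have \<theta>: "\<theta> < 1" "\<theta> \<ge> 0"
    using m0 m0'[of m0] rp by (auto simp: \<theta>_def le_max_iff_disj)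
  have w0: "w r m0 > 0" by (rule w_pos[OF rp])
  have bound: "w r m \<le> \<theta> * w r m0" if "m \<noteq> m0" for m
  proof (cases "m > m0")
    case True
    have "w r m \<le> w r (Suc m0)"
    proof (rule w_decreasing[OF rp])
      fix k assume "k > Suc m0"
      hence "\<delta> k * r \<le> \<delta> (Suc m0) * r" using rp by (intro mult_right_mono \<delta>_antimono) auto
      thus "\<delta> k * r \<le> 1" using m0 by simp
    qed (use True in simp)
    also have "\<dots> \<le> \<theta> * w r m0"
      unfolding w_Suc \<theta>_def using w0 by (intro mult_right_mono) auto
    finally show ?thesis .
  next
    case False
    with that have m: "m < m0" by simp
    then obtain l where l: "m0 = Suc l" by (cases m0) auto
    have "w r m \<le> w r l"
    proof (cases "m = 0")
      case True
      show ?thesis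
      proof (cases l)
        case (Suc l')
        have "w r 0 \<le> w r n" if "n \<le> l" for n
          using that
        proof (induction n)
          case (Suc n)
          have "1 * w r n \<le> w r (Suc n)"
            unfolding w_Suc using m0'[of "Suc n"] Suc.prems l w_pos[OF rp, of n]
            by (intro mult_right_mono) auto
          thus ?case using Suc by simp
        qed simp
        thus ?thesis using True by simp
      qed (use True in simp)
    next
      case False
      show ?thesis
      proof (rule w_increasing[OF rp])
        fix k assume "k \<le> l"
        hence "\<delta> l * r \<le> \<delta> k * r" using rp by (intro mult_right_mono \<delta>_antimono) auto
        thus "1 \<le> \<delta> k * r" using m0'[of l] False m l by simp
      qed (use m l in simp)
    qed
    also have "w r l = 1 / (\<delta> m0 * r) * w r m0"
      unfolding l w_Suc using \<delta>_pos[of "Suc l"] rp by simp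
    also have "\<dots> \<le> \<theta> * w r m0"
      unfolding \<theta>_def using w0 l by (intro mult_right_mono) auto
    finally show ?thesis .
  qed
  have "vabs (fps_value P x - sum (\<lambda>m. c m * x ^ m) {m0}) \<le> \<theta> * w r m0"
    unfolding sums_unique[OF P_sums[OF x]]
  proof (rule vabs_suminf_diff_le)
    show "(\<lambda>m. vabs (c m * x ^ m)) \<longlonglongrightarrow> 0"
      using w_LIMSEQ[OF rp] by (simp add: vabs_term r_def)
    show "vabs (c m * x ^ m) \<le> \<theta> * w r m0" if "m \<notin> {m0}" for m
      using bound[of m] that by (simp add: vabs_term flip: r_def)
  qed (use \<theta> w0 in auto)
  moreover have "\<theta> * w r m0 < 1 * w r m0"
    using \<theta> w0 by (intro mult_strict_right_mono) auto
  ultimately show ?thesis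
    using vabs_term[of m0 x] by (auto simp: r_def)
qed

section \<open>The critical spheres of radius 1 / \<delta> n\<close>

context
  fixes n :: nat and r :: real
  assumes n: "n > 0" and r: "r = 1 / \<delta> n"
begin

lemma r_pos: "r > 0"
  using \<delta>_pos[of n] by (simp add: r)

text \<open>The radius is chosen so that the terms of index n - 1 and n have equal size.\<close>

lemma w_pred: "w r (n - 1) = w r n"
  using n \<delta>_pos[of n] w_Suc[of r "n - 1"] by (simp add: r)

text \<open>The ratio \<open>\<delta> k * r\<close> equals 1 at k = n and changes by a factor of at
  least 4 per step, so each further term is smaller by that factor.\<close>

lemma w_other:
  assumes "m \<noteq> n" "m \<noteq> n - 1"
  shows "w r m \<le> w r n / 4"
proof (cases "m > n")
  case True
  have "\<delta> (Suc n) * r \<le> 1 / 4"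
    using \<delta>_Suc[of n] \<delta>_pos[of n] by (simp add: r field_simps)
  hence *: "w r (Suc n) \<le> w r n / 4"
    unfolding w_Suc using mult_right_mono[of "\<delta> (Suc n) * r" "1/4" "w r n"] w_pos[OF r_pos, of n] by simp
  have "w r m \<le> w r (Suc n)"
  proof (rule w_decreasing[OF r_pos])
    fix k assume "k > Suc n"
    hence "\<delta> k \<le> \<delta> n" by (intro \<delta>_antimono) auto
    thus "\<delta> k * r \<le> 1" using \<delta>_pos[of n] by (simp add: r field_simps)
  qed (use True in simp)
  thus ?thesis using * by simp
next
  case False
  with assms have m: "m < n - 1" by simp
  then obtain l where l: "n = Suc (Suc l)" by (metis Suc_pred diff_Suc_1 less_nat_zero_code not_gr_zero gr0_implies_Suc n)
  have "w r m \<le> w r l"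
  proof (rule w_increasing[OF r_pos])
    fix k assume "k \<le> l"
    hence "\<delta> n \<le> \<delta> k" by (intro \<delta>_antimono) (simp add: l)
    thus "1 \<le> \<delta> k * r" using \<delta>_pos[of n] by (simp add: r field_simps)
  qed (use m l in simp)
  moreover have "4 * w r l \<le> w r (Suc l)"
  proof -
    have "4 \<le> \<delta> (Suc l) * r"
      using \<delta>_Suc[of "Suc l"] \<delta>_pos[of n] by (simp add: r l field_simps)
    thus ?thesis unfolding w_Suc using w_pos[OF r_pos, of l] by (intro mult_right_mono) auto
  qed
  moreover have "w r (Suc l) = w r n" using w_pred l by simp
  ultimately show ?thesis by simp
qed

lemma c_nonzero: "c m \<noteq> 0"
proof
  assume "c m = 0"
  hence "(\<Prod>k=1..m. \<delta> k) = 0" using vabs_c[of m] by simp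
  moreover have "(\<Prod>k=1..m. \<delta> k) > 0" by (intro prod_pos) (simp add: \<delta>_pos)
  ultimately show False by linarith
qed

text \<open>
  The terms of index \<open>n - 1\<close> and \<open>n\<close> dominate on the sphere of radius \<open>r\<close>, so that
  $x \mapsto x - P(x) / (c_n x^{n-1})$ is a contraction of the sphere whose fixed points are the zeros of $P$.
\<close>

lemma ex1_zero: "\<exists>!x. vabs x = r \<and> fps_value P x = 0"
proof -
  define T where "T x = x - fps_value P x / (c n * x ^ (n - 1))" for x
  define S where "S = {x :: 'c. vabs x = r}"
  have S0: "x \<noteq> 0" if "x \<in> S" for x using that r_pos by (auto simp: S_def)
  \<comment> \<open>The terms of P(x) / (c_n x^(n-1)). That of index n is x itself and that of index
    n - 1 does not depend on x, so neither contributes to T x - T y.\<close>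
  define u where "u x m = 1 / (c n * x ^ (n - 1)) * (c m * x ^ m)" for x m
  have vu: "vabs (u x m) = w r m / w r n * r" if "x \<in> S" for x m
  proof -
    have "w r n = vabs (c n) * r ^ (n - 1) * r"
      using power_Suc[of r "n - 1"] n by (simp add: w_eq)
    thus ?thesis using that r_pos c_nonzero[of n]
      by (simp add: u_def S_def vabs_divide vabs_mult vabs_power w_eq)
  qed
  have u_sums: "u x sums (fps_value P x / (c n * x ^ (n - 1)))" if "x \<in> S" for x
    using nonarch_sums_mult[OF P_sums[OF S0[OF that]], of "1 / (c n * x ^ (n - 1))"]
    unfolding u_def[abs_def] by simp
  have u_n: "u x n = x" if "x \<in> S" for x
    using S0[OF that] c_nonzero[of n] n power_Suc[of x "n - 1"] by (simp add: u_def)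
  have lim: "(\<lambda>m. w r m / w r n * b) \<longlonglongrightarrow> 0" for b
    by (intro tendsto_mult_left_zero tendsto_divide_zero w_LIMSEQ r_pos)
  have wn: "w r n > 0" by (rule w_pos[OF r_pos])
  have other: "w r m / w r n * b \<le> b / 4" if "m \<noteq> n" "m \<noteq> n - 1" "b \<ge> 0" for m b
    using mult_right_mono[OF w_other[OF that(1,2)] that(3)] wn by (simp add: field_simps)
  have TS: "T x \<in> S" if x: "x \<in> S" for x
  proof -
    have "vabs (suminf (u x) - sum (u x) {n - 1, n}) \<le> r / 4"
    proof (rule vabs_suminf_diff_le)
      show "(\<lambda>m. vabs (u x m)) \<longlonglongrightarrow> 0" unfolding vu[OF x] by (rule lim)
      show "vabs (u x m) \<le> r / 4" if "m \<notin> {n - 1, n}" for m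
        unfolding vu[OF x] using that r_pos by (intro other) auto
    qed (use r_pos in auto)
    moreover have "sum (u x) {n - 1, n} = u x (n - 1) + x" using n u_n[OF x] by simp
    moreover have "suminf (u x) = x - T x"
      using sums_unique[OF u_sums[OF x]] by (simp add: T_def)
    ultimately have "vabs (- (T x + u x (n - 1))) \<le> r / 4" by (simp add: algebra_simps)
    hence *: "vabs (T x + u x (n - 1)) \<le> r / 4" by (simp only: vabs_minus)
    \<comment> \<open>T x differs from - u x (n - 1) by at most r/4, hence lies on the same
      sphere.\<close>
    have un: "vabs (u x (n - 1)) = r" using vu[OF x, of "n - 1"] w_pred wn by simp
    have "T x = - u x (n - 1) + (T x + u x (n - 1))" by simp
    also have "vabs \<dots> = vabs (- u x (n - 1))"
      using * un r_pos by (intro vabs_add_eq) simp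
    finally show ?thesis using un by (simp add: S_def)
  qed
  have contr: "dist (T x) (T y) \<le> 1 / 4 * dist x y" if x: "x \<in> S" and y: "y \<in> S" for x y
  proof -
    define v where "v m = u x m - u y m" for m
    have v_sums: "v sums ((x - T x) - (y - T y))"
      using nonarch_sums_diff[OF u_sums[OF x] u_sums[OF y]] unfolding v_def[abs_def] T_def by simp
    have v: "vabs (v m) \<le> w r m / w r n * vabs (x - y)" for m
    proof -
      have "v m = c m / c n * (x ^ m / x ^ (n - 1) - y ^ m / y ^ (n - 1))"
        using S0[OF x] S0[OF y] c_nonzero[of n] by (simp add: v_def u_def field_simps)
      also have "vabs \<dots> \<le> vabs (c m / c n) * (vabs (x - y) * (r ^ m / (r ^ (n - 1) * r)))"
        unfolding vabs_mult[of "c m / c n"] using x y r_pos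
        by (intro mult_left_mono vabs_power_quot_diff_le) (auto simp: S_def)
      also have "r ^ (n - 1) * r = r ^ n" using power_Suc[of r "n - 1"] n by simp
      also have "vabs (c m / c n) * (vabs (x - y) * (r ^ m / r ^ n)) = w r m / w r n * vabs (x - y)"
        by (simp add: vabs_divide w_eq)
      finally show ?thesis .
    qed
    have "vabs (suminf v - sum v {n}) \<le> vabs (x - y) / 4"
    proof (rule vabs_suminf_diff_le)
      show "(\<lambda>m. vabs (v m)) \<longlonglongrightarrow> 0"
      proof (rule tendsto_sandwich[OF _ _ tendsto_const lim[of "vabs (x - y)"]])
        show "eventually (\<lambda>m. vabs (v m) \<le> w r m / w r n * vabs (x - y)) sequentially"
          by (intro always_eventually allI v)
      qed simp
      show "vabs (v m) \<le> vabs (x - y) / 4" if "m \<notin> {n}" for m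
      proof (cases "m = n - 1")
        case True
        have "v m = 0" using S0[OF x] S0[OF y] by (simp add: v_def u_def True)
        thus ?thesis by simp
      next
        case False
        hence "w r m / w r n * vabs (x - y) \<le> vabs (x - y) / 4"
          using that by (intro other) auto
        thus ?thesis using v[of m] by (rule order_trans[rotated])
      qed
    qed auto
    moreover have "suminf v - sum v {n} = - (T x - T y)"
      using sums_unique[OF v_sums, symmetric] u_n[OF x] u_n[OF y] by (simp add: v_def)
    ultimately show ?thesis by (metis dist_vabs mult.commute times_divide_eq_right mult_1_right vabs_minus)
  qed
  have "closed S"
  proof -
    have "S = cball 0 r - ball 0 r" by (auto simp: S_def dist_vabs)
    thus ?thesis by (simp add: closed_Diff)
  qed
  hence "complete S" by (simp add: complete_eq_closed)
  \<comment> \<open>The witness is, up to sign, the zero of the two dominant terms c_(n-1) x^(n-1) +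
    c_n x^n.\<close>
  moreover have "S \<noteq> {}"
  proof -
    have "vabs (c (n - 1) / c n) = r"
    proof -
      have "(\<Prod>k=1..n. \<delta> k) = (\<Prod>k=1..n-1. \<delta> k) * \<delta> n" using n by (cases n) auto
      moreover have "p / (p * \<delta> n) = r" if "p > 0" for p :: real
        using that by (simp add: r)
      moreover have "(\<Prod>k=1..n-1. \<delta> k) > 0" by (intro prod_pos) (simp add: \<delta>_pos)
      ultimately show ?thesis by (simp only: vabs_divide vabs_c)
    qed
    thus ?thesis by (auto simp: S_def)
  qed
  ultimately have "\<exists>!x\<in>S. T x = x"
    using TS contr by (intro Banach_fix[where c = "1 / 4"]) auto
  moreover have "x \<in> S \<and> T x = x \<longleftrightarrow> vabs x = r \<and> fps_value P x = 0" for x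
    using S0[of x] c_nonzero[of n] by (auto simp: T_def S_def)
  ultimately show ?thesis by simp
qed

text \<open>
  In $x P'(x) - (n - 1) P(x)$ the term of index \<open>n - 1\<close> cancels, hence that of index \<open>n\<close> dominates.
\<close>

lemma deriv_nonzero:
  assumes x: "vabs x = r" and zero: "fps_value P x = 0"
  shows "fps_value (fps_deriv P) x \<noteq> 0"
proof -
  have x0: "x \<noteq> 0" using x r_pos by auto
  \<comment> \<open>The factor m - (n - 1) is 0 and 1 at the two dominant indices, and an integer,
    so of absolute value at most 1, elsewhere.\<close>
  define a where "a m = of_nat m * (c m * x ^ m) - of_nat (n - 1) * (c m * x ^ m)" for m
  have va: "vabs (a m) \<le> w r m" for m
  proof -
    have "a m = of_int (int m - int (n - 1)) * (c m * x ^ m)"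
      by (simp add: a_def left_diff_distrib)
    hence "vabs (a m) = vabs (of_int (int m - int (n - 1)) :: 'c) * w r m"
      by (simp only: vabs_mult[of "of_int _"] vabs_term x)
    also have "\<dots> \<le> 1 * w r m"
      using w_pos[OF r_pos, of m] by (intro mult_right_mono vabs_of_int_le) auto
    finally show ?thesis by simp
  qed
  have lim: "(\<lambda>m. vabs (f m)) \<longlonglongrightarrow> 0" if "\<And>m. vabs (f m) \<le> w r m * b" for f :: "nat \<Rightarrow> 'c" and b
    by (rule tendsto_sandwich[OF _ _ tendsto_const tendsto_mult_left_zero[OF w_LIMSEQ[OF r_pos], of b]])
       (auto simp: that)
  have "summable (\<lambda>m. of_nat (Suc m) * c (Suc m) * x ^ m)"
  proof (intro nonarch_summable)
    have "(\<lambda>m. vabs (of_nat m * (c m * x ^ m) / x)) \<longlonglongrightarrow> 0"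
    proof (rule lim[where b = "1 / r"])
      fix m
      have "vabs (of_nat m :: 'c) * w r m / r \<le> 1 * w r m / r"
        using w_pos[OF r_pos, of m] r_pos by (intro divide_right_mono mult_right_mono vabs_of_nat_le) auto
      thus "vabs (of_nat m * (c m * x ^ m) / x) \<le> w r m * (1 / r)"
        by (simp add: vabs_divide vabs_mult[of "of_nat m"] vabs_term x)
    qed
    hence "(\<lambda>m. vabs (of_nat (Suc m) * (c (Suc m) * x ^ Suc m) / x)) \<longlonglongrightarrow> 0"
      by (rule LIMSEQ_Suc)
    thus "(\<lambda>m. vabs (of_nat (Suc m) * c (Suc m) * x ^ m)) \<longlonglongrightarrow> 0"
      using x0 by (simp add: mult.assoc del: of_nat_Suc)
  qed
  hence "(\<lambda>m. of_nat (Suc m) * c (Suc m) * x ^ m) sums fps_value (fps_deriv P) x"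
    by (simp add: fps_value_def P_def summable_sums del: of_nat_Suc)
  from nonarch_sums_mult[OF this, of x]
  have "(\<lambda>m. of_nat (Suc m) * (c (Suc m) * x ^ Suc m)) sums (x * fps_value (fps_deriv P) x)"
    by (simp add: mult_ac del: of_nat_Suc)
  hence 1: "(\<lambda>m. of_nat m * (c m * x ^ m)) sums (x * fps_value (fps_deriv P) x)"
    by (rule nonarch_sums_Suc[where f = "\<lambda>m. of_nat m * (c m * x ^ m)", rotated]) simp
  have "a sums (x * fps_value (fps_deriv P) x - of_nat (n - 1) * fps_value P x)"
    unfolding a_def by (intro nonarch_sums_diff 1 nonarch_sums_mult P_sums x0)
  hence 2: "suminf a = x * fps_value (fps_deriv P) x" by (simp add: zero sums_iff)
  have "vabs (suminf a - sum a {n}) \<le> w r n / 4"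
  proof (rule vabs_suminf_diff_le)
    show "(\<lambda>m. vabs (a m)) \<longlonglongrightarrow> 0" by (rule lim[where b = 1]) (simp add: va)
    show "vabs (a m) \<le> w r n / 4" if "m \<notin> {n}" for m
    proof (cases "m = n - 1")
      case True
      thus ?thesis using w_pos[OF r_pos, of n] by (simp add: a_def)
    next
      case False
      thus ?thesis using that w_other[of m] va[of m] by simp
    qed
  qed (use w_pos[OF r_pos, of n] in auto)
  moreover have "a n = c n * x ^ n"
    using n by (simp add: a_def of_nat_diff algebra_simps flip: left_diff_distrib)
  hence "vabs (a n) = w r n" by (simp add: vabs_term x)
  ultimately have "suminf a \<noteq> 0" using w_pos[OF r_pos, of n] by auto
  thus ?thesis using 2 by auto
qed

end

text \<open>By \<open>P_nonzero\<close> a zero lies on a critical sphere, where the derivative does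
  not vanish, so \<open>LEAST\<close> stops at 1.\<close>

lemma zero_mult_P:
  assumes x: "x \<noteq> 0"
  shows "zero_mult P x = (if fps_value P x = 0 then 1 else 0)"
proof (cases "fps_value P x = 0")
  case False
  thus ?thesis unfolding zero_mult_def by (auto intro!: Least_equality)
next
  case True
  then obtain n where n: "n > 0" "\<delta> n * vabs x = 1" using P_nonzero[OF x] by blast
  hence "fps_value (fps_deriv P) x \<noteq> 0"
    using \<delta>_pos[of n] by (intro deriv_nonzero[OF n(1) refl] True) (simp add: field_simps)
  moreover have "Suc 0 \<le> k" if "fps_value ((fps_deriv ^^ k) P) x \<noteq> 0" for k
    using that True by (cases k) auto
  ultimately show ?thesis
    using True unfolding zero_mult_def by (auto intro!: Least_equality)
qed

definition zero_at :: "nat \<Rightarrow> 'c" where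
  "zero_at n = (THE x. vabs x = 1 / \<delta> n \<and> fps_value P x = 0)"

lemma zero_at:
  assumes "n > 0"
  shows "vabs (zero_at n) = 1 / \<delta> n" "fps_value P (zero_at n) = 0"
  using theI'[OF ex1_zero[OF assms refl]] by (simp_all add: zero_at_def)

lemma zero_at_unique:
  assumes "x \<noteq> 0" "fps_value P x = 0"
  obtains n where "n > 0" "x = zero_at n"
proof -
  obtain n where n: "n > 0" "\<delta> n * vabs x = 1" using P_nonzero[OF assms(1)] assms(2) by blast
  hence "vabs x = 1 / \<delta> n" using \<delta>_pos[of n] by (simp add: field_simps)
  hence "x = zero_at n" using ex1_zero[OF n(1) refl] zero_at[OF n(1)] assms(2) by blast
  thus ?thesis using that n(1) by blast
qed

end

section \<open>The eigenvalues of $U$\<close>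

text \<open>Strict growth gives \<sigma> k >= k, so the preimage of n is at most n, and the smaller
  indices are already fixed.\<close>

lemma strict_mono_surj_eq:
  fixes \<sigma> :: "nat \<Rightarrow> nat"
  assumes pos: "\<And>n. n > 0 \<Longrightarrow> \<sigma> n > 0" and step: "\<And>n. n > 0 \<Longrightarrow> \<sigma> n < \<sigma> (Suc n)"
    and surj: "\<And>k. k > 0 \<Longrightarrow> \<exists>n>0. \<sigma> n = k"
  shows "n > 0 \<Longrightarrow> \<sigma> n = n"
proof (induction n rule: less_induct)
  case (less n)
  have ge: "\<sigma> k \<ge> k" if "k > 0" for k
    using that
  proof (induction k)
    case (Suc k)
    thus ?case using pos[of 1] step[of k] by (cases "k = 0") auto
  qed simp
  obtain k where k: "k > 0" "\<sigma> k = n" using surj[OF less.prems] by blast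
  have "\<not> k < n" using less.IH[of k] k by auto
  moreover have "k \<le> n" using ge[OF k(1)] k(2) by simp
  ultimately show ?case using k by simp
qed

context steep_series
begin

lemma vabs_inverse_zero_at: "n > 0 \<Longrightarrow> vabs (inverse (zero_at n)) = \<delta> n"
  using zero_at(1)[of n] by (simp add: vabs_inverse)

lemma zero_at_nonzero: "n > 0 \<Longrightarrow> zero_at n \<noteq> 0"
  using zero_at(1)[of n] \<delta>_pos[of n] by auto

lemma inj_zero_at:
  assumes "m > 0" "n > 0" "zero_at m = zero_at n"
  shows "m = n"
proof -
  have "\<delta> m = \<delta> n"
    using vabs_inverse_zero_at[OF assms(1)] vabs_inverse_zero_at[OF assms(2)] assms(3) by simp
  thus ?thesis using \<delta>_less[of m n] \<delta>_less[of n m] by (cases m n rule: linorder_cases) auto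
qed

lemma zero_mult_inverse:
  assumes "x \<noteq> 0"
  shows "zero_mult P (inverse x) = (if \<exists>n>0. x = inverse (zero_at n) then 1 else 0)"
proof -
  have "fps_value P (inverse x) = 0 \<longleftrightarrow> (\<exists>n>0. x = inverse (zero_at n))"
  proof
    assume "fps_value P (inverse x) = 0"
    then obtain n where "n > 0" "inverse x = zero_at n" using zero_at_unique[of "inverse x"] assms by auto
    thus "\<exists>n>0. x = inverse (zero_at n)" by (metis inverse_inverse_eq)
  next
    assume "\<exists>n>0. x = inverse (zero_at n)"
    thus "fps_value P (inverse x) = 0" using zero_at(2) by auto
  qed
  thus ?thesis using zero_mult_P[of "inverse x"] assms by simp
qed

lemma inverse_zeros_enumerate:
  assumes "x \<noteq> 0"
  shows "finite {n. n \<ge> 1 \<and> inverse (zero_at n) = x} \<and>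
    card {n. n \<ge> 1 \<and> inverse (zero_at n) = x} = zero_mult P (inverse x)"
proof (cases "\<exists>n>0. x = inverse (zero_at n)")
  case True
  then obtain n where n: "n > 0" "x = inverse (zero_at n)" by blast
  have "{k. k \<ge> 1 \<and> inverse (zero_at k) = x} = {n}"
    using n inj_zero_at by (auto simp: Suc_le_eq)
  moreover have "zero_mult P (inverse x) = 1"
    unfolding zero_mult_inverse[OF assms] using True by (rule if_P)
  ultimately show ?thesis by simp
next
  case False
  hence "\<not> (k \<ge> 1 \<and> inverse (zero_at k) = x)" for k by (metis One_nat_def Suc_le_eq)
  hence "{k. k \<ge> 1 \<and> inverse (zero_at k) = x} = {}" by blast
  moreover have "zero_mult P (inverse x) = 0"
    unfolding zero_mult_inverse[OF assms] using False by (rule if_not_P)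
  ultimately show ?thesis by (simp only: finite.emptyI card.empty simp_thms)
qed

text \<open>Every admissible sequence has the form \<open>inverse (zero_at (\<sigma> n))\<close>.
  Simplicity of the zeros makes \<sigma> a bijection, the ordering by absolute value makes it
  increasing, so it is the identity.\<close>

lemma vabs_eigenvalue:
  assumes nz: "\<forall>n\<ge>1. ev n \<noteq> 0" and dec: "\<forall>n\<ge>1. vabs (ev (Suc n)) \<le> vabs (ev n)"
    and mult: "\<forall>x. x \<noteq> 0 \<longrightarrow> finite {n. n \<ge> 1 \<and> ev n = x} \<and>
        card {n. n \<ge> 1 \<and> ev n = x} = zero_mult P (inverse x)"
    and n: "n \<ge> 1"
  shows "vabs (ev n) = \<delta> n"
proof -
  have "\<exists>k>0. ev n = inverse (zero_at k)" if n: "n > 0" for n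
  proof -
    have x: "ev n \<noteq> 0" using nz n by (simp add: Suc_le_eq)
    have "n \<in> {m. m \<ge> 1 \<and> ev m = ev n}" using n by simp
    hence "zero_mult P (inverse (ev n)) \<noteq> 0"
      using mult[rule_format, OF x] by (metis card_0_eq empty_iff)
    thus ?thesis using zero_mult_inverse[OF x] by (auto split: if_splits)
  qed
  then obtain \<sigma> where \<sigma>: "\<And>n. n > 0 \<Longrightarrow> \<sigma> n > 0" "\<And>n. n > 0 \<Longrightarrow> ev n = inverse (zero_at (\<sigma> n))"
    by metis
  have v: "vabs (ev n) = \<delta> (\<sigma> n)" if "n > 0" for n
    using \<sigma>[OF that] vabs_inverse_zero_at by simp
  have card1: "card {n. n \<ge> 1 \<and> ev n = inverse (zero_at k)} = 1" if k: "k > 0" for k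
  proof -
    have x: "inverse (zero_at k) \<noteq> 0" using zero_at_nonzero[OF k] by simp
    have "zero_mult P (inverse (inverse (zero_at k))) = 1"
      unfolding zero_mult_inverse[OF x] using k by (intro if_P) blast
    thus ?thesis using mult[rule_format, OF x] by simp
  qed
  have inj: "a = b" if ab: "a > 0" "b > 0" "\<sigma> a = \<sigma> b" for a b
  proof -
    obtain c where "{n. n \<ge> 1 \<and> ev n = inverse (zero_at (\<sigma> a))} = {c}"
      using card1[OF \<sigma>(1)[OF ab(1)]] by (auto simp: card_1_singleton_iff)
    moreover have "a \<in> {n. n \<ge> 1 \<and> ev n = inverse (zero_at (\<sigma> a))}"
      "b \<in> {n. n \<ge> 1 \<and> ev n = inverse (zero_at (\<sigma> a))}"
      using ab \<sigma>(2)[of a] \<sigma>(2)[of b] by auto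
    ultimately show ?thesis by (metis singletonD)
  qed
  have "\<sigma> n = n" if "n > 0" for n
  proof (rule strict_mono_surj_eq[OF \<sigma>(1) _ _ that])
    fix n :: nat assume n: "n > 0"
    have "\<delta> (\<sigma> (Suc n)) \<le> \<delta> (\<sigma> n)"
      using dec[rule_format, of n] n v[of n] v[of "Suc n"] by simp
    hence "\<sigma> n \<le> \<sigma> (Suc n)" using \<delta>_less[of "\<sigma> (Suc n)" "\<sigma> n"] by (meson not_le)
    moreover have "\<sigma> n \<noteq> \<sigma> (Suc n)" using inj[of n "Suc n"] n by auto
    ultimately show "\<sigma> n < \<sigma> (Suc n)" by simp
  next
    fix k :: nat assume k: "k > 0"
    obtain n where "{n. n \<ge> 1 \<and> ev n = inverse (zero_at k)} = {n}"
      using card1[OF k] by (auto simp: card_1_singleton_iff)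
    hence n: "n > 0" "ev n = inverse (zero_at k)" by (auto simp: Suc_le_eq)
    hence "zero_at (\<sigma> n) = zero_at k" using \<sigma>(2)[of n] by simp
    hence "\<sigma> n = k" by (rule inj_zero_at[OF \<sigma>(1)[OF n(1)] k])
    thus "\<exists>n>0. \<sigma> n = k" using n by blast
  qed auto
  thus ?thesis using v[of n] n by simp
qed

end

text \<open>Existence is included so that the slope formula is not vacuous; the inverses of the
  \<open>zero_at n\<close> form such a sequence.\<close>

theorem corollary1:
  fixes \<iota> :: "Q2 \<Rightarrow> 'c::{nonarch_field, complete_space}"
  assumes "is_C2 \<iota>"
  shows "(\<exists>ev. is_eigenvalue_seq \<iota> ev) \<and>
    (\<forall>ev. is_eigenvalue_seq \<iota> ev \<longrightarrow>
      (\<forall>n\<ge>1. v2 (ev n) = 1 + 2 * v2 (of_nat (fact (3 * n)) / of_nat (fact n) :: 'c)))"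
proof -
  have \<iota>1: "\<iota> 1 = 1" and \<iota>_add: "\<iota> (x + y) = \<iota> x + \<iota> y" and \<iota>_abs: "vabs (\<iota> x) = vabs x" for x y
    using assms by (simp_all add: is_C2_def)
  have "\<iota> 0 + \<iota> 0 = \<iota> 0" using \<iota>_add[of 0 0] by simp
  hence \<iota>0: "\<iota> 0 = 0" by (metis add_cancel_right_right)
  have \<iota>_of_nat: "\<iota> (of_nat m) = of_nat m" for m
    by (induction m) (simp_all add: \<iota>0 \<iota>1 \<iota>_add)
  \<comment> \<open>Factorials are images of natural numbers under the isometry \<iota>, so their
    absolute values can be computed in \<open>Q2\<close>.\<close>
  have vfact: "vabs (of_nat (fact m) :: 'c) = wfact m" for m
    unfolding wfact_def \<iota>_of_nat[symmetric] \<iota>_abs by simp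
  define c where "c m = \<iota> (fps_nth U_char_series m)" for m
  interpret steep_series c slope_abs
    by standard (rule slope_abs_pos, rule slope_abs_Suc, simp only: c_def \<iota>_abs vabs_U_char_series)
  have P: "Abs_fps (\<lambda>m. \<iota> (fps_nth U_char_series m)) = P" unfolding P_def by (simp add: fps_eq_iff c_def)
  have "is_eigenvalue_seq \<iota> (\<lambda>n. inverse (zero_at n))"
    unfolding is_eigenvalue_seq_def P
    using inverse_zeros_enumerate zero_at_nonzero
    by (auto simp: vabs_inverse_zero_at Suc_le_eq intro: \<delta>_antimono)
  moreover have "v2 (ev n) = 1 + 2 * v2 (of_nat (fact (3 * n)) / of_nat (fact n) :: 'c)"
    if ev: "is_eigenvalue_seq \<iota> ev" and n: "n \<ge> 1" for ev n
  proof -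
    have "vabs (ev n) = slope_abs n"
      using ev n unfolding is_eigenvalue_seq_def P by (intro vabs_eigenvalue) auto
    hence v: "vabs (ev n) = 1 / 2 * (wfact (3 * n) / wfact n) ^ 2"
      by (simp only: slope_abs_eq)
    have "log 2 (1 / 2 * q ^ 2) = 2 * log 2 q - 1" if "q > 0" for q :: real
      using that by (simp add: log_mult log_divide log_nat_power)
    from this[of "wfact (3 * n) / wfact n"] show ?thesis
      unfolding v2_def vabs_divide vfact v by simp
  qed
  ultimately show ?thesis by blast
qed

end
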